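(* View the Poisson-Dirichlet process PD($1$), $(X_1,X_2,\dots)$, as the random multisubset of $(0,1]$ given by $A=\{X_1,X_2,\dots\}$. Then PD($1$) is the unique (in distribution) random multisubset $A$ of $(0,1]$ for which both of the following hold: (i) $T:=\sum_{x\in A}x$ (sum taken with multiplicities) satisfies $\mathbb{P}(T\le 1)=1$; (ii) for each $k=1,2,\dots$, the multi-intensity density of $A$ is given, for distinct $x_1,\dots,x_k\in(0,1]$ with $t:=x_1+\cdots+x_k$, by $$f_k(x_1,\dots,x_k)=\begin{cases}\dfrac{1}{x_1\cdots x_k}&\text{if } t<1,\\[2mm] 0&\text{if } t>1.\end{cases}$$
   Context: Random multisubsets: a multisubset $A$ of $(0,1]$ assigns to each $u\in(0,1]$ a finite nonnegative integer multiplicity; only at most countable multisets are considered. For $S\subset(0,1]$, $|A\cap S|$ denotes the cardinality of the intersection counted with multiplicities. A random multisubset $A$ is specified by the joint distributions of $|A\cap S_1|,\dots,|A\cap S_k|$ for finite collections of Borel sets $S_i\subset(0,1]$ (equivalently, it is a random $\sigma$-finite integer-valued measure on $(0,1]$). Multi-intensity density: a random multisubset $A$ of $(0,1]$ has ($k$-fold) multi-intensity density $f_k$, a function on $(0,1]^k\setminus\bigcup_{1\le i<j\le k}\{x_i=x_j\}$, if for every choice of $k$ pairwise disjoint closed intervals $I_i=[a_i,b_i]\subset(0,1]$, with $B=\prod_{i=1}^k[a_i,b_i]$, $$\mathbb{E}\,|A\cap I_1|\cdots|A\cap I_k|=\int_B f_k(x_1,\dots,x_k)\,dx_1\cdots dx_k.$$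 The value of $f_k$ on the null set $t=1$ is irrelevant. Poisson-Dirichlet process PD($\theta$), $\theta>0$: let $U_1,U_2,\dots$ be independent uniform random variables on $(0,1)$, $V_i=U_i^{1/\theta}$, and $G_1=1-V_1$, $G_2=V_1(1-V_2)$, $G_3=V_1V_2(1-V_3),\dots$. Then PD($\theta$) is the distribution of the sequence obtained by sorting $G_1,G_2,\dots$ into descending order. (Equivalently, it is the Poisson point process with intensity $\theta\,dx/x$ on $(0,1)$ conditioned on the sum of the arrivals being $1$.) *)

theory Defs
  imports "HOL-Probability.Probability"
begin

section \<open>Random multisubsets of the half-open unit interval\<close>

text \<open>A multisubset is represented by its multiplicity function.\<close>

definition multisubset :: "(real \<Rightarrow> nat) \<Rightarrow> bool" where
  "multisubset m \<longleftrightarrow> countable {x. m x \<noteq> 0} \<and> {x. m x \<noteq> 0} \<subseteq> {0<..1}"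

definition mcount :: "(real \<Rightarrow> nat) \<Rightarrow> real set \<Rightarrow> ennreal" where
  "mcount m S = (\<integral>\<^sup>+x. of_nat (m x) \<partial>count_space S)"

definition msum :: "(real \<Rightarrow> nat) \<Rightarrow> ennreal" where
  "msum m = (\<integral>\<^sup>+x. of_nat (m x) * ennreal x \<partial>count_space {0<..1})"

definition random_multisubset :: "'a measure \<Rightarrow> ('a \<Rightarrow> real \<Rightarrow> nat) \<Rightarrow> bool" where
  "random_multisubset M A \<longleftrightarrow>
     prob_space M \<and>
     (\<forall>\<omega>\<in>space M. multisubset (A \<omega>)) \<and>
     (\<forall>S\<in>sets borel. S \<subseteq> {0<..1} \<longrightarrow> (\<lambda>\<omega>. mcount (A \<omega>) S) \<in> borel_measurable M)"

text \<open>Equality in distribution of two random multisubsets, possibly living on different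
  probability spaces: all finite families of counts have the same joint law.\<close>

definition same_distribution ::
  "'a measure \<Rightarrow> ('a \<Rightarrow> real \<Rightarrow> nat) \<Rightarrow> 'b measure \<Rightarrow> ('b \<Rightarrow> real \<Rightarrow> nat) \<Rightarrow> bool" where
  "same_distribution M A N B \<longleftrightarrow>
     (\<forall>(k::nat) S. (\<forall>i<k. S i \<in> sets borel \<and> S i \<subseteq> {0<..1}) \<longrightarrow>
        distr M (PiM {..<k} (\<lambda>_. borel)) (\<lambda>\<omega>. \<lambda>i\<in>{..<k}. mcount (A \<omega>) (S i)) =
        distr N (PiM {..<k} (\<lambda>_. borel)) (\<lambda>\<omega>. \<lambda>i\<in>{..<k}. mcount (B \<omega>) (S i)))"

section \<open>Multi-intensity densities\<close>

text \<open>Points of \<open>k\<close>-dimensional space are functions on \<open>{..<k}\<close>.  The intervals are pairwise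
  disjoint, so the values of \<open>f\<close> on the diagonals never enter.\<close>

definition has_multi_intensity_density ::
  "'a measure \<Rightarrow> ('a \<Rightarrow> real \<Rightarrow> nat) \<Rightarrow> nat \<Rightarrow> ((nat \<Rightarrow> real) \<Rightarrow> ennreal) \<Rightarrow> bool" where
  "has_multi_intensity_density M A k f \<longleftrightarrow>
     f \<in> borel_measurable (PiM {..<k} (\<lambda>_. lborel)) \<and>
     (\<forall>a b. (\<forall>i<k. 0 < a i \<and> a i \<le> b i \<and> b i \<le> 1) \<longrightarrow>
        disjoint_family_on (\<lambda>i. {a i..b i}) {..<k} \<longrightarrow>
        (\<integral>\<^sup>+\<omega>. (\<Prod>i<k. mcount (A \<omega>) {a i..b i}) \<partial>M) =
        (\<integral>\<^sup>+x\<in>(\<Pi>\<^sub>E i\<in>{..<k}. {a i..b i}). f x \<partial>PiM {..<k} (\<lambda>_. lborel)))"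

section \<open>The Poisson--Dirichlet process\<close>

text \<open>Indices start at \<open>0\<close>: with \<open>V i = U i powr (1 / \<theta>)\<close>, the \<open>n\<close>-th entry is
  \<open>V 0 * \<dots> * V (n - 1) * (1 - V n)\<close>.\<close>

definition stick_breaking :: "real \<Rightarrow> (nat \<Rightarrow> real) \<Rightarrow> nat \<Rightarrow> real" where
  "stick_breaking \<theta> U n = (\<Prod>i<n. U i powr (1 / \<theta>)) * (1 - U n powr (1 / \<theta>))"

text \<open>The entry of rank \<open>n\<close> (again from \<open>0\<close>) when a sequence of positive numbers tending to
  \<open>0\<close> is sorted into descending order, repetitions kept.  The stick-breaking sequence is almost
  surely of this kind.\<close>

definition desc_sort :: "(nat \<Rightarrow> real) \<Rightarrow> nat \<Rightarrow> real" where
  "desc_sort x n = Sup {t. n < card {i. t \<le> x i}}"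

text \<open>Hence \<open>desc_sort x\<close> is nonincreasing, and it has exactly as many entries above each
  positive level as \<open>x\<close> has.\<close>

lemma le_desc_sort_iff:
  assumes pos: "\<And>i. 0 < x i" and lim: "x \<longlonglongrightarrow> 0" and t: "0 < t"
  shows "t \<le> desc_sort x n \<longleftrightarrow> n < card {i. t \<le> x i}"
proof -
  let ?S = "{t. n < card {i. t \<le> x i}}"
  have fin: "finite {i. s \<le> x i}" if "0 < s" for s
  proof -
    have "eventually (\<lambda>i. x i < s) sequentially"
      using lim that by (rule order_tendstoD)
    then show ?thesis
      by (simp add: not_less eventually_sequentially_Suc flip: cofinite_eq_sequentially)
         (simp add: eventually_cofinite not_less)
  qed
  have Bpos: "0 < s" if "s \<in> ?S" for s
  proof (rule ccontr)
    assume "\<not> 0 < s"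
    then have "{i. s \<le> x i} = UNIV" using pos by (auto intro: less_imp_le order_trans simp: not_less)
    with that show False by simp
  qed
  obtain K where K: "\<And>i. x i \<le> K"
    using convergent_imp_Bseq[of x] lim by (auto simp: convergent_def Bseq_def abs_le_iff)
  have bdd: "bdd_above ?S"
  proof (rule bdd_aboveI[of _ K])
    fix s assume "s \<in> ?S"
    then have "{i. s \<le> x i} \<noteq> {}" by (metis card.empty mem_Collect_eq not_less_zero)
    then show "s \<le> K" using K order_trans by blast
  qed
  show ?thesis
  proof
    assume "n < card {i. t \<le> x i}"
    then show "t \<le> desc_sort x n" unfolding desc_sort_def by (intro cSup_upper bdd) simp
  next
    assume le: "t \<le> desc_sort x n"
    have ne: "?S \<noteq> {}"
    proof -
      have F: "finite (x ` {..n})" "x ` {..n} \<noteq> {}" by auto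
      have m: "0 < Min (x ` {..n})" using F pos by (simp add: Min_gr_iff)
      have "{..n} \<subseteq> {i. Min (x ` {..n}) \<le> x i}" by auto
      from card_mono[OF fin[OF m] this] show ?thesis by (auto simp: Suc_le_eq)
    qed
    show "n < card {i. t \<le> x i}"
    proof (rule ccontr)
      assume not: "\<not> n < card {i. t \<le> x i}"
      define J where "J = {i. t / 2 \<le> x i \<and> x i < t}"
      have finJ: "finite J" unfolding J_def by (rule finite_subset[OF _ fin[of "t/2"]]) (use t in auto)
      define u where "u = Max (insert (t / 2) (x ` J))"
      have u: "u < t" using finJ t by (auto simp: u_def J_def)
      have "s \<le> u" if "s \<in> ?S" for s
      proof (rule ccontr)
        assume "\<not> s \<le> u"
        then have us: "u < s" by simp
        have "{i. s \<le> x i} \<subseteq> {i. t \<le> x i}"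
        proof
          fix i assume i: "i \<in> {i. s \<le> x i}"
          have "t / 2 \<le> u" unfolding u_def using finJ by (intro Max_ge) auto
          moreover have "x i \<le> u" if "i \<in> J" unfolding u_def using finJ that by (intro Max_ge) auto
          ultimately show "i \<in> {i. t \<le> x i}" using i us by (force simp: J_def)
        qed
        from card_mono[OF fin[OF t] this] that not show False by simp
      qed
      then have "desc_sort x n \<le> u" unfolding desc_sort_def using ne by (intro cSup_least) auto
      with le u show False by simp
    qed
  qed
qed

definition poisson_dirichlet :: "real \<Rightarrow> (nat \<Rightarrow> real) measure" where
  "poisson_dirichlet \<theta> =
     distr (PiM UNIV (\<lambda>_. uniform_measure lborel {0<..<1})) (PiM UNIV (\<lambda>_. borel))
       (\<lambda>U. desc_sort (stick_breaking \<theta> U))"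

text \<open>The multisubset \<open>{X 0, X 1, \<dots>}\<close>.  A value taken infinitely often gets
  multiplicity \<open>0\<close> here; under \<open>poisson_dirichlet \<theta>\<close> with \<open>\<theta> > 0\<close> this has
  probability \<open>0\<close>, since the entries tend to \<open>0\<close> almost surely.\<close>

definition multisubset_of_seq :: "(nat \<Rightarrow> real) \<Rightarrow> real \<Rightarrow> nat" where
  "multisubset_of_seq X u = (if u \<in> {0<..1} then card {i. X i = u} else 0)"

text \<open>On the null set where the coordinates sum to \<open>1\<close> the value is chosen to be \<open>0\<close>.\<close>

definition pd1_density :: "nat \<Rightarrow> (nat \<Rightarrow> real) \<Rightarrow> ennreal" where
  "pd1_density k x = ennreal (if (\<Sum>i<k. x i) < 1 then 1 / (\<Prod>i<k. x i) else 0)"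

end

theory Submission
  imports Defs "HOL-Real_Asymp.Real_Asymp"
begin

text \<open>
  Existence. Write \<open>W n\<close> for the product of the first \<open>n\<close> variables \<open>U i\<close>. Conditioning on the first
  stick, the mixed moment \<open>\<phi> w = E (\<Prod>i\<in>J. card {n. w * G n \<in> S i})\<close> of the stick-breaking sequence
  \<open>G\<close> satisfies, for disjoint \<open>S i\<close>, the equation \<open>\<phi> w = (\<integral>v\<in>{0<..<1}. \<phi> (w * v)) + s w\<close>, where \<open>s\<close> involves
  only proper subsets of \<open>J\<close>. The mass that the product of the measures \<open>dx / x\<close> gives to the points
  of \<open>\<Prod> S i\<close> with coordinate sum below \<open>w\<close> satisfies the same equation. If all \<open>S i\<close> lie in \<open>{e..}\<close>, both solutions
  are bounded and vanish for \<open>w < e\<close>, so the integral operator contracts their difference by \<open>1 - e\<close>,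
  and they agree.

  Uniqueness. The intensities determine \<open>E (\<Prod>i. N (S i))\<close> for Borel sets in disjoint intervals, \<open>N\<close> being the counts,
  but multiplicities are not visible in them. Here condition (i) helps: approximating \<open>T\<^sup>2 \<le> 1\<close> by sums over a grid,
  the pairs of points in distinct cells and the diagonal with multiplicity one contribute \<open>1/2\<close> each in the limit,
  which leaves no room for multiple points. So on \<open>{e..1}\<close> there are at most \<open>1 / e\<close> points, all simple, and
  on a fine enough grid a product of counts is a sum of products over distinct cells. All joint moments
  of the counts are therefore determined, and these determine the law of a bounded integer vector.
\<close>

section \<open>The renewal equation for the candidate intensities\<close>

text \<open>The scale \<open>w\<close> closes the recursion: behind the first stick
  \<open>1 - v\<close> lies \<open>v\<close> times an independent copy of the sequence, so the
  equation at \<open>w = 1\<close> involves all smaller scales. For \<theta> = 1 the factor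
  \<open>v\<close> is uniform, whence the plain average over \<open>{0<..<1}\<close>. The
  contraction comes from small \<open>v\<close>: for \<open>w \<le> 1\<close> and
  \<open>v < e\<close> the scale \<open>w * v\<close> lies below \<open>e\<close>, where the
  solutions vanish.

  The obstacle to uniqueness is that the densities describe disjoint intervals only, hence never two
  points at the same place. The two halves are the integral of \<open>x^2 * (1 / x)\<close> over
  \<open>0 < x < 1\<close> and the area of the triangle \<open>x + y < 1\<close>, where the weight
  \<open>x * y\<close> cancels the density \<open>1 / (x * y)\<close>. Since they exhaust the bound
  \<open>1\<close> on the second moment of \<open>T\<close>, nothing remains for pairs at one place.
  The bound \<open>T \<le> 1\<close> also makes counts away from \<open>0\<close> bounded, so that
  finitely many moments determine their law; sets reaching down to \<open>0\<close> may hold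
  infinitely many points and are treated as monotone limits of truncations.\<close>

definition log_measure :: "real measure" where
  "log_measure = density lborel (\<lambda>x. indicator {0<..} x * ennreal (1 / x))"

lemma space_log_measure [simp]: "space log_measure = UNIV"
  and sets_log_measure [simp, measurable_cong]: "sets log_measure = sets borel"
  by (simp_all add: log_measure_def)

lemma nn_integral_log_measure:
  assumes [measurable]: "f \<in> borel_measurable borel"
  shows "(\<integral>\<^sup>+x. f x \<partial>log_measure) = (\<integral>\<^sup>+x\<in>{0<..}. ennreal (1 / x) * f x \<partial>lborel)"
  by (simp add: log_measure_def nn_integral_density mult_ac)

lemma sigma_finite_log_measure: "sigma_finite_measure log_measure"
  unfolding log_measure_def
  by (subst sigma_finite_measure.sigma_finite_iff_density_finite[OF sigma_finite_lborel]) (auto simp: indicator_def ennreal_mult_eq_top_iff)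

interpretation log_PiM: product_sigma_finite "\<lambda>_. log_measure"
  by (simp add: product_sigma_finite_def sigma_finite_log_measure)

text \<open>The weight \<open>1 / x\<close> sits in the measure, so the product measure carries the
  factor \<open>1 / (x_1 * ... * x_k)\<close> of the density. At \<open>w = 1\<close> this is the
  integral of the candidate density over a box. \<open>J\<close> is an arbitrary finite index set
  because the recursion deletes single indices.\<close>

definition simplex_mass :: "nat set \<Rightarrow> (nat \<Rightarrow> real set) \<Rightarrow> real \<Rightarrow> ennreal" where
  "simplex_mass J S w =
     (\<integral>\<^sup>+x. (\<Prod>i\<in>J. indicator (S i) (x i)) * indicator {..<w} (\<Sum>i\<in>J. x i) \<partial>PiM J (\<lambda>_. log_measure))"

lemma simplex_mass_measurable [measurable]:
  assumes J: "finite J" and S [measurable]: "\<And>i. i \<in> J \<Longrightarrow> S i \<in> sets borel"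
  shows "simplex_mass J S \<in> borel_measurable borel"
proof -
  interpret sigma_finite_measure "PiM J (\<lambda>_. log_measure)" by (rule log_PiM.sigma_finite[OF J])
  have [measurable]: "Measurable.pred (borel \<Otimes>\<^sub>M PiM J (\<lambda>_. log_measure)) (\<lambda>p. (\<Sum>i\<in>J. snd p i) < fst p)"
    by measurable
  have "(\<lambda>w. \<integral>\<^sup>+x. (\<Prod>i\<in>J. indicator (S i) (x i)) * (if (\<Sum>i\<in>J. x i) < w then 1 else 0) \<partial>PiM J (\<lambda>_. log_measure)) \<in> borel_measurable borel"
    by measurable
  then show ?thesis by (simp add: simplex_mass_def[abs_def] indicator_def of_bool_def)
qed

lemma prod_indicator_eq:
  "finite J \<Longrightarrow> (\<Prod>i\<in>J. indicator (S i) (x i)) = (if \<forall>i\<in>J. x i \<in> S i then 1 else 0 :: 'a :: comm_semiring_1)"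
  by (induction J rule: finite_induct) auto

text \<open>For uniform \<open>v\<close> this is the probability of \<open>v > t / w\<close>: the
  chance that a configuration of total size \<open>t\<close> still fits after shrinking the scale
  from \<open>w\<close> to \<open>w * v\<close>.\<close>

lemma nn_integral_indicator_linear:
  fixes t w :: real assumes "0 \<le> t" "0 < w"
  shows "(\<integral>\<^sup>+v\<in>{0<..<1}. indicator {..<w * v} t \<partial>lborel) = indicator {..<w} t * ennreal (1 - t / w)"
proof -
  have "(\<integral>\<^sup>+v\<in>{0<..<1}. indicator {..<w * v} t \<partial>lborel) = (\<integral>\<^sup>+v. indicator {t / w<..<1} v \<partial>lborel)"
    using assms by (intro nn_integral_cong) (auto simp: indicator_def field_simps dest: le_less_trans zero_less_mult_pos2)
  also have "\<dots> = emeasure lborel {t / w<..<1}" by simp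
  also have "\<dots> = indicator {..<w} t * ennreal (1 - t / w)"
    using assms by (cases "t < w") auto
  finally show ?thesis .
qed

text \<open>The first stick becomes coordinate \<open>i\<close>. Substituting
  \<open>y = w * (1 - v)\<close> gives \<open>dv = dy / w\<close>, which is \<open>y / w\<close>
  times \<open>dy / y\<close>; this explains the weight \<open>x i / w\<close> on the right.\<close>

lemma simplex_mass_split_off:
  assumes J: "finite J" "i \<in> J" and S [measurable]: "\<And>i. i \<in> J \<Longrightarrow> S i \<in> sets borel"
    and pos: "\<And>i. i \<in> J \<Longrightarrow> S i \<subseteq> {0<..}" and w: "0 < w"
  shows "(\<integral>\<^sup>+v\<in>{0<..<1}. indicator (S i) (w * (1 - v)) * simplex_mass (J - {i}) S (w * v) \<partial>lborel) =
    (\<integral>\<^sup>+x. (\<Prod>i\<in>J. indicator (S i) (x i)) * indicator {..<w} (\<Sum>i\<in>J. x i) * ennreal (x i / w) \<partial>PiM J (\<lambda>_. log_measure))"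
proof -
  have [measurable]: "S i \<in> sets borel" using J by simp
  have Sm [measurable]: "simplex_mass (J - {i}) S \<in> borel_measurable borel"
    using J by (intro simplex_mass_measurable) auto
  \<comment> \<open>Here \<open>y\<close> is the size of the first stick, and
    \<open>w - y = w * v\<close> is the scale left for the other coordinates.\<close>
  define f where "f y = indicator {0<..<w} y * indicator (S i) y * simplex_mass (J - {i}) S (w - y)" for y
  have [measurable]: "f \<in> borel_measurable borel" unfolding f_def by measurable
  have "(\<integral>\<^sup>+y. f y \<partial>lborel) = ennreal \<bar>-w\<bar> * (\<integral>\<^sup>+v. f (w + (-w) * v) \<partial>lborel)"
    by (rule nn_integral_real_affine) (use w in auto)
  also have "(\<integral>\<^sup>+v. f (w + (-w) * v) \<partial>lborel) = (\<integral>\<^sup>+v\<in>{0<..<1}. indicator (S i) (w * (1 - v)) * simplex_mass (J - {i}) S (w * v) \<partial>lborel)"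
    (is "_ = ?L")
    using w by (intro nn_integral_cong) (auto simp: f_def indicator_def algebra_simps dest: zero_less_mult_pos2)
  finally have 1: "?L = (\<integral>\<^sup>+y. f y \<partial>lborel) * ennreal (1 / w)"
    using w by (simp add: mult.commute[of _ "ennreal (1 / w)"] mult.assoc[symmetric] ennreal_mult[symmetric])
  have fy: "f y = (\<integral>\<^sup>+x. indicator (S i) y * (\<Prod>j\<in>J-{i}. indicator (S j) (x j)) * indicator {..<w} (y + (\<Sum>j\<in>J-{i}. x j)) \<partial>PiM (J-{i}) (\<lambda>_. log_measure))" for y
  proof -
    have "f y = (\<integral>\<^sup>+x. indicator {0<..<w} y * indicator (S i) y * ((\<Prod>j\<in>J-{i}. indicator (S j) (x j)) * indicator {..<w-y} (\<Sum>j\<in>J-{i}. x j)) \<partial>PiM (J-{i}) (\<lambda>_. log_measure))"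
      unfolding f_def simplex_mass_def using J by (subst nn_integral_cmult) (auto intro!: borel_measurable_times)
    also have "\<dots> = (\<integral>\<^sup>+x. indicator (S i) y * (\<Prod>j\<in>J-{i}. indicator (S j) (x j)) * indicator {..<w} (y + (\<Sum>j\<in>J-{i}. x j)) \<partial>PiM (J-{i}) (\<lambda>_. log_measure))"
    proof (intro nn_integral_cong)
      fix x
      show "indicator {0<..<w} y * indicator (S i) y * ((\<Prod>j\<in>J-{i}. indicator (S j) (x j)) * indicator {..<w-y} (\<Sum>j\<in>J-{i}. x j)) = 
         (indicator (S i) y * (\<Prod>j\<in>J-{i}. indicator (S j) (x j)) * indicator {..<w} (y + (\<Sum>j\<in>J-{i}. x j)) :: ennreal)"
      proof (cases "y \<in> S i \<and> (\<forall>j\<in>J-{i}. x j \<in> S j)")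
        case True
        \<comment> \<open>By positivity of all coordinates the constraint \<open>0 < y < w\<close>
          follows from the bound on their total.\<close>
        then have "0 < y" using pos J by auto
        moreover have "0 \<le> (\<Sum>j\<in>J-{i}. x j)" using True pos by (intro sum_nonneg) (auto simp: subset_eq less_imp_le)
        ultimately show ?thesis by (auto simp: indicator_def)
      next
        case False
        then have "y \<notin> S i \<or> (\<Prod>j\<in>J-{i}. indicator (S j) (x j) :: ennreal) = 0"
          using J by (auto simp: prod_indicator_eq)
        then show ?thesis by (elim disjE) (simp_all only: indicator_simps not_False_eq_True mult_zero_left mult_zero_right)
      qed
    qed
    finally show ?thesis .
  qed
  define g where "g x = (\<Prod>i\<in>J. indicator (S i) (x i)) * indicator {..<w} (\<Sum>i\<in>J. x i) * ennreal (x i / w)" for x :: "nat \<Rightarrow> real"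
  have J': "insert i (J - {i}) = J" using J by auto
  have gm [measurable]: "g \<in> borel_measurable (PiM J (\<lambda>_. log_measure))"
    unfolding g_def using J(2) by measurable
  have "(\<integral>\<^sup>+x. g x \<partial>PiM J (\<lambda>_. log_measure)) = (\<integral>\<^sup>+y. \<integral>\<^sup>+x. g (x(i := y)) \<partial>PiM (J-{i}) (\<lambda>_. log_measure) \<partial>log_measure)"
    using log_PiM.product_nn_integral_insert_rev[of "J-{i}" i g, unfolded J'] J gm by simp
  also have "\<dots> = (\<integral>\<^sup>+y. ennreal (y / w) * f y \<partial>log_measure)"
  proof (intro nn_integral_cong)
    fix y
    have "(\<integral>\<^sup>+x. g (x(i := y)) \<partial>PiM (J-{i}) (\<lambda>_. log_measure)) = (\<integral>\<^sup>+x. ennreal (y / w) * (indicator (S i) y * (\<Prod>j\<in>J-{i}. indicator (S j) (x j)) * indicator {..<w} (y + (\<Sum>j\<in>J-{i}. x j))) \<partial>PiM (J-{i}) (\<lambda>_. log_measure))"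
      using J by (intro nn_integral_cong) (simp add: g_def prod.remove[of J i] sum.remove[of J i] mult_ac)
    also have "\<dots> = ennreal (y / w) * f y" unfolding fy by (intro nn_integral_cmult) measurable
    finally show "(\<integral>\<^sup>+x. g (x(i := y)) \<partial>PiM (J-{i}) (\<lambda>_. log_measure)) = ennreal (y / w) * f y" .
  qed
  \<comment> \<open>The factor \<open>y / w\<close> cancels the density \<open>1 / y\<close> of
    \<open>log_measure\<close>.\<close>
  also have "\<dots> = (\<integral>\<^sup>+y. ennreal (1 / w) * f y \<partial>lborel)"
    by (subst nn_integral_log_measure, measurable, intro nn_integral_cong)
      (use w in \<open>auto simp: f_def indicator_def ennreal_mult[symmetric] mult.assoc[symmetric]\<close>)
  also have "\<dots> = (\<integral>\<^sup>+y. f y \<partial>lborel) * ennreal (1 / w)"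
    by (subst nn_integral_cmult) (auto simp: mult.commute)
  finally show ?thesis unfolding 1 g_def by simp
qed

text \<open>The right-hand side is obtained by conditioning on the first stick \<open>1 - v\<close>.
  It holds since the integrand on the left splits as \<open>(1 - t / w) + (\<Sum>i\<in>J. x i / w)\<close>, where \<open>t\<close> is the
  sum of the coordinates.\<close>

lemma simplex_mass_renewal:
  assumes J: "finite J" and S [measurable]: "\<And>i. i \<in> J \<Longrightarrow> S i \<in> sets borel"
    and pos: "\<And>i. i \<in> J \<Longrightarrow> S i \<subseteq> {0<..}" and w: "0 < w"
  shows "simplex_mass J S w = (\<integral>\<^sup>+v\<in>{0<..<1}. simplex_mass J S (w * v) \<partial>lborel) +
    (\<Sum>i\<in>J. \<integral>\<^sup>+v\<in>{0<..<1}. indicator (S i) (w * (1 - v)) * simplex_mass (J - {i}) S (w * v) \<partial>lborel)"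
proof -
  let ?P = "PiM J (\<lambda>_. log_measure)"
  interpret P: sigma_finite_measure ?P by (rule log_PiM.sigma_finite[OF J])
  interpret pair_sigma_finite lborel ?P ..
  let ?I = "\<lambda>x. (\<Prod>i\<in>J. indicator (S i) (x i)) :: ennreal"
  have [measurable]: "Measurable.pred (lborel \<Otimes>\<^sub>M PiM J (\<lambda>_. log_measure)) (\<lambda>p. (\<Sum>i\<in>J. snd p i) < w * fst p)"
    by measurable
  have "(\<integral>\<^sup>+v\<in>{0<..<1}. simplex_mass J S (w * v) \<partial>lborel) = 
     (\<integral>\<^sup>+v. \<integral>\<^sup>+x. indicator {0<..<1} v * (?I x * (if (\<Sum>i\<in>J. x i) < w * v then 1 else 0)) \<partial>?P \<partial>lborel)"
    unfolding simplex_mass_def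
    by (subst mult.commute, intro nn_integral_cong, subst nn_integral_cmult[symmetric]) (auto simp: indicator_def of_bool_def)
  also have "\<dots> = (\<integral>\<^sup>+x. \<integral>\<^sup>+v. indicator {0<..<1} v * (?I x * (if (\<Sum>i\<in>J. x i) < w * v then 1 else 0)) \<partial>lborel \<partial>?P)"
    by (subst Fubini') auto
  also have "\<dots> = (\<integral>\<^sup>+x. ?I x * (\<integral>\<^sup>+v\<in>{0<..<1}. indicator {..<w * v} (\<Sum>i\<in>J. x i) \<partial>lborel) \<partial>?P)"
    by (intro nn_integral_cong, subst nn_integral_cmult[symmetric], measurable)
       (auto intro!: nn_integral_cong simp: indicator_def of_bool_def)
  also have "\<dots> = (\<integral>\<^sup>+x. ?I x * indicator {..<w} (\<Sum>i\<in>J. x i) * ennreal (1 - (\<Sum>i\<in>J. x i) / w) \<partial>?P)"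
  proof (intro nn_integral_cong)
    fix x
    show "?I x * (\<integral>\<^sup>+v\<in>{0<..<1}. indicator {..<w * v} (\<Sum>i\<in>J. x i) \<partial>lborel) = ?I x * indicator {..<w} (\<Sum>i\<in>J. x i) * ennreal (1 - (\<Sum>i\<in>J. x i) / w)"
    proof (cases "\<forall>i\<in>J. x i \<in> S i")
      case True
      then have "0 \<le> (\<Sum>j\<in>J. x j)" using pos by (intro sum_nonneg) (auto simp: subset_eq less_imp_le)
      then show ?thesis using w by (simp add: nn_integral_indicator_linear mult.assoc)
    next
      case False
      then have "?I x = 0" using J by (auto simp: prod_zero_iff indicator_def)
      then show ?thesis by (simp only: mult_zero_left)
    qed
  qed
  finally have 1: "(\<integral>\<^sup>+v\<in>{0<..<1}. simplex_mass J S (w * v) \<partial>lborel) =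
      (\<integral>\<^sup>+x. ?I x * indicator {..<w} (\<Sum>i\<in>J. x i) * ennreal (1 - (\<Sum>i\<in>J. x i) / w) \<partial>?P)" .
  have 2: "(\<Sum>i\<in>J. \<integral>\<^sup>+v\<in>{0<..<1}. indicator (S i) (w * (1 - v)) * simplex_mass (J - {i}) S (w * v) \<partial>lborel) =
    (\<integral>\<^sup>+x. (\<Sum>i\<in>J. ?I x * indicator {..<w} (\<Sum>i\<in>J. x i) * ennreal (x i / w)) \<partial>?P)"
    using J S pos w by (subst nn_integral_sum) (auto intro!: sum.cong simplex_mass_split_off)
  show ?thesis
    unfolding 1 2
    apply (subst nn_integral_add[symmetric])
      apply measurable
    unfolding simplex_mass_def
  proof (intro nn_integral_cong)
    fix x
    show "?I x * indicator {..<w} (\<Sum>i\<in>J. x i) =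
      ?I x * indicator {..<w} (\<Sum>i\<in>J. x i) * ennreal (1 - (\<Sum>i\<in>J. x i) / w) + (\<Sum>i\<in>J. ?I x * indicator {..<w} (\<Sum>i\<in>J. x i) * ennreal (x i / w))"
    proof (cases "(\<forall>i\<in>J. x i \<in> S i) \<and> (\<Sum>i\<in>J. x i) < w")
      case True
      then have p: "\<And>i. i \<in> J \<Longrightarrow> 0 < x i" using pos by auto
      have "(\<Sum>i\<in>J. ennreal (x i / w)) = ennreal ((\<Sum>i\<in>J. x i) / w)"
        using p w by (subst sum_ennreal) (auto simp: less_imp_le sum_divide_distrib)
      moreover have "ennreal (1 - (\<Sum>i\<in>J. x i) / w) + ennreal ((\<Sum>i\<in>J. x i) / w) = 1"
        using True w p by (subst ennreal_plus[symmetric]) (auto simp: less_imp_le intro!: divide_nonneg_pos sum_nonneg)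
      ultimately show ?thesis using True by (simp add: flip: sum_distrib_left distrib_left)
    next
      case False
      then have "?I x = 0 \<or> indicator {..<w} (\<Sum>i\<in>J. x i) = (0::ennreal)" using J by (auto simp: prod_indicator_eq)
      then show ?thesis by (elim disjE) (simp_all only: mult_zero_left mult_zero_right sum.neutral_const add_0_right)
    qed
  qed
qed

section \<open>Moments of the stick-breaking sequence\<close>

abbreviation unif_seq :: "(nat \<Rightarrow> real) measure" where
  "unif_seq \<equiv> PiM UNIV (\<lambda>_. uniform_measure lborel {0<..<1})"

lemma prob_space_uniform_01: "prob_space (uniform_measure lborel {0<..<1::real})"
  by (rule prob_space_uniform_measure) auto

interpretation unif: sequence_space "uniform_measure lborel {0<..<1::real}"
  by (intro sequence_space.intro product_prob_spaceI prob_space_uniform_01)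

lemma nn_integral_uniform_01:
  assumes [measurable]: "f \<in> borel_measurable borel"
  shows "(\<integral>\<^sup>+v. f v \<partial>uniform_measure lborel {0<..<1::real}) = (\<integral>\<^sup>+v\<in>{0<..<1}. f v \<partial>lborel)"
  by (subst nn_integral_uniform_measure) (auto simp: divide_ennreal_def)

lemma AE_unif_seq: "AE U in unif_seq. \<forall>i. 0 < U i \<and> U i < 1"
proof -
  have "AE x in uniform_measure lborel {0<..<1::real}. 0 < x \<and> x < 1"
    by (rule AE_uniform_measureI) auto
  then have "AE U in unif_seq. 0 < U i \<and> U i < 1" for i
    by (intro AE_PiM_component) (auto intro: prob_space_uniform_01)
  then show ?thesis by (simp add: AE_all_countable)
qed

lemma stick_breaking_1:
  assumes "\<And>i. 0 < U i"
  shows "stick_breaking 1 U n = (\<Prod>i<n. U i) * (1 - U n)"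
  using assms by (simp add: stick_breaking_def less_imp_le)

lemma stick_breaking_measurable [measurable]: "(\<lambda>U. stick_breaking \<theta> U n) \<in> borel_measurable unif_seq"
  unfolding stick_breaking_def by measurable

lemma stick_breaking_case_nat:
  assumes "0 < v"
  shows "stick_breaking 1 (case_nat v U) 0 = 1 - v"
    and "stick_breaking 1 (case_nat v U) (Suc n) = v * stick_breaking 1 U n"
  using assms by (simp_all add: stick_breaking_def prod.lessThan_Suc_shift del: prod.lessThan_Suc)

lemma sum_stick_breaking:
  assumes "\<And>i. 0 < U i"
  shows "(\<Sum>n<m. stick_breaking 1 U n) = 1 - (\<Prod>i<m. U i)"
  by (induction m) (simp_all add: stick_breaking_1[OF assms] algebra_simps)

lemma stick_breaking_pos:
  assumes "\<And>i. 0 < U i \<and> U i < 1"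
  shows "0 < stick_breaking 1 U n"
  using assms by (auto simp: stick_breaking_1 intro!: mult_pos_pos prod_pos)

text \<open>The partial sums are \<open>1\<close> minus the part of the unit stick that is still
  unbroken.\<close>

lemma summable_stick_breaking:
  assumes U: "\<And>i. 0 < U i \<and> U i < 1"
  shows "summable (stick_breaking 1 U)" and "suminf (stick_breaking 1 U) \<le> 1"
proof -
  have le: "(\<Sum>n<m. stick_breaking 1 U n) \<le> 1" for m
    using U by (subst sum_stick_breaking) (auto intro!: prod_nonneg intro: less_imp_le)
  show "summable (stick_breaking 1 U)"
    by (rule bounded_imp_summable[of _ 1])
       (use le[of "Suc _"] U in \<open>auto simp: lessThan_Suc_atMost intro: less_imp_le stick_breaking_pos\<close>)
  then show "suminf (stick_breaking 1 U) \<le> 1"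
    by (rule suminf_le_const) (rule le)
qed

text \<open>Counting runs over indices and not over values, so repeated values are counted with
  multiplicity.\<close>

definition stick_count :: "(nat \<Rightarrow> real) \<Rightarrow> real \<Rightarrow> real set \<Rightarrow> ennreal" where
  "stick_count U w S = (\<Sum>n. indicator S (w * stick_breaking 1 U n))"

lemma stick_count_measurable [measurable (raw)]:
  assumes [measurable]: "S \<in> sets borel" "f \<in> borel_measurable M" "g \<in> measurable M unif_seq"
  shows "(\<lambda>x. stick_count (g x) (f x) S) \<in> borel_measurable M"
  unfolding stick_count_def by measurable

text \<open>Self-similarity: all sticks after the first form a stick-breaking sequence scaled by
  \<open>v\<close>.\<close>

lemma stick_count_case_nat:
  assumes "0 < v"
  shows "stick_count (case_nat v U) w S = indicator S (w * (1 - v)) + stick_count U (w * v) S"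
proof -
  have "(\<lambda>n. indicator S (w * stick_breaking 1 (case_nat v U) (Suc n))) sums stick_count U (w * v) S"
    unfolding stick_count_def stick_breaking_case_nat[OF assms] mult.assoc by (rule summable_sums) simp
  from sums_Suc[OF this] show ?thesis
    unfolding stick_breaking_case_nat[OF assms] by (simp add: stick_count_def sums_iff add.commute)
qed

text \<open>A counted stick has size at least \<open>e\<close>, so its indicator is at most its size
  divided by \<open>e\<close>, and the sizes sum to at most \<open>1\<close>. Below scale
  \<open>e\<close> no stick is long enough to be counted.\<close>

lemma stick_count_le:
  assumes U: "\<And>i. 0 < U i \<and> U i < 1" and e: "0 < e" and w: "0 < w" "w \<le> 1" and S: "S \<subseteq> {e..}"
  shows "stick_count U w S \<le> ennreal (1 / e)" and "w < e \<Longrightarrow> stick_count U w S = 0"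
proof -
  note p = stick_breaking_pos[of U, OF U]
  note s = summable_stick_breaking[of U, OF U]
  have *: "indicator S (w * stick_breaking 1 U n) \<le> ennreal (1 / e * stick_breaking 1 U n)" for n
  proof (cases "w * stick_breaking 1 U n \<in> S")
    case True
    then have "e \<le> w * stick_breaking 1 U n" using S by auto
    also have "\<dots> \<le> stick_breaking 1 U n" using w p[of n] by (simp add: mult_left_le_one_le)
    finally show ?thesis using e True by (simp add: indicator_def field_simps)
  qed simp
  have "stick_count U w S \<le> (\<Sum>n. ennreal (1 / e * stick_breaking 1 U n))"
    unfolding stick_count_def by (intro suminf_le *) auto
  also have "\<dots> = ennreal (\<Sum>n. 1 / e * stick_breaking 1 U n)"
    using e p by (intro suminf_ennreal2 summable_mult s(1)) (simp add: less_imp_le)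
  also have "\<dots> = ennreal (1 / e * suminf (stick_breaking 1 U))"
    by (simp only: suminf_mult[OF s(1)])
  also have "\<dots> \<le> ennreal (1 / e)" using s(2) e by (intro ennreal_leI) (simp add: field_simps)
  finally show "stick_count U w S \<le> ennreal (1 / e)" .
  assume we: "w < e"
  have "stick_breaking 1 U n \<le> 1" for n
    using sum_le_suminf[OF s(1), of "{n}"] s(2) p by (auto simp: less_imp_le)
  then have "w * stick_breaking 1 U n < e" for n
    using mult_left_le[of "stick_breaking 1 U n" w] w we by (smt (verit))
  then have "w * stick_breaking 1 U n \<notin> S" for n using S by (metis atLeast_iff not_le subsetD)
  then show "stick_count U w S = 0" by (simp add: stick_count_def)
qed

definition stick_moment :: "nat set \<Rightarrow> (nat \<Rightarrow> real set) \<Rightarrow> real \<Rightarrow> ennreal" where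
  "stick_moment J S w = (\<integral>\<^sup>+U. (\<Prod>i\<in>J. stick_count U w (S i)) \<partial>unif_seq)"

lemma stick_moment_measurable [measurable]:
  assumes [measurable]: "\<And>i. i \<in> J \<Longrightarrow> S i \<in> sets borel"
  shows "stick_moment J S \<in> borel_measurable borel"
  unfolding stick_moment_def[abs_def] by measurable

text \<open>In the application \<open>a i\<close> tells whether the first stick lies in
  \<open>S i\<close>. The sets are disjoint, so expanding the product leaves only terms with at most
  one factor \<open>a i\<close>.\<close>

lemma prod_add_at_most_one:
  fixes f a :: "'i \<Rightarrow> 'a :: comm_semiring_1"
  assumes "finite J" and "\<And>i j. i \<in> J \<Longrightarrow> j \<in> J \<Longrightarrow> i \<noteq> j \<Longrightarrow> a i * a j = 0"
  shows "(\<Prod>i\<in>J. a i + f i) = (\<Prod>i\<in>J. f i) + (\<Sum>i\<in>J. a i * (\<Prod>j\<in>J-{i}. f j))"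
  using assms
proof (induction J rule: finite_induct)
  case (insert k J)
  have IH: "(\<Prod>i\<in>J. a i + f i) = (\<Prod>i\<in>J. f i) + (\<Sum>i\<in>J. a i * (\<Prod>j\<in>J-{i}. f j))"
    using insert by auto
  have z: "a k * (\<Sum>i\<in>J. a i * (\<Prod>j\<in>J-{i}. f j)) = 0"
  proof -
    have "a k * a i * c = 0" if "i \<in> J" for i c using insert.prems[of k i] insert.hyps that by (metis insertI1 insertI2 mult_zero_left)
    then show ?thesis by (simp add: sum_distrib_left mult.assoc[symmetric])
  qed
  have "(\<Sum>i\<in>J. a i * (\<Prod>j\<in>insert k J-{i}. f j)) = (\<Sum>i\<in>J. f k * (a i * (\<Prod>j\<in>J-{i}. f j)))"
  proof (intro sum.cong refl)
    fix i assume "i \<in> J"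
    then have "insert k J - {i} = insert k (J - {i})" using insert by auto
    then show "a i * (\<Prod>j\<in>insert k J-{i}. f j) = f k * (a i * (\<Prod>j\<in>J-{i}. f j))"
      using insert by (simp add: mult_ac)
  qed
  then show ?case using insert.hyps z
    by (simp add: IH distrib_right distrib_left sum_distrib_left[symmetric] insert_Diff_if add_ac)
qed simp

text \<open>Given the first stick, either it lies in none of the sets, and the rest contributes the
  full moment at scale \<open>w * v\<close>, or it lies in exactly one \<open>S i\<close> and leaves
  the moment over \<open>J - {i}\<close>.\<close>

lemma stick_moment_renewal:
  assumes J: "finite J" and S [measurable]: "\<And>i. i \<in> J \<Longrightarrow> S i \<in> sets borel"
    and disj: "disjoint_family_on S J"
  shows "stick_moment J S w = (\<integral>\<^sup>+v\<in>{0<..<1}. stick_moment J S (w * v) \<partial>lborel) +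
    (\<Sum>i\<in>J. \<integral>\<^sup>+v\<in>{0<..<1}. indicator (S i) (w * (1 - v)) * stick_moment (J - {i}) S (w * v) \<partial>lborel)"
proof -
  let ?u = "uniform_measure lborel {0<..<1::real}"
  have [measurable]: "stick_moment (J - {i}) S \<in> borel_measurable borel"
    "stick_moment J S \<in> borel_measurable borel" for i
    by (rule stick_moment_measurable, use assms(2) in auto)+
  \<comment> \<open>An i.i.d. sequence has the same law as a fresh variable put in front of an
    i.i.d. sequence.\<close>
  have "stick_moment J S w = (\<integral>\<^sup>+U. (\<Prod>i\<in>J. stick_count U w (S i)) \<partial>distr (?u \<Otimes>\<^sub>M unif_seq) unif_seq (\<lambda>(s, \<omega>). case_nat s \<omega>))"
    unfolding stick_moment_def unif.PiM_iter ..
  also have "\<dots> = (\<integral>\<^sup>+p. (\<Prod>i\<in>J. stick_count (case_nat (fst p) (snd p)) w (S i)) \<partial>(?u \<Otimes>\<^sub>M unif_seq))"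
    by (subst nn_integral_distr) (measurable, auto simp: case_prod_beta)
  also have "\<dots> = (\<integral>\<^sup>+v. \<integral>\<^sup>+U. (\<Prod>i\<in>J. stick_count (case_nat v U) w (S i)) \<partial>unif_seq \<partial>?u)"
  proof -
    have "(\<lambda>p. \<Prod>i\<in>J. stick_count (case_nat (fst p) (snd p)) w (S i)) \<in> borel_measurable (?u \<Otimes>\<^sub>M unif_seq)"
      by (intro borel_measurable_prod_ennreal stick_count_measurable S) measurable
    from unif.P.nn_integral_fst[OF this] show ?thesis by simp
  qed
  also have "\<dots> = (\<integral>\<^sup>+v. stick_moment J S (w * v) + (\<Sum>i\<in>J. indicator (S i) (w * (1 - v)) * stick_moment (J - {i}) S (w * v)) \<partial>?u)"
  proof (rule nn_integral_cong_AE, rule AE_uniform_measureI)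
    show "AE v in lborel. v \<in> {0<..<1} \<longrightarrow> (\<integral>\<^sup>+U. (\<Prod>i\<in>J. stick_count (case_nat v U) w (S i)) \<partial>unif_seq) =
        stick_moment J S (w * v) + (\<Sum>i\<in>J. indicator (S i) (w * (1 - v)) * stick_moment (J - {i}) S (w * v))"
    proof (intro AE_I2 impI)
      fix v :: real assume v: "v \<in> {0<..<1}"
      have *: "(\<Prod>i\<in>J. stick_count (case_nat v U) w (S i)) = (\<Prod>i\<in>J. stick_count U (w * v) (S i)) +
        (\<Sum>i\<in>J. indicator (S i) (w * (1 - v)) * (\<Prod>j\<in>J-{i}. stick_count U (w * v) (S j)))" for U
        unfolding stick_count_case_nat[of v] using v disj J
        by (subst stick_count_case_nat, simp, intro prod_add_at_most_one) (auto simp: disjoint_family_on_def indicator_def)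
      show "(\<integral>\<^sup>+U. (\<Prod>i\<in>J. stick_count (case_nat v U) w (S i)) \<partial>unif_seq) =
        stick_moment J S (w * v) + (\<Sum>i\<in>J. indicator (S i) (w * (1 - v)) * stick_moment (J - {i}) S (w * v))"
        unfolding * stick_moment_def
        by (subst nn_integral_add, measurable, subst nn_integral_sum, measurable) (simp_all add: nn_integral_cmult)
    qed
  qed simp
  also have "\<dots> = (\<integral>\<^sup>+v\<in>{0<..<1}. (stick_moment J S (w * v) + (\<Sum>i\<in>J. indicator (S i) (w * (1 - v)) * stick_moment (J - {i}) S (w * v))) \<partial>lborel)"
    by (rule nn_integral_uniform_01) measurable
  also have "\<dots> = (\<integral>\<^sup>+v. indicator {0<..<1} v * stick_moment J S (w * v) + (\<Sum>i\<in>J. indicator {0<..<1} v * (indicator (S i) (w * (1 - v)) * stick_moment (J - {i}) S (w * v))) \<partial>lborel)"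
    by (intro nn_integral_cong) (simp add: distrib_left sum_distrib_left mult.commute)
  also have "\<dots> = (\<integral>\<^sup>+v\<in>{0<..<1}. stick_moment J S (w * v) \<partial>lborel) +
    (\<Sum>i\<in>J. \<integral>\<^sup>+v\<in>{0<..<1}. indicator (S i) (w * (1 - v)) * stick_moment (J - {i}) S (w * v) \<partial>lborel)"
    by (subst nn_integral_add, measurable, subst nn_integral_sum, measurable) (simp_all add: mult_ac)
  finally show ?thesis .
qed

text \<open>Iterating the equation improves \<open>f \<le> g + d\<close> to
  \<open>f \<le> g + d * (1 - e)\<close>: the error matters only for \<open>v\<close> in
  \<open>{e..<1}\<close>, since \<open>f (w * v) = 0\<close> for \<open>v < e\<close>. This
  one-sided form avoids subtraction in \<open>ennreal\<close> and bounds \<open>f\<close> only;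
  equality follows by exchanging the roles of \<open>f\<close> and \<open>g\<close>.\<close>

lemma renewal_comparison:
  fixes f g s :: "real \<Rightarrow> ennreal"
  assumes [measurable]: "f \<in> borel_measurable borel" "g \<in> borel_measurable borel"
    and e: "0 < e" "e \<le> 1"
    and f: "\<And>w. 0 < w \<Longrightarrow> w \<le> 1 \<Longrightarrow> f w = (\<integral>\<^sup>+v\<in>{0<..<1}. f (w * v) \<partial>lborel) + s w"
    and g: "\<And>w. 0 < w \<Longrightarrow> w \<le> 1 \<Longrightarrow> g w = (\<integral>\<^sup>+v\<in>{0<..<1}. g (w * v) \<partial>lborel) + s w"
    and f0: "\<And>w. 0 < w \<Longrightarrow> w < e \<Longrightarrow> f w = 0"
    and fC: "\<And>w. 0 < w \<Longrightarrow> w \<le> 1 \<Longrightarrow> f w \<le> ennreal C" and C: "0 \<le> C"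
    and w: "0 < w" "w \<le> 1"
  shows "f w \<le> g w"
proof -
  have *: "f w \<le> g w + ennreal (C * (1 - e) ^ n)" if "0 < w" "w \<le> 1" for n w
    using that
  proof (induction n arbitrary: w)
    case 0
    then show ?case using fC[of w] by (simp add: add_increasing)
  next
    case (Suc n)
    let ?d = "ennreal (C * (1 - e) ^ n)"
    have "(\<integral>\<^sup>+v\<in>{0<..<1}. f (w * v) \<partial>lborel) \<le> (\<integral>\<^sup>+v. g (w * v) * indicator {0<..<1} v + ?d * indicator {e..<1} v \<partial>lborel)"
    proof (intro nn_integral_mono)
      fix v :: real
      show "f (w * v) * indicator {0<..<1} v \<le> g (w * v) * indicator {0<..<1} v + ?d * indicator {e..<1} v"
      proof (cases "0 < v \<and> v < 1")
        case True
        then have wv: "0 < w * v" "w * v \<le> 1" "w * v \<le> v"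
          using Suc.prems by (auto intro: mult_le_one mult_left_le_one_le)
        show ?thesis
          using True Suc.IH[OF wv(1,2)] f0[OF wv(1)] wv(3) by (cases "v < e") auto
      qed simp
    qed
    also have "\<dots> = (\<integral>\<^sup>+v\<in>{0<..<1}. g (w * v) \<partial>lborel) + ?d * ennreal (1 - e)"
      using e by (subst nn_integral_add) (auto simp: nn_integral_cmult_indicator)
    finally show ?case
      using f[OF Suc.prems] g[OF Suc.prems] e C
      by (simp add: ennreal_mult[symmetric] mult_ac add_ac add_left_mono)
  qed
  have "(\<lambda>n. g w + ennreal (C * (1 - e) ^ n)) \<longlonglongrightarrow> g w + ennreal (C * 0)"
    using e by (intro tendsto_intros tendsto_ennrealI LIMSEQ_power_zero) auto
  from LIMSEQ_le_const[OF this, of "f w"] * w show ?thesis by auto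
qed

section \<open>A priori bounds and the identification of the moments\<close>

lemma simplex_mass_empty: "0 < w \<Longrightarrow> simplex_mass {} S w = 1"
  by (simp add: simplex_mass_def space_PiM_empty)

lemma emeasure_log_measure_Icc_le: "0 < e \<Longrightarrow> emeasure log_measure {e..1} \<le> ennreal (1 / e)"
proof -
  assume e: "0 < e"
  have "emeasure log_measure {e..1} = (\<integral>\<^sup>+x. indicator {e..1} x \<partial>log_measure)" by simp
  also have "\<dots> = (\<integral>\<^sup>+x\<in>{0<..}. ennreal (1 / x) * indicator {e..1} x \<partial>lborel)"
    by (rule nn_integral_log_measure) measurable
  also have "\<dots> \<le> (\<integral>\<^sup>+x. ennreal (1 / e) * indicator {0..1::real} x \<partial>lborel)"
    by (intro nn_integral_mono)
       (use e in \<open>auto simp: indicator_def field_simps intro!: ennreal_leI\<close>)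
  also have "\<dots> = ennreal (1 / e)" by (subst nn_integral_cmult_indicator) auto
  finally show ?thesis .
qed

text \<open>These two bounds, like those of \<open>stick_moment_le\<close>, are what
  \<open>renewal_comparison\<close> asks of its smaller side. The mass vanishes for
  \<open>w < e\<close> because a single coordinate already exceeds \<open>w\<close>; for
  \<open>J = {}\<close> there is no such coordinate, and the mass is \<open>1\<close> at positive
  \<open>w\<close>.\<close>

lemma simplex_mass_le:
  assumes J: "finite J" and e: "0 < e" and S: "\<And>i. i \<in> J \<Longrightarrow> S i \<subseteq> {e..}" and w: "w \<le> 1"
  shows "simplex_mass J S w \<le> ennreal ((1 / e) ^ card J)"
    and "w < e \<Longrightarrow> J \<noteq> {} \<Longrightarrow> simplex_mass J S w = 0"
proof -
  have le: "x i \<le> (\<Sum>i\<in>J. x i)" if "\<And>i. i \<in> J \<Longrightarrow> x i \<in> S i" "i \<in> J" for x i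
  proof (rule member_le_sum)
    fix j assume "j \<in> J - {i}"
    then have "e \<le> x j" using that(1)[of j] S[of j] by auto
    then show "0 \<le> x j" using e by simp
  qed (use that J in auto)
  have "simplex_mass J S w \<le> (\<integral>\<^sup>+x. (\<Prod>i\<in>J. indicator {e..1} (x i)) \<partial>PiM J (\<lambda>_. log_measure))"
    unfolding simplex_mass_def
  proof (intro nn_integral_mono)
    fix x
    show "(\<Prod>i\<in>J. indicator (S i) (x i)) * indicator {..<w} (\<Sum>i\<in>J. x i) \<le> (\<Prod>i\<in>J. indicator {e..1} (x i) :: ennreal)"
    proof (cases "(\<forall>i\<in>J. x i \<in> S i) \<and> (\<Sum>i\<in>J. x i) < w")
      case True
      then have "\<forall>i\<in>J. x i \<in> {e..1}" using le[of x] S w by fastforce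
      then show ?thesis using J True by (simp add: prod_indicator_eq)
    qed (use J in \<open>auto simp: prod_indicator_eq\<close>)
  qed
  also have "\<dots> = (\<Prod>i\<in>J. emeasure log_measure {e..1})"
    using J by (subst log_PiM.product_nn_integral_prod) auto
  also have "\<dots> \<le> (\<Prod>i\<in>J. ennreal (1 / e))"
    by (intro prod_mono_ennreal) (use e emeasure_log_measure_Icc_le in auto)
  also have "\<dots> = ennreal ((1 / e) ^ card J)" using e by (simp add: ennreal_power)
  finally show "simplex_mass J S w \<le> ennreal ((1 / e) ^ card J)" .
  assume we: "w < e" "J \<noteq> {}"
  have "(\<Prod>i\<in>J. indicator (S i) (x i)) * indicator {..<w} (\<Sum>i\<in>J. x i) = (0 :: ennreal)" for x
  proof (cases "\<forall>i\<in>J. x i \<in> S i")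
    case True
    obtain i where "i \<in> J" using we by auto
    then have "w \<le> (\<Sum>i\<in>J. x i)" using le[of x i] True S we by fastforce
    then show ?thesis by (simp add: indicator_def)
  qed (use J in \<open>auto simp: prod_indicator_eq\<close>)
  then show "simplex_mass J S w = 0" by (simp only: simplex_mass_def nn_integral_0_iff_AE nn_integral_const mult_zero_left)
qed

lemma stick_moment_le:
  assumes J: "finite J" and e: "0 < e" and S: "\<And>i. i \<in> J \<Longrightarrow> S i \<subseteq> {e..}" and w: "0 < w" "w \<le> 1"
  shows "stick_moment J S w \<le> ennreal ((1 / e) ^ card J)"
    and "w < e \<Longrightarrow> J \<noteq> {} \<Longrightarrow> stick_moment J S w = 0"
proof -
  have "AE U in unif_seq. (\<Prod>i\<in>J. stick_count U w (S i)) \<le> (\<Prod>i\<in>J. ennreal (1 / e))"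
    using AE_unif_seq by eventually_elim (use e S w in \<open>intro prod_mono_ennreal stick_count_le(1), auto\<close>)
  then have "stick_moment J S w \<le> (\<integral>\<^sup>+U. (\<Prod>i\<in>J. ennreal (1 / e)) \<partial>unif_seq)"
    unfolding stick_moment_def by (rule nn_integral_mono_AE)
  also have "\<dots> = ennreal ((1 / e) ^ card J)" using e by (simp add: ennreal_power unif.P.emeasure_space_1)
  finally show "stick_moment J S w \<le> ennreal ((1 / e) ^ card J)" .
  assume we: "w < e" "J \<noteq> {}"
  have "AE U in unif_seq. (\<Prod>i\<in>J. stick_count U w (S i)) = 0"
    using AE_unif_seq
  proof eventually_elim
    case (elim U)
    obtain i where i: "i \<in> J" using we by auto
    then have "stick_count U w (S i) = 0" using elim by (intro stick_count_le(2)[OF _ e w S we(1)]) auto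
    then show ?case using i J by (auto simp: prod_zero_iff)
  qed
  then show "stick_moment J S w = 0" unfolding stick_moment_def
    by (subst nn_integral_cong_AE[where v="\<lambda>_. 0"]) auto
qed

text \<open>Induction over proper subsets of \<open>J\<close>: by the induction hypothesis both
  functions satisfy the renewal equation with the same source term \<open>s\<close>, and such
  solutions coincide.\<close>

lemma stick_moment_eq_simplex_mass:
  assumes J: "finite J" and S: "\<And>i. i \<in> J \<Longrightarrow> S i \<in> sets borel"
    and e: "0 < e" "e \<le> 1" and Se: "\<And>i. i \<in> J \<Longrightarrow> S i \<subseteq> {e..}" and disj: "disjoint_family_on S J"
    and w: "0 < w" "w \<le> 1"
  shows "stick_moment J S w = simplex_mass J S w"
  using J S Se disj w
proof (induction J arbitrary: w rule: finite_psubset_induct)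
  case (psubset J)
  show ?case
  proof (cases "J = {}")
    case True
    then show ?thesis using psubset.prems unif.P.emeasure_space_1 by (simp add: simplex_mass_empty stick_moment_def)
  next
    case False
    define s where "s w = (\<Sum>i\<in>J. \<integral>\<^sup>+v\<in>{0<..<1}. indicator (S i) (w * (1 - v)) * simplex_mass (J - {i}) S (w * v) \<partial>lborel)" for w
    have m: "stick_moment J S \<in> borel_measurable borel" "simplex_mass J S \<in> borel_measurable borel"
      using psubset by (auto intro!: stick_moment_measurable simplex_mass_measurable)
    have S0: "S i \<subseteq> {0<..}" if "i \<in> J" for i using psubset.prems(2)[OF that] e by auto
    \<comment> \<open>Equality is needed at every scale in \<open>(0, 1]\<close>, because the source
      term evaluates the smaller moments at \<open>w * v\<close>.\<close>
    have rec: "stick_moment (J - {i}) S w = simplex_mass (J - {i}) S w" if "i \<in> J" "0 < w" "w \<le> 1" for i w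
      using that psubset.prems by (intro psubset.IH) (auto simp: disjoint_family_on_def)
    have f: "stick_moment J S w = (\<integral>\<^sup>+v\<in>{0<..<1}. stick_moment J S (w * v) \<partial>lborel) + s w"
      if "0 < w" "w \<le> 1" for w
      unfolding s_def
      by (subst stick_moment_renewal)
         (use psubset that rec in \<open>auto intro!: sum.cong nn_integral_cong simp: indicator_def mult_le_one\<close>)
    have g: "simplex_mass J S w = (\<integral>\<^sup>+v\<in>{0<..<1}. simplex_mass J S (w * v) \<partial>lborel) + s w"
      if "0 < w" "w \<le> 1" for w
      unfolding s_def by (rule simplex_mass_renewal) (use psubset that S0 in auto)
    show ?thesis
    proof (rule antisym)
      show "stick_moment J S w \<le> simplex_mass J S w"
        using renewal_comparison[OF m e f g stick_moment_le(2) stick_moment_le(1)] psubset False e by auto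
      show "simplex_mass J S w \<le> stick_moment J S w"
        using renewal_comparison[OF m(2,1) e g f simplex_mass_le(2) simplex_mass_le(1)] psubset False e by auto
    qed
  qed
qed

section \<open>The Poisson--Dirichlet process as a random multisubset\<close>

lemma borel_measurable_pred_le [measurable (raw)]:
  fixes f :: "'a \<Rightarrow> 'b::{second_countable_topology, linorder_topology}"
  shows "f \<in> borel_measurable M \<Longrightarrow> g \<in> borel_measurable M \<Longrightarrow> Measurable.pred M (\<lambda>w. f w \<le> g w)"
  unfolding Measurable.pred_def by (rule borel_measurable_le)

lemma finite_superlevel:
  fixes x :: "nat \<Rightarrow> real"
  assumes "x \<longlonglongrightarrow> 0" "0 < t"
  shows "finite {i. t \<le> x i}"
  using order_tendstoD(2)[OF assms]
  by (simp add: eventually_cofinite not_less flip: cofinite_eq_sequentially)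

text \<open>Ranks with sorted entry at least \<open>u\<close> form an initial segment whose length
  is the number of entries at least \<open>u\<close>, and likewise for entries above
  \<open>u\<close>. The ranks with entry exactly \<open>u\<close> are the difference of the two
  segments.\<close>

lemma multisubset_of_seq_desc_sort:
  assumes pos: "\<And>i. 0 < x i" and lim: "x \<longlonglongrightarrow> 0"
  shows "multisubset_of_seq (desc_sort x) = multisubset_of_seq x"
proof
  fix u
  show "multisubset_of_seq (desc_sort x) u = multisubset_of_seq x u"
  proof (cases "u \<in> {0<..1}")
    case True
    then have u: "0 < u" by simp
    note le = le_desc_sort_iff[of x, OF pos lim]
    let ?B = "{i. u < x i}"
    have finB: "finite ?B" using finite_superlevel[OF lim u] by (rule rev_finite_subset) auto
    \<comment> \<open>Only finitely many entries exceed \<open>u\<close>, so there is a gap above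
      \<open>u\<close>, and "greater than \<open>u\<close>" can be read as "at least
      \<open>s\<close>", the form that \<open>le_desc_sort_iff\<close> handles. The value
      \<open>u + 1\<close> serves the case without larger entries.\<close>
    define s where "s = Min (insert (u + 1) (x ` ?B))"
    have s: "u < s" using finB by (auto simp: s_def)
    have B: "?B = {i. s \<le> x i}"
    proof (intro Collect_cong iffI)
      fix i assume "u < x i"
      then show "s \<le> x i" unfolding s_def using finB by (intro Min_le) auto
    qed (use s in auto)
    have lt: "u < desc_sort x n \<longleftrightarrow> n < card ?B" for n
    proof
      assume less: "u < desc_sort x n"
      then have "n < card {i. desc_sort x n \<le> x i}" using le[of "desc_sort x n" n] u by simp
      also have "\<dots> \<le> card ?B" using less by (intro card_mono finB) auto
      finally show "n < card ?B" .
    next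
      assume "n < card ?B"
      then have "s \<le> desc_sort x n" using le[of s n] s u unfolding B by simp
      then show "u < desc_sort x n" using s by simp
    qed
    have "{n. desc_sort x n = u} = {n. u \<le> desc_sort x n} - {n. u < desc_sort x n}" by auto
    also have "\<dots> = {card ?B..<card {i. u \<le> x i}}"
      unfolding le[OF u] lt by (rule set_eqI) (simp add: not_less conj_commute)
    also have "card \<dots> = card {i. u \<le> x i} - card ?B" by simp
    also have "\<dots> = card ({i. u \<le> x i} - ?B)"
      using finB by (intro card_Diff_subset[symmetric]) auto
    also have "{i. u \<le> x i} - ?B = {i. x i = u}" by auto
    finally show ?thesis using True by (simp add: multisubset_of_seq_def)
  next
    case False
    then show ?thesis by (simp only: multisubset_of_seq_def if_False)
  qed
qed

text \<open>Measurability is needed on all sequences, also where \<open>desc_sort\<close> is not a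
  true sorting. The supremum runs over uncountably many levels \<open>t\<close>, but the number of
  entries at or above \<open>t\<close> changes only at the entries themselves, so countably many
  conditions suffice.\<close>

lemma desc_sort_measurable [measurable]:
  "(\<lambda>x. desc_sort x n) \<in> borel_measurable (PiM UNIV (\<lambda>_. borel))"
proof (unfold borel_measurable_iff_le, rule allI)
  fix a
  \<comment> \<open>If no level qualifies, the value is the unspecified constant
    \<open>Sup {}\<close>; it is the same for all such sequences, so it does no harm.\<close>
  have *: "desc_sort x n \<le> a \<longleftrightarrow> (if \<exists>j. n < card {i. x j \<le> x i} then \<forall>j. n < card {i. x j \<le> x i} \<longrightarrow> x j \<le> a else Sup {} \<le> a)" for x
  proof -
    define E where "E = {t. n < card {i. t \<le> x i}}"
    \<comment> \<open>The least entry that is at least \<open>t\<close> has the same superlevel set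
      as \<open>t\<close>. The set is finite because \<open>card\<close> of an infinite set is
      \<open>0\<close>.\<close>
    have attain: "\<exists>j. t \<le> x j \<and> x j \<in> E" if "t \<in> E" for t
    proof -
      let ?F = "{i. t \<le> x i}"
      have "0 < card ?F" using that unfolding E_def by simp
      then have F: "finite ?F" "?F \<noteq> {}" by (auto simp only: card_gt_0_iff)
      then have "Min (x ` ?F) \<in> x ` ?F" by (intro Min_in) auto
      then obtain j where j0: "j \<in> ?F" "Min (x ` ?F) = x j" by (rule imageE) auto
      have j: "j \<in> ?F" "\<And>i. i \<in> ?F \<Longrightarrow> x j \<le> x i"
        using j0(1) F by (auto simp: j0(2)[symmetric])
      then have "{i. x j \<le> x i} = ?F" by auto
      then show ?thesis using j that unfolding E_def by auto
    qed
    show ?thesis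
    proof (cases "E = {}")
      case True
      then show ?thesis unfolding desc_sort_def E_def[symmetric] by (auto simp: E_def)
    next
      case False
      then obtain t where t: "t \<in> E" by auto
      have fin: "finite {i. t \<le> x i}" using t unfolding E_def by (auto intro: card_ge_0_finite)
      have bdd: "bdd_above E"
      proof (rule bdd_aboveI)
        fix r assume "r \<in> E"
        then obtain j where j: "r \<le> x j" using attain by auto
        show "r \<le> Max (insert t (x ` {i. t \<le> x i}))"
        proof (cases "t \<le> x j")
          case True
          then show ?thesis using j fin by (intro order_trans[OF j] Max_ge) auto
        next
          case False
          then have "r \<le> t" using j by simp
          then show ?thesis by (rule order_trans) (use fin in \<open>intro Max_ge, auto\<close>)
        qed
      qed
      have "desc_sort x n \<le> a \<longleftrightarrow> (\<forall>r\<in>E. r \<le> a)"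
        unfolding desc_sort_def E_def[symmetric] by (rule cSup_le_iff[OF False bdd])
      also have "\<dots> \<longleftrightarrow> (\<forall>j. x j \<in> E \<longrightarrow> x j \<le> a)" using attain by (meson order_trans)
      finally show ?thesis using attain[OF t] by (auto simp: E_def)
    qed
  qed
  show "{x \<in> space (PiM UNIV (\<lambda>_. borel)). desc_sort x n \<le> a} \<in> sets (PiM UNIV (\<lambda>_. borel :: real measure))"
    unfolding * by measurable
qed

text \<open>Exchanges the sum over values with the sum over indices. The finiteness condition on the
  right reflects that \<open>card\<close> gives multiplicity \<open>0\<close> to a value taken
  infinitely often.\<close>

lemma nn_integral_multisubset_of_seq:
  fixes h :: "real \<Rightarrow> ennreal"
  assumes S: "S \<subseteq> {0<..1}"
  shows "(\<integral>\<^sup>+u. of_nat (multisubset_of_seq x u) * h u \<partial>count_space S) =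
    (\<Sum>n. if x n \<in> S \<and> finite {i. x i = x n} then h (x n) else 0)"
proof -
  let ?g = "\<lambda>u n. if x n = u \<and> u \<in> S \<and> finite {i. x i = u} then h u else 0"
  have "(\<integral>\<^sup>+u. of_nat (multisubset_of_seq x u) * h u \<partial>count_space S) = (\<integral>\<^sup>+u. \<integral>\<^sup>+n. ?g u n \<partial>count_space UNIV \<partial>count_space UNIV)"
    apply (subst nn_integral_count_space_indicator, simp add: NO_MATCH_def)
  proof (intro nn_integral_cong)
    fix u
    show "of_nat (multisubset_of_seq x u) * h u * indicator S u = (\<integral>\<^sup>+n. ?g u n \<partial>count_space UNIV)"
    proof (cases "u \<in> S \<and> finite {i. x i = u}")
      case True
      have "(\<integral>\<^sup>+n. ?g u n \<partial>count_space UNIV) = (\<integral>\<^sup>+n. h u * indicator {i. x i = u} n \<partial>count_space UNIV)"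
        using True by (intro nn_integral_cong) (auto simp: indicator_def)
      also have "\<dots> = h u * of_nat (card {i. x i = u})"
        using True by (subst nn_integral_cmult_indicator) auto
      finally show ?thesis using True S by (auto simp: multisubset_of_seq_def mult.commute)
    next
      case False
      then have "?g u n = 0" for n by auto
      then show ?thesis using False by (auto simp: multisubset_of_seq_def)
    qed
  qed
  also have "\<dots> = (\<integral>\<^sup>+n. \<integral>\<^sup>+u. ?g u n \<partial>count_space UNIV \<partial>count_space UNIV)"
    using nn_integral_fst_count_space[of "\<lambda>(u, n). ?g u n"] nn_integral_snd_count_space[of "\<lambda>(u, n). ?g u n"]
    by simp
  also have "\<dots> = (\<integral>\<^sup>+n. (if x n \<in> S \<and> finite {i. x i = x n} then h (x n) else 0) \<partial>count_space UNIV)"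
  proof (intro nn_integral_cong)
    fix n
    have "(\<integral>\<^sup>+u. ?g u n \<partial>count_space UNIV) = (\<integral>\<^sup>+u. ?g (x n) n * indicator {x n} u \<partial>count_space UNIV)"
      by (intro nn_integral_cong) (auto simp: indicator_def)
    then show "(\<integral>\<^sup>+u. ?g u n \<partial>count_space UNIV) = (if x n \<in> S \<and> finite {i. x i = x n} then h (x n) else 0)"
      by (simp add: nn_integral_cmult_indicator)
  qed
  finally show ?thesis by (simp add: nn_integral_count_space_nat)
qed

lemma mcount_multisubset_of_seq:
  assumes "S \<subseteq> {0<..1}"
  shows "mcount (multisubset_of_seq x) S = (\<Sum>n. if x n \<in> S \<and> finite {i. x i = x n} then 1 else 0)"
  using nn_integral_multisubset_of_seq[OF assms, of x "\<lambda>_. 1"] by (simp add: mcount_def)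

lemma msum_multisubset_of_seq:
  "msum (multisubset_of_seq x) = (\<Sum>n. if x n \<in> {0<..1} \<and> finite {i. x i = x n} then ennreal (x n) else 0)"
  unfolding msum_def by (rule nn_integral_multisubset_of_seq) simp

section \<open>Measurability of counts and sums of the sorted sequence\<close>

lemma finite_fibre_measurable [measurable]:
  "Measurable.pred (PiM UNIV (\<lambda>_. borel)) (\<lambda>x :: nat \<Rightarrow> real. finite {i. x i = x n})"
  unfolding order_eq_iff by measurable

lemma mcount_multisubset_of_seq_measurable [measurable]:
  assumes [measurable]: "S \<in> sets borel" and "S \<subseteq> {0<..1}"
  shows "(\<lambda>x. mcount (multisubset_of_seq x) S) \<in> borel_measurable (PiM UNIV (\<lambda>_. borel))"
  unfolding mcount_multisubset_of_seq[OF assms(2)] by measurable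

lemma msum_multisubset_of_seq_measurable [measurable]:
  "(\<lambda>x. msum (multisubset_of_seq x)) \<in> borel_measurable (PiM UNIV (\<lambda>_. borel))"
  unfolding msum_multisubset_of_seq by measurable

lemma multisubset_multisubset_of_seq: "multisubset (multisubset_of_seq x)"
proof -
  have "{u. multisubset_of_seq x u \<noteq> 0} \<subseteq> range x"
    by (auto simp: multisubset_of_seq_def card_gt_0_iff split: if_splits)
  moreover have "{u. multisubset_of_seq x u \<noteq> 0} \<subseteq> {0<..1}"
    by (auto simp: multisubset_of_seq_def split: if_splits)
  ultimately show ?thesis by (auto simp: multisubset_def intro: countable_subset)
qed

lemma desc_sort_stick_breaking_measurable [measurable]:
  "(\<lambda>U. desc_sort (stick_breaking \<theta> U)) \<in> measurable unif_seq (PiM UNIV (\<lambda>_. borel))"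
proof -
  have "(\<lambda>U. stick_breaking \<theta> U) \<in> measurable unif_seq (PiM UNIV (\<lambda>_. borel))"
    by (rule measurable_PiM_single') auto
  from measurable_compose[OF this desc_sort_measurable] show ?thesis
    by (intro measurable_PiM_single') auto
qed

lemma prob_space_poisson_dirichlet: "prob_space (poisson_dirichlet \<theta>)"
  unfolding poisson_dirichlet_def by (rule unif.P.prob_space_distr) measurable

lemma sets_poisson_dirichlet [measurable_cong]: "sets (poisson_dirichlet \<theta>) = sets (PiM UNIV (\<lambda>_. borel))"
  by (simp add: poisson_dirichlet_def)

lemma random_multisubset_poisson_dirichlet:
  "random_multisubset (poisson_dirichlet \<theta>) multisubset_of_seq"
  unfolding random_multisubset_def
  by (auto simp: prob_space_poisson_dirichlet multisubset_multisubset_of_seq measurable_cong_sets[OF sets_poisson_dirichlet refl])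

section \<open>The sum condition and the intensities of PD(1)\<close>

lemma stick_breaking_tendsto_0:
  assumes "\<And>i. 0 < U i \<and> U i < 1"
  shows "stick_breaking 1 U \<longlonglongrightarrow> 0"
  by (rule summable_LIMSEQ_zero, rule summable_stick_breaking(1), rule assms)

lemma finite_fibre_stick_breaking:
  assumes "\<And>i. 0 < U i \<and> U i < 1"
  shows "finite {i. stick_breaking 1 U i = stick_breaking 1 U n}"
  by (rule finite_subset[OF _ finite_superlevel[OF stick_breaking_tendsto_0[of U, OF assms] stick_breaking_pos[of U n, OF assms]]]) auto

lemma mcount_stick_breaking:
  assumes U: "\<And>i. 0 < U i \<and> U i < 1" and S: "S \<subseteq> {0<..1}"
  shows "mcount (multisubset_of_seq (desc_sort (stick_breaking 1 U))) S = stick_count U 1 S"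
  unfolding multisubset_of_seq_desc_sort[OF stick_breaking_pos[of U, OF U] stick_breaking_tendsto_0[of U, OF U]]
    mcount_multisubset_of_seq[OF S] stick_count_def
  using finite_fibre_stick_breaking[of U, OF U] by (intro suminf_cong) (auto simp: indicator_def)

lemma msum_stick_breaking_le:
  assumes U: "\<And>i. 0 < U i \<and> U i < 1"
  shows "msum (multisubset_of_seq (desc_sort (stick_breaking 1 U))) \<le> 1"
proof -
  have "msum (multisubset_of_seq (desc_sort (stick_breaking 1 U))) \<le> (\<Sum>n. ennreal (stick_breaking 1 U n))"
    unfolding multisubset_of_seq_desc_sort[OF stick_breaking_pos[of U, OF U] stick_breaking_tendsto_0[of U, OF U]] msum_multisubset_of_seq
    by (intro suminf_le) auto
  also have "\<dots> = ennreal (suminf (stick_breaking 1 U))"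
    using U by (intro suminf_ennreal2 summable_stick_breaking) (auto intro: less_imp_le stick_breaking_pos)
  also have "\<dots> \<le> 1" using summable_stick_breaking(2)[of U, OF U] by simp
  finally show ?thesis .
qed

lemma AE_msum_poisson_dirichlet: "AE X in poisson_dirichlet 1. msum (multisubset_of_seq X) \<le> 1"
  unfolding poisson_dirichlet_def
  by (subst AE_distr_iff) (measurable, use AE_unif_seq in eventually_elim, rule msum_stick_breaking_le, auto)

text \<open>Checked on boxes, where both sides factor; it links the moments to densities with
  respect to Lebesgue measure.\<close>

lemma PiM_log_measure:
  assumes J: "finite J"
  shows "PiM J (\<lambda>_. log_measure) = density (PiM J (\<lambda>_. lborel)) (\<lambda>x. \<Prod>i\<in>J. indicator {0<..} (x i) * ennreal (1 / x i))"
proof (rule log_PiM.PiM_eqI[OF J, symmetric])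
  interpret product_sigma_finite "\<lambda>_. lborel :: real measure" ..
  let ?h = "\<lambda>x::real. indicator {0<..} x * ennreal (1 / x)"
  show "sets (density (PiM J (\<lambda>_. lborel)) (\<lambda>x. \<Prod>i\<in>J. ?h (x i))) = sets (PiM J (\<lambda>_. log_measure))"
    by (simp, intro sets_PiM_cong) auto
  fix A assume "\<And>i. i \<in> J \<Longrightarrow> A i \<in> sets log_measure"
  then have A: "\<And>i. i \<in> J \<Longrightarrow> A i \<in> sets borel" by simp
  have "emeasure (density (PiM J (\<lambda>_. lborel)) (\<lambda>x. \<Prod>i\<in>J. ?h (x i))) (Pi\<^sub>E J A) =
      (\<integral>\<^sup>+x. (\<Prod>i\<in>J. ?h (x i)) * indicator (Pi\<^sub>E J A) x \<partial>PiM J (\<lambda>_. lborel))"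
    using J A by (subst emeasure_density) (auto intro!: sets_PiM_I_finite)
  also have "\<dots> = (\<integral>\<^sup>+x. (\<Prod>i\<in>J. ?h (x i) * indicator (A i) (x i)) \<partial>PiM J (\<lambda>_. lborel))"
    using J by (intro nn_integral_cong)
      (auto simp: prod.distrib prod_indicator_eq space_PiM PiE_iff indicator_def of_bool_def)
  also have "\<dots> = (\<Prod>i\<in>J. \<integral>\<^sup>+x. ?h x * indicator (A i) x \<partial>lborel)"
    using J A by (intro product_nn_integral_prod) auto
  also have "\<dots> = (\<Prod>i\<in>J. emeasure log_measure (A i))"
    using A by (intro prod.cong refl) (simp add: log_measure_def emeasure_density)
  finally show "emeasure (density (PiM J (\<lambda>_. lborel)) (\<lambda>x. \<Prod>i\<in>J. ?h (x i))) (Pi\<^sub>E J A) = (\<Prod>i\<in>J. emeasure log_measure (A i))" .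
qed

lemma simplex_mass_eq_pd1_density:
  assumes S: "\<And>i. i < k \<Longrightarrow> S i \<in> sets borel" and pos: "\<And>i. i < k \<Longrightarrow> S i \<subseteq> {0<..}"
  shows "simplex_mass {..<k} S 1 = (\<integral>\<^sup>+x\<in>Pi\<^sub>E {..<k} S. pd1_density k x \<partial>PiM {..<k} (\<lambda>_. lborel))"
proof -
  have [measurable]: "i \<in> {..<k} \<Longrightarrow> S i \<in> sets borel" for i using S by simp
  show ?thesis
    unfolding simplex_mass_def PiM_log_measure[OF finite_lessThan]
  proof (subst nn_integral_density, measurable, intro nn_integral_cong)
    fix x :: "nat \<Rightarrow> real" assume x: "x \<in> space (PiM {..<k} (\<lambda>_. lborel))"
    show "(\<Prod>i<k. indicator {0<..} (x i) * ennreal (1 / x i)) * ((\<Prod>i<k. indicator (S i) (x i)) * indicator {..<1} (\<Sum>i<k. x i)) =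
      pd1_density k x * indicator (Pi\<^sub>E {..<k} S) x"
    proof (cases "\<forall>i<k. x i \<in> S i")
      case True
      then have p: "\<And>i. i < k \<Longrightarrow> 0 < x i" using pos by auto
      have "(\<Prod>i<k. indicator {0<..} (x i) * ennreal (1 / x i)) = (\<Prod>i<k. ennreal (1 / x i))"
        using p by (intro prod.cong) auto
      also have "\<dots> = ennreal (1 / (\<Prod>i<k. x i))"
        using p by (subst prod_ennreal) (auto simp: less_imp_le prod_dividef)
      finally show ?thesis using True x
        by (auto simp: pd1_density_def prod_indicator_eq space_PiM PiE_iff)
    next
      case False
      then have "x \<notin> Pi\<^sub>E {..<k} S" by (auto simp: PiE_iff)
      then show ?thesis using False by (auto simp: prod_indicator_eq)
    qed
  qed
qed

lemma pd1_density_measurable [measurable]: "pd1_density k \<in> borel_measurable (PiM {..<k} (\<lambda>_. lborel))"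
  unfolding pd1_density_def[abs_def] by measurable

lemma poisson_dirichlet_multi_intensity:
  "has_multi_intensity_density (poisson_dirichlet 1) multisubset_of_seq k (pd1_density k)"
  unfolding has_multi_intensity_density_def
proof (intro conjI allI impI pd1_density_measurable)
  fix a b :: "nat \<Rightarrow> real"
  assume ab: "\<forall>i<k. 0 < a i \<and> a i \<le> b i \<and> b i \<le> 1" and disj: "disjoint_family_on (\<lambda>i. {a i..b i}) {..<k}"
  let ?S = "\<lambda>i. {a i..b i}"
  \<comment> \<open>The inserted \<open>1\<close> ensures \<open>e \<le> 1\<close> and keeps the set
    nonempty when \<open>k = 0\<close>.\<close>
  define e where "e = Min (insert 1 (a ` {..<k}))"
  have e: "0 < e" "e \<le> 1" using ab by (auto simp: e_def)
  have Se: "?S i \<subseteq> {e..}" if "i < k" for i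
    using that by (auto simp: e_def intro: min.coboundedI2 order_trans[rotated])
  have S01: "?S i \<subseteq> {0<..1}" if "i < k" for i using ab that by force
  have "(\<integral>\<^sup>+X. (\<Prod>i<k. mcount (multisubset_of_seq X) (?S i)) \<partial>poisson_dirichlet 1) =
      (\<integral>\<^sup>+U. (\<Prod>i<k. mcount (multisubset_of_seq (desc_sort (stick_breaking 1 U))) (?S i)) \<partial>unif_seq)"
    unfolding poisson_dirichlet_def
    by (rule nn_integral_distr) (auto intro!: borel_measurable_prod_ennreal mcount_multisubset_of_seq_measurable S01[THEN subsetD])
  also have "\<dots> = stick_moment {..<k} ?S 1"
    unfolding stick_moment_def
    by (rule nn_integral_cong_AE, use AE_unif_seq in eventually_elim, intro prod.cong refl mcount_stick_breaking S01) auto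
  also have "\<dots> = simplex_mass {..<k} ?S 1"
    by (rule stick_moment_eq_simplex_mass[OF _ _ e]) (use Se disj in auto)
  also have "\<dots> = (\<integral>\<^sup>+x\<in>Pi\<^sub>E {..<k} ?S. pd1_density k x \<partial>PiM {..<k} (\<lambda>_. lborel))"
    using ab by (intro simplex_mass_eq_pd1_density) force+
  finally show "(\<integral>\<^sup>+X. (\<Prod>i<k. mcount (multisubset_of_seq X) (?S i)) \<partial>poisson_dirichlet 1) =
    (\<integral>\<^sup>+x\<in>Pi\<^sub>E {..<k} ?S. pd1_density k x \<partial>PiM {..<k} (\<lambda>_. lborel))" .
qed

section \<open>Moments of counts in disjoint intervals\<close>

text \<open>Every set is measurable here, so monotonicity and additivity of counts hold without side
  conditions.\<close>

lemma mcount_eq_emeasure: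
  "mcount m S = emeasure (density (count_space UNIV) (\<lambda>x. of_nat (m x))) S"
proof -
  have "mcount m S = (\<integral>\<^sup>+x. of_nat (m x) * indicator S x \<partial>count_space UNIV)"
    unfolding mcount_def by (subst nn_integral_count_space_indicator) (auto simp: NO_MATCH_def)
  then show ?thesis by (simp add: emeasure_density)
qed

lemma mcount_empty [simp]: "mcount m {} = 0"
  by (simp add: mcount_eq_emeasure)

lemma mcount_mono: "S \<subseteq> T \<Longrightarrow> mcount m S \<le> mcount m T"
  unfolding mcount_eq_emeasure by (rule emeasure_mono) simp_all

lemma mcount_suminf: "disjoint_family F \<Longrightarrow> (\<Sum>n. mcount m (F n)) = mcount m (\<Union>n. F n)"
  unfolding mcount_eq_emeasure by (rule suminf_emeasure) auto

lemma mcount_sum: "finite I \<Longrightarrow> disjoint_family_on F I \<Longrightarrow> (\<Sum>i\<in>I. mcount m (F i)) = mcount m (\<Union>i\<in>I. F i)"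
  unfolding mcount_eq_emeasure by (rule sum_emeasure) auto

lemma mcount_singleton: "mcount m {x} = of_nat (m x)"
  by (simp add: mcount_def nn_integral_count_space_finite)

text \<open>A lower sum for \<open>T\<close>, each point being weighted by a lower bound of its
  location. With one set it bounds counts, with grid cells it starts the second moment
  argument.\<close>

lemma sum_mcount_le_msum:
  assumes I: "finite I" and disj: "disjoint_family_on F I"
    and F: "\<And>i. i \<in> I \<Longrightarrow> F i \<subseteq> {0<..1}" and t: "\<And>i x. i \<in> I \<Longrightarrow> x \<in> F i \<Longrightarrow> t i \<le> x"
  shows "(\<Sum>i\<in>I. ennreal (t i) * mcount m (F i)) \<le> msum m"
proof -
  have eq: "ennreal (t i) * mcount m (F i) = (\<integral>\<^sup>+x. ennreal (t i) * (of_nat (m x) * indicator (F i) x) \<partial>count_space UNIV)" for i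
    unfolding mcount_eq_emeasure by (simp add: emeasure_density nn_integral_cmult)
  have "(\<Sum>i\<in>I. ennreal (t i) * mcount m (F i)) = (\<integral>\<^sup>+x. (\<Sum>i\<in>I. ennreal (t i) * (of_nat (m x) * indicator (F i) x)) \<partial>count_space UNIV)"
    unfolding eq by (rule nn_integral_sum[symmetric]) simp
  also have "\<dots> \<le> (\<integral>\<^sup>+x. of_nat (m x) * ennreal x * indicator {0<..1} x \<partial>count_space UNIV)"
  proof (intro nn_integral_mono)
    fix x
    show "(\<Sum>i\<in>I. ennreal (t i) * (of_nat (m x) * indicator (F i) x)) \<le> of_nat (m x) * ennreal x * indicator {0<..1} x"
    proof (cases "\<exists>i\<in>I. x \<in> F i")
      case True
      then obtain i where i: "i \<in> I" "x \<in> F i" by auto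
      have "(\<Sum>j\<in>I. ennreal (t j) * (of_nat (m x) * indicator (F j) x)) = ennreal (t i) * (of_nat (m x) * indicator (F i) x)
          + (\<Sum>j\<in>I-{i}. ennreal (t j) * (of_nat (m x) * indicator (F j) x))"
        using I i by (simp add: sum.remove)
      also have "(\<Sum>j\<in>I-{i}. ennreal (t j) * (of_nat (m x) * indicator (F j) x)) = 0"
        using disj i by (intro sum.neutral ballI) (auto simp: disjoint_family_on_def indicator_def)
      also have "ennreal (t i) * (of_nat (m x) * indicator (F i) x) + 0 \<le> of_nat (m x) * ennreal x * indicator {0<..1} x"
        using t[OF i] subsetD[OF F[OF i(1)] i(2)] i
        by (simp add: mult.commute mult_right_mono ennreal_leI)
      finally show ?thesis .
    next
      case False
      then show ?thesis by simp
    qed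
  qed
  also have "\<dots> = msum m"
    unfolding msum_def by (subst (2) nn_integral_count_space_indicator) (auto simp: NO_MATCH_def)
  finally show ?thesis .
qed

lemma mcount_le_of_msum_le_1:
  assumes "msum m \<le> 1" "0 < e" "S \<subseteq> {e..1}"
  shows "mcount m S \<le> ennreal (1 / e)"
proof -
  have "ennreal e * mcount m S \<le> 1"
    using sum_mcount_le_msum[of "{()}" "\<lambda>_. S" "\<lambda>_. e" m] assms by (force simp: disjoint_family_on_def)
  then have "ennreal (1 / e) * (ennreal e * mcount m S) \<le> ennreal (1 / e) * 1" by (intro mult_left_mono) auto
  then show ?thesis using assms by (simp add: mult.assoc[symmetric] ennreal_mult[symmetric])
qed

text \<open>Uniqueness of measures from a pi-system, applied to set functions that look at the trace
  on \<open>{l<..r}\<close>. The intervals satisfy \<open>l < a\<close> because a neighbouring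
  half-open interval may end at \<open>l\<close>, and the closed intervals put in must stay
  disjoint.\<close>

lemma additive_eq_on_borel:
  fixes f g :: "real set \<Rightarrow> ennreal" and l r :: real
  assumes f: "positive (sets borel) f" "countably_additive (sets borel) f"
    and g: "positive (sets borel) g" "countably_additive (sets borel) g"
    and eq: "\<And>X. X \<in> sets borel \<Longrightarrow> X \<inter> {l<..r} = {} \<or> (\<exists>a b. l < a \<and> a \<le> b \<and> b \<le> r \<and> X \<inter> {l<..r} = {a..b}) \<Longrightarrow> f X = g X"
    and fin: "\<And>X. X \<in> sets borel \<Longrightarrow> f X \<noteq> \<infinity>" and X: "X \<in> sets borel"
  shows "f X = g X"
proof -
  define E where "E = {X \<in> sets borel. X \<inter> {l<..r} = {} \<or> (\<exists>a b. l < a \<and> a \<le> b \<and> b \<le> r \<and> X \<inter> {l<..r} = {a..b})}"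
  \<comment> \<open>\<open>{l<..r}\<close> itself need not have a closed interval as its trace.
    Omitting a shrinking gap to the right of \<open>l\<close> yields generators that exhaust the
    line.\<close>
  define C where "C n = {..l} \<union> {l + inverse (Suc n)..}" for n
  have C: "{c..} \<inter> C n \<in> E" for c n
  proof -
    let ?a = "max c (l + inverse (Suc n))"
    have l: "l < l + inverse (real (Suc n))" by simp
    then have la: "l < ?a" by (simp only: less_max_iff_disj) simp
    have "{c..} \<inter> C n \<inter> {l<..r} = {?a..r}"
      using less_le_trans[OF l] by (auto simp: C_def simp del: of_nat_Suc)
    with la show ?thesis unfolding E_def by (cases "?a \<le> r") (auto simp: C_def)
  qed
  have UN: "{c..} = (\<Union>n. {c..} \<inter> C n)" for c
  proof -
    have "\<exists>n. x \<in> C n" for x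
    proof (cases "l < x")
      case True
      then obtain n where "inverse (real (Suc n)) < x - l" using reals_Archimedean[of "x - l"] by auto
      then show ?thesis by (intro exI[of _ n]) (auto simp: C_def)
    qed (auto simp: C_def)
    then show ?thesis by auto
  qed
  have sigma: "sets borel = sigma_sets UNIV E"
  proof
    have "{c..} \<in> sigma_sets UNIV E" for c
      by (subst UN, rule sigma_sets.Union, rule sigma_sets.Basic, rule C)
    then have "UNIV - {c..} \<in> sigma_sets UNIV E" for c by (rule sigma_sets.Compl)
    moreover have "UNIV - {c..} = {..<c}" for c :: real by auto
    ultimately have "sigma_sets UNIV (range lessThan) \<subseteq> sigma_sets UNIV E"
      by (intro sigma_sets_mono) auto
    then show "sets borel \<subseteq> sigma_sets UNIV E" by (simp add: borel_Iio)
    show "sigma_sets UNIV E \<subseteq> sets (borel :: real measure)"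
      by (rule sets.sigma_sets_subset'[of _ borel, simplified]) (auto simp: E_def)
  qed
  have int: "Int_stable E"
  proof (rule Int_stableI)
    fix A B assume AB: "A \<in> E" "B \<in> E"
    have *: "A \<inter> B \<inter> {l<..r} = (A \<inter> {l<..r}) \<inter> (B \<inter> {l<..r})" by auto
    show "A \<inter> B \<in> E"
    proof (cases "A \<inter> B \<inter> {l<..r} = {}")
      case False
      then obtain a b c d where "l < a" "b \<le> r" "A \<inter> {l<..r} = {a..b}" "l < c" "d \<le> r" "B \<inter> {l<..r} = {c..d}"
        using AB by (auto simp: E_def)
      then have "A \<inter> B \<inter> {l<..r} = {max a c..min b d}" "l < max a c" "min b d \<le> r" unfolding * by auto
      moreover from this False have "max a c \<le> min b d" by (metis atLeastatMost_empty_iff2)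
      ultimately show ?thesis using AB unfolding E_def by blast
    qed (use AB in \<open>auto simp: E_def\<close>)
  qed
  interpret sigma_algebra UNIV "sets borel :: real set set"
    using sets.sigma_algebra_axioms[of borel] by simp
  define F where "F = measure_of UNIV (sets borel) f"
  define G where "G = measure_of UNIV (sets borel) g"
  have F: "emeasure F X = f X" if "X \<in> sets borel" for X
    unfolding F_def by (rule emeasure_measure_of_sigma) (use f that sigma_algebra_axioms in auto)
  have G: "emeasure G X = g X" if "X \<in> sets borel" for X
    unfolding G_def by (rule emeasure_measure_of_sigma) (use g that sigma_algebra_axioms in auto)
  have "F = G"
  proof (rule measure_eqI_generator_eq_countable[OF int])
    show "E \<subseteq> Pow UNIV" by simp
    show "emeasure F X = emeasure G X" if "X \<in> E" for X
      using that eq by (subst F, simp add: E_def, subst G) (auto simp: E_def)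
    show "sets F = sigma_sets UNIV E" "sets G = sigma_sets UNIV E"
      by (simp_all add: F_def G_def flip: sigma)
    show "range (\<lambda>(k, n). {- real k..} \<inter> C n) \<subseteq> E" using C by auto
    show "\<Union> (range (\<lambda>(k, n). {- real k..} \<inter> C n)) = UNIV"
    proof (intro set_eqI iffI UNIV_I)
      fix x :: real
      obtain k where "- x \<le> real k" using real_arch_simple by blast
      then have "x \<in> {- real k..}" by simp
      then show "x \<in> \<Union> (range (\<lambda>(k, n). {- real k..} \<inter> C n))" using UN[of "- real k"] by auto
    qed
    show "emeasure F a \<noteq> \<infinity>" if "a \<in> range (\<lambda>(k, n). {- real k..} \<inter> C n)" for a
      using that C fin by (auto simp: E_def F)
  qed auto
  then show ?thesis using F[OF X] G[OF X] by simp
qed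


text \<open>Written as the measure of a box, so that countable additivity in each single coordinate
  is inherited.\<close>

definition pd1_intensity :: "nat \<Rightarrow> (nat \<Rightarrow> real set) \<Rightarrow> ennreal" where
  "pd1_intensity k S = emeasure (density (PiM {..<k} (\<lambda>_. lborel)) (pd1_density k)) (Pi\<^sub>E {..<k} S)"

lemma pd1_intensity_eq:
  assumes "\<And>i. i < k \<Longrightarrow> S i \<in> sets borel"
  shows "pd1_intensity k S = (\<integral>\<^sup>+x\<in>Pi\<^sub>E {..<k} S. pd1_density k x \<partial>PiM {..<k} (\<lambda>_. lborel))"
  unfolding pd1_intensity_def using assms
  by (intro emeasure_density sets_PiM_I_finite pd1_density_measurable) auto

lemma pd1_intensity_suminf:
  assumes p: "p < k" and S: "\<And>i. i < k \<Longrightarrow> S i \<in> sets borel"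
    and F: "range F \<subseteq> sets borel" "disjoint_family F"
  shows "(\<Sum>n. pd1_intensity k (S(p := F n))) = pd1_intensity k (S(p := \<Union>n. F n))"
  unfolding pd1_intensity_def
proof (subst suminf_emeasure)
  show "range (\<lambda>n. Pi\<^sub>E {..<k} (S(p := F n))) \<subseteq> sets (density (PiM {..<k} (\<lambda>_. lborel)) (pd1_density k))"
    using S F by (auto intro!: sets_PiM_I_finite)
  show "disjoint_family (\<lambda>n. Pi\<^sub>E {..<k} (S(p := F n)))"
  proof (unfold disjoint_family_on_def, intro ballI impI equals0I)
    fix m n x assume "m \<noteq> n" and x: "x \<in> Pi\<^sub>E {..<k} (S(p := F m)) \<inter> Pi\<^sub>E {..<k} (S(p := F n))"
    then have "F m \<inter> F n = {}" using F(2) by (auto simp: disjoint_family_on_def)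
    moreover have "x p \<in> F m" "x p \<in> F n"
      using IntD1[OF x, THEN PiE_mem, of p] IntD2[OF x, THEN PiE_mem, of p] p by auto
    ultimately show False by auto
  qed
  have "(\<Union>n. Pi\<^sub>E {..<k} (S(p := F n))) = Pi\<^sub>E {..<k} (S(p := \<Union>n. F n))"
  proof (intro set_eqI iffI)
    fix x assume x: "x \<in> Pi\<^sub>E {..<k} (S(p := \<Union>n. F n))"
    then have "x p \<in> (\<Union>n. F n)" using PiE_mem[OF x, of p] p by simp
    then obtain n where "x p \<in> F n" by auto
    have "x \<in> Pi\<^sub>E {..<k} (S(p := F n))"
    proof (rule PiE_I)
      show "x i \<in> (S(p := F n)) i" if "i \<in> {..<k}" for i
        using PiE_mem[OF x that] \<open>x p \<in> F n\<close> by (cases "i = p") auto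
      show "x i = undefined" if "i \<notin> {..<k}" for i using PiE_arb[OF x that] .
    qed
    then show "x \<in> (\<Union>n. Pi\<^sub>E {..<k} (S(p := F n)))" by auto
  next
    fix x assume "x \<in> (\<Union>n. Pi\<^sub>E {..<k} (S(p := F n)))"
    then obtain n where "x \<in> Pi\<^sub>E {..<k} (S(p := F n))" by auto
    then show "x \<in> Pi\<^sub>E {..<k} (S(p := \<Union>n. F n))" by (auto simp: PiE_iff split: if_splits)
  qed
  then show "emeasure (density (PiM {..<k} (\<lambda>_. lborel)) (pd1_density k)) (\<Union>n. Pi\<^sub>E {..<k} (S(p := F n))) =
      emeasure (density (PiM {..<k} (\<lambda>_. lborel)) (pd1_density k)) (Pi\<^sub>E {..<k} (S(p := \<Union>n. F n)))" by simp
qed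

text \<open>Both the given multisubset and PD(1) are instances, so uniqueness becomes a comparison
  of two instances on possibly different probability spaces.\<close>

locale pd1_multisubset = prob_space M for M :: "'a measure" +
  fixes A :: "'a \<Rightarrow> real \<Rightarrow> nat"
  assumes random: "random_multisubset M A"
    and AE_msum_le: "AE \<omega> in M. msum (A \<omega>) \<le> 1"
    and multi_intensity: "1 \<le> k \<Longrightarrow> has_multi_intensity_density M A k (pd1_density k)"
begin

lemma mcount_measurable [measurable]:
  "S \<in> sets borel \<Longrightarrow> S \<subseteq> {0<..1} \<Longrightarrow> (\<lambda>\<omega>. mcount (A \<omega>) S) \<in> borel_measurable M"
  using random by (auto simp: random_multisubset_def)

lemma AE_mcount_le:
  assumes "0 < e" shows "AE \<omega> in M. \<forall>S. S \<subseteq> {e..1} \<longrightarrow> mcount (A \<omega>) S \<le> ennreal (1 / e)"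
  using AE_msum_le by eventually_elim (use assms mcount_le_of_msum_le_1 in auto)

lemma moment_finite:
  assumes "finite I" "0 < e" "\<And>i. i \<in> I \<Longrightarrow> S i \<subseteq> {e..1}"
  shows "(\<integral>\<^sup>+\<omega>. (\<Prod>i\<in>I. mcount (A \<omega>) (S i)) \<partial>M) < \<infinity>"
proof -
  have "AE \<omega> in M. (\<Prod>i\<in>I. mcount (A \<omega>) (S i)) \<le> (\<Prod>i\<in>I. ennreal (1 / e))"
    using AE_mcount_le[OF assms(2)] by eventually_elim (use assms(3) in \<open>intro prod_mono_ennreal, auto\<close>)
  then have "(\<integral>\<^sup>+\<omega>. (\<Prod>i\<in>I. mcount (A \<omega>) (S i)) \<partial>M) \<le> (\<integral>\<^sup>+\<omega>. (\<Prod>i\<in>I. ennreal (1 / e)) \<partial>M)"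
    by (rule nn_integral_mono_AE)
  also have "\<dots> < \<infinity>" using assms(2) by (simp add: emeasure_space_1 ennreal_power)
  finally show ?thesis .
qed

lemma moment_suminf:
  fixes k :: nat
  assumes p: "p < k" and S: "\<And>i. i < k \<Longrightarrow> S i \<in> sets borel \<and> S i \<subseteq> {0<..1}"
    and F: "range F \<subseteq> sets borel" "disjoint_family F" "\<And>n. F n \<subseteq> {0<..1}"
  shows "(\<Sum>n. \<integral>\<^sup>+\<omega>. (\<Prod>i<k. mcount (A \<omega>) ((S(p := F n)) i)) \<partial>M) = (\<integral>\<^sup>+\<omega>. (\<Prod>i<k. mcount (A \<omega>) ((S(p := \<Union>n. F n)) i)) \<partial>M)"
proof -
  have split: "(\<Prod>i<k. mcount m ((S(p := Z)) i)) = mcount m Z * (\<Prod>i\<in>{..<k}-{p}. mcount m (S i))" for m Z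
    using p by (subst prod.remove[of _ p]) (auto intro!: arg_cong2[where f="(*)"] prod.cong)
  have "(\<Sum>n. \<integral>\<^sup>+\<omega>. (\<Prod>i<k. mcount (A \<omega>) ((S(p := F n)) i)) \<partial>M) = (\<integral>\<^sup>+\<omega>. (\<Sum>n. mcount (A \<omega>) (F n) * (\<Prod>i\<in>{..<k}-{p}. mcount (A \<omega>) (S i))) \<partial>M)"
    unfolding split using S F
    by (intro nn_integral_suminf[symmetric] borel_measurable_times_ennreal borel_measurable_prod_ennreal mcount_measurable) auto
  also have "\<dots> = (\<integral>\<^sup>+\<omega>. (\<Prod>i<k. mcount (A \<omega>) ((S(p := \<Union>n. F n)) i)) \<partial>M)"
    unfolding split by (simp add: mcount_suminf[OF F(2)])
  finally show ?thesis .
qed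

text \<open>For fixed other sets both sides are finite measures in a single \<open>S p\<close>.
  Hence closed intervals can be replaced by Borel sets one coordinate at a time, each time by
  uniqueness of measures.\<close>

lemma moment_eq_intensity:
  assumes k: "1 \<le> k" and lr: "\<And>i. i < k \<Longrightarrow> 0 < l i \<and> r i \<le> 1"
    and disj: "disjoint_family_on (\<lambda>i. {l i<..r i}) {..<k}"
    and S: "\<And>i. i < k \<Longrightarrow> S i \<in> sets borel \<and> S i \<subseteq> {l i<..r i}"
  shows "(\<integral>\<^sup>+\<omega>. (\<Prod>i<k. mcount (A \<omega>) (S i)) \<partial>M) = pd1_intensity k S"
proof -
  let ?lhs = "\<lambda>S. \<integral>\<^sup>+\<omega>. (\<Prod>i<k. mcount (A \<omega>) (S i)) \<partial>M"
  define Icc where "Icc i X \<longleftrightarrow> X = {} \<or> (\<exists>a b. l i < a \<and> a \<le> b \<and> b \<le> r i \<and> X = {a..b})" for i X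
  define good where "good p S \<longleftrightarrow> (\<forall>i<k. S i \<in> sets borel \<and> S i \<subseteq> {l i<..r i} \<and> (p \<le> i \<longrightarrow> Icc i (S i)))" for p S
  have empty: "?lhs S = 0" "pd1_intensity k S = 0" if "i < k" "S i = {}" for S i
  proof -
    have "(\<Prod>i<k. mcount m (S i)) = 0" for m using that by (auto simp: prod_zero_iff intro!: bexI[of _ i])
    then show "?lhs S = 0" by (simp only: nn_integral_const mult_zero_left)
    have "Pi\<^sub>E {..<k} S = {}" using that by (auto simp: PiE_eq_empty_iff)
    then show "pd1_intensity k S = 0" by (simp add: pd1_intensity_def)
  qed
  have fin: "?lhs S < \<infinity>" if "good p S" for S p
  proof -
    define e where "e = Min (insert 1 (l ` {..<k}))"
    have "0 < e" using lr by (auto simp: e_def)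
    moreover have "S i \<subseteq> {e..1}" if "i \<in> {..<k}" for i
    proof -
      have "e \<le> l i" using that unfolding e_def by (intro Min_le) auto
      moreover have "S i \<subseteq> {l i<..r i}" "r i \<le> 1" using that \<open>good p S\<close> lr[of i] by (auto simp: good_def)
      ultimately show ?thesis by fastforce
    qed
    ultimately show ?thesis by (intro moment_finite) auto
  qed
  have "good p S \<longrightarrow> ?lhs S = pd1_intensity k S" if "p \<le> k" for p S
    using that
  proof (induction p arbitrary: S)
    case 0
    show ?case
    proof
      assume g: "good 0 S"
      show "?lhs S = pd1_intensity k S"
      proof (cases "\<exists>i<k. S i = {}")
        case False
        then have "\<forall>i\<in>{..<k}. \<exists>a b. l i < a \<and> a \<le> b \<and> b \<le> r i \<and> S i = {a..b}"
          using g by (auto simp: good_def Icc_def)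
        then obtain a b where ab: "\<And>i. i < k \<Longrightarrow> l i < a i \<and> a i \<le> b i \<and> b i \<le> r i \<and> S i = {a i..b i}"
          by (metis lessThan_iff)
        have "disjoint_family_on (\<lambda>i. {a i..b i}) {..<k}"
        proof (unfold disjoint_family_on_def, intro ballI impI)
          fix i j assume ij: "i \<in> {..<k}" "j \<in> {..<k}" "i \<noteq> j"
          have "{a i..b i} \<subseteq> {l i<..r i}" "{a j..b j} \<subseteq> {l j<..r j}" using ab[of i] ab[of j] ij by auto
          moreover have "{l i<..r i} \<inter> {l j<..r j} = {}" using disj ij by (auto simp only: disjoint_family_on_def)
          ultimately show "{a i..b i} \<inter> {a j..b j} = {}" by blast
        qed
        moreover have "\<forall>i<k. 0 < a i \<and> a i \<le> b i \<and> b i \<le> 1" using ab lr by (meson less_trans order_trans)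
        ultimately have "?lhs (\<lambda>i. {a i..b i}) = (\<integral>\<^sup>+x\<in>(\<Pi>\<^sub>E i\<in>{..<k}. {a i..b i}). pd1_density k x \<partial>PiM {..<k} (\<lambda>_. lborel))"
          using multi_intensity[OF k] by (simp add: has_multi_intensity_density_def)
        also have "\<dots> = pd1_intensity k (\<lambda>i. {a i..b i})" by (subst pd1_intensity_eq) auto
        also have "?lhs (\<lambda>i. {a i..b i}) = ?lhs S" using ab by (intro nn_integral_cong prod.cong) auto
        also have "pd1_intensity k (\<lambda>i. {a i..b i}) = pd1_intensity k S"
          unfolding pd1_intensity_def using ab by (intro arg_cong2[where f=emeasure] PiE_cong) auto
        finally show ?thesis .
      qed (use empty in metis)
    qed
  next
    case (Suc p)
    then have p: "p < k" by simp
    let ?H = "{l p<..r p}"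
    have H: "?H \<subseteq> {0<..1}" using lr[OF p] by auto
    show ?case
    proof
      assume g: "good (Suc p) S"
      have S': "S i \<in> sets borel \<and> S i \<subseteq> {0<..1}" if "i < k" for i
      proof -
        have "S i \<in> sets borel" "S i \<subseteq> {l i<..r i}" using g that by (simp_all add: good_def)
        moreover have "{l i<..r i} \<subseteq> {0<..1}" using lr[OF that] by auto
        ultimately show ?thesis by blast
      qed
      have gX: "good (Suc p) (S(p := X \<inter> ?H))" if "X \<in> sets borel" for X
        using g that by (auto simp: good_def)
      let ?f = "\<lambda>X. ?lhs (S(p := X \<inter> ?H))" and ?g = "\<lambda>X. pd1_intensity k (S(p := X \<inter> ?H))"
      have z: "?lhs (S(p := {})) = 0" "pd1_intensity k (S(p := {})) = 0"
        by (rule empty[OF p fun_upd_same])+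
      have "?f (S p) = ?g (S p)"
      proof (rule additive_eq_on_borel[where f="?f" and g="?g" and X="S p" and l="l p" and r="r p"])
        show "positive (sets borel) ?f" by (simp only: positive_def Int_empty_left z)
        show "positive (sets borel) ?g" by (simp only: positive_def Int_empty_left z)
        show "countably_additive (sets borel) ?f"
          unfolding countably_additive_def
        proof (intro allI impI)
          fix F :: "nat \<Rightarrow> real set" assume F: "range F \<subseteq> sets borel" "disjoint_family F"
          then have F': "range (\<lambda>n. F n \<inter> ?H) \<subseteq> sets borel" "disjoint_family (\<lambda>n. F n \<inter> ?H)"
            by (auto simp: disjoint_family_on_def)
          show "(\<Sum>n. ?f (F n)) = ?f (\<Union>n. F n)"
            using moment_suminf[where S=S and F="\<lambda>n. F n \<inter> ?H", OF p S' F'] H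
            by (simp add: le_infI2 del: fun_upd_apply)
        qed
        show "countably_additive (sets borel) ?g"
          unfolding countably_additive_def
        proof (intro allI impI)
          fix F :: "nat \<Rightarrow> real set" assume F: "range F \<subseteq> sets borel" "disjoint_family F"
          then have F': "range (\<lambda>n. F n \<inter> ?H) \<subseteq> sets borel" "disjoint_family (\<lambda>n. F n \<inter> ?H)"
            by (auto simp: disjoint_family_on_def)
          show "(\<Sum>n. ?g (F n)) = ?g (\<Union>n. F n)"
            using pd1_intensity_suminf[where S=S and F="\<lambda>n. F n \<inter> ?H", OF p _ F'] S'
            by (simp del: fun_upd_apply)
        qed
        show "?f X \<noteq> \<infinity>" if "X \<in> sets borel" for X using fin[OF gX[OF that]] by auto
        show "S p \<in> sets borel" using S'[OF p] by simp
        show "?f X = ?g X" if "X \<in> sets borel" "X \<inter> ?H = {} \<or> (\<exists>a b. l p < a \<and> a \<le> b \<and> b \<le> r p \<and> X \<inter> ?H = {a..b})" for X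
        proof -
          have "good p (S(p := X \<inter> ?H))"
            using gX[OF that(1)] that(2) unfolding good_def Icc_def by (auto simp: Suc_le_eq le_less)
          moreover have "p \<le> k" using Suc.prems by simp
          ultimately show ?thesis using Suc.IH by blast
        qed
      qed
      moreover have "S p \<inter> ?H = S p" using g p by (auto simp: good_def)
      ultimately show "?lhs S = pd1_intensity k S" by (simp only: fun_upd_triv)
    qed
  qed
  moreover have "good k S" using S by (auto simp: good_def)
  ultimately show ?thesis by blast
qed

end

section \<open>Absence of multiple points\<close>

text \<open>For \<open>1 \<le> c < m\<close> the cells tile \<open>{1 / m<..1}\<close>. Cell
  \<open>0\<close> is always left out: it touches \<open>0\<close>, where the density
  \<open>1 / x\<close> is not integrable.\<close>

definition cell :: "nat \<Rightarrow> nat \<Rightarrow> real set" where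
  "cell m c = {real c / real m<..real (c + 1) / real m}"

lemma cell_borel [measurable]: "cell m c \<in> sets borel"
  by (simp add: cell_def)

lemma mem_cell_iff: "0 < m \<Longrightarrow> x \<in> cell m c \<longleftrightarrow> real c < x * real m \<and> x * real m \<le> real c + 1"
  by (auto simp: cell_def field_simps)

lemma disjoint_cells: "0 < m \<Longrightarrow> disjoint_family_on (cell m) I"
  unfolding disjoint_family_on_def
proof (intro ballI impI equals0I)
  fix c d x assume "0 < m" "c \<noteq> d" "x \<in> cell m c \<inter> cell m d"
  then have "real c < real d + 1" "real d < real c + 1" by (auto simp: mem_cell_iff)
  then show False using \<open>c \<noteq> d\<close> by linarith
qed

lemma cell_subset: "c \<in> {1..<m} \<Longrightarrow> cell m c \<subseteq> {0<..1}"
proof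
  fix x assume c: "c \<in> {1..<m}" and "x \<in> cell m c"
  then have x: "real c < x * real m" "x * real m \<le> real c + 1" by (auto simp: mem_cell_iff)
  have "0 < x * real m" using x(1) by (rule le_less_trans[rotated]) simp
  then have "0 < x" by (rule zero_less_mult_pos2) (use c in auto)
  moreover have "real c + 1 \<le> real m" using c by auto
  then have "x * real m \<le> 1 * real m" using x(2) by linarith
  then have "x \<le> 1" by (rule mult_right_le_imp_le) (use c in auto)
  ultimately show "x \<in> {0<..1}" by simp
qed

lemma ex_cell:
  assumes m: "0 < m" and x: "1 / real m < x" "x \<le> 1"
  shows "\<exists>c\<in>{1..<m}. x \<in> cell m c"
proof -
  \<comment> \<open>Cells contain their right end, so the index is the ceiling minus one.\<close>
  define c where "c = nat (\<lceil>x * real m\<rceil> - 1)"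
  have 1: "1 < x * real m" using x m by (simp add: field_simps)
  have "x * real m \<le> real m" using x m by (simp add: mult_left_le_one_le)
  then have le: "\<lceil>x * real m\<rceil> \<le> int m" by (simp add: ceiling_le_iff)
  have ge: "1 < \<lceil>x * real m\<rceil>" using 1 by (simp add: less_ceiling_iff)
  have c: "real c = of_int \<lceil>x * real m\<rceil> - 1" using ge by (simp add: c_def)
  have "x \<in> cell m c" unfolding mem_cell_iff[OF m] c by (auto intro: le_of_int_ceiling) linarith
  moreover have "int c = \<lceil>x * real m\<rceil> - 1" using ge by (simp add: c_def)
  then have "c \<in> {1..<m}" using ge le unfolding atLeastLessThan_iff by linarith
  ultimately show ?thesis by blast
qed

text \<open>The box lies inside the simplex \<open>t < 1\<close>, where the density is smallest at
  the upper corner. For a grid cell the factor \<open>(r i - l i) / r i\<close> equals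
  \<open>1 / (c + 1)\<close>.\<close>

lemma pd1_intensity_Ioc_ge:
  assumes lr: "\<And>i. i < k \<Longrightarrow> 0 < l i \<and> l i \<le> r i" and sum: "(\<Sum>i<k. r i) < 1"
  shows "(\<Prod>i<k. ennreal ((r i - l i) / r i)) \<le> pd1_intensity k (\<lambda>i. {l i<..r i})"
proof -
  interpret product_sigma_finite "\<lambda>_. lborel :: real measure" ..
  let ?P = "PiM {..<k} (\<lambda>_. lborel :: real measure)" and ?B = "\<Pi>\<^sub>E i\<in>{..<k}. {l i<..r i}"
  have r: "0 < r i" if "i < k" for i using lr[OF that] by simp
  have [measurable]: "?B \<in> sets ?P" by (rule sets_PiM_I_finite) auto
  have "(\<Prod>i<k. ennreal ((r i - l i) / r i)) = (\<Prod>i<k. ennreal (1 / r i) * ennreal (r i - l i))"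
    using lr r by (intro prod.cong refl) (subst ennreal_mult[symmetric], auto simp: less_imp_le)
  also have "\<dots> = ennreal (1 / (\<Prod>i<k. r i)) * (\<Prod>i<k. ennreal (r i - l i))"
    using r by (subst prod.distrib, subst prod_ennreal) (auto simp: prod_dividef less_imp_le)
  also have "\<dots> = ennreal (1 / (\<Prod>i<k. r i)) * emeasure ?P ?B"
    using lr by (subst emeasure_PiM) auto
  also have "\<dots> = (\<integral>\<^sup>+x. ennreal (1 / (\<Prod>i<k. r i)) * indicator ?B x \<partial>?P)"
    by (subst nn_integral_cmult_indicator) auto
  also have "\<dots> \<le> (\<integral>\<^sup>+x\<in>?B. pd1_density k x \<partial>?P)"
  proof (intro nn_integral_mono)
    fix x
    show "ennreal (1 / (\<Prod>i<k. r i)) * indicator ?B x \<le> pd1_density k x * indicator ?B x"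
    proof (cases "x \<in> ?B")
      case True
      then have x: "l i < x i" "x i \<le> r i" if "i < k" for i using that by (auto simp: PiE_iff)
      have p: "0 < x i" if "i < k" for i using x(1)[OF that] lr[OF that] by simp
      have "(\<Sum>i<k. x i) < 1" using sum_mono[of "{..<k}" x r] x(2) sum by force
      moreover have "1 / (\<Prod>i<k. r i) \<le> 1 / (\<Prod>i<k. x i)"
      proof (rule divide_left_mono)
        show "(\<Prod>i<k. x i) \<le> (\<Prod>i<k. r i)" using x p by (intro prod_mono) (auto simp: less_imp_le)
        show "0 < (\<Prod>i<k. r i) * (\<Prod>i<k. x i)" using p r by (intro mult_pos_pos prod_pos) auto
      qed simp
      ultimately show ?thesis using True by (simp add: pd1_density_def ennreal_leI)
    qed simp
  qed
  also have "\<dots> = pd1_intensity k (\<lambda>i. {l i<..r i})"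
    by (rule pd1_intensity_eq[symmetric]) auto
  finally show ?thesis .
qed

text \<open>Each summand is at least \<open>c - 1\<close>. After division by the square of the grid
  size this is the discrete form of the integral of \<open>x\<close> over the unit interval, the
  first half of the second moment.\<close>

lemma sum_sq_over_Suc_ge: "1 \<le> n \<Longrightarrow> (real n - 1) * (real n - 2) / 2 \<le> (\<Sum>c\<in>{1..<n}. (real c)\<^sup>2 / (real c + 1))"
proof (induction n rule: dec_induct)
  case (step n)
  have "real n - 1 \<le> (real n)\<^sup>2 / (real n + 1)" by (simp add: field_simps power2_eq_square)
  then have "(real (Suc n) - 1) * (real (Suc n) - 2) / 2 \<le> (real n - 1) * (real n - 2) / 2 + (real n)\<^sup>2 / (real n + 1)"
    by (simp add: field_simps)
  then show ?case using step by simp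
qed simp

text \<open>A discrete triangle: pairs \<open>c, d \<ge> q\<close> with
  \<open>c + d < 2 * q + p\<close>. Row \<open>c = q + j\<close> has \<open>p - j\<close> entries,
  and removing the diagonal costs at most one per row. This gives the second half of the second
  moment.\<close>

lemma sum_triangle_ge:
  "real p * (real p - 1) / 2 \<le> (\<Sum>c\<in>{q..<q+p}. real (card ({q..<q+p+q-c} - {c})))"
proof -
  have "real p * (real p - 1) / 2 = (\<Sum>j<p. real p - 1 - real j)"
    by (induction p) (auto simp: sum_subtractf sum.distrib field_simps)
  also have "\<dots> \<le> (\<Sum>j<p. real (card ({q..<q+p+q-(q+j)} - {q+j})))"
  proof (intro sum_mono)
    fix j assume "j \<in> {..<p}"
    then have "real p - 1 - real j = real (card {q..<q+p+q-(q+j)}) - 1" by simp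
    also have "\<dots> \<le> real (card ({q..<q+p+q-(q+j)} - {q+j}))"
      using card_Diff1_le[of "{q..<q+p+q-(q+j)}" "q+j"] by (cases "q + j \<in> {q..<q+p+q-(q+j)}") (auto simp: card_Diff_singleton_if)
    finally show "real p - 1 - real j \<le> real (card ({q..<q+p+q-(q+j)} - {q+j}))" .
  qed
  also have "\<dots> = (\<Sum>c\<in>{q..<q+p}. real (card ({q..<q+p+q-c} - {c})))"
    by (rule sum.reindex_bij_witness[where i="\<lambda>c. c - q" and j="\<lambda>j. q + j"]) auto
  finally show ?thesis .
qed

lemma mcount_ge_1:
  assumes "mcount a S \<noteq> 0"
  shows "1 \<le> mcount a S"
proof -
  have "\<exists>x\<in>S. a x \<noteq> 0"
  proof (rule ccontr)
    assume "\<not> (\<exists>x\<in>S. a x \<noteq> 0)"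
    then have "mcount a S = (\<integral>\<^sup>+x. 0 \<partial>count_space S)" unfolding mcount_def by (intro nn_integral_cong) auto
    then show False using assms by simp
  qed
  then obtain x where x: "x \<in> S" "a x \<noteq> 0" by auto
  then have "of_nat 1 \<le> (of_nat (a x) :: ennreal)" by (intro of_nat_mono) auto
  also have "\<dots> = mcount a {x}" by (simp add: mcount_singleton)
  also have "\<dots> \<le> mcount a S" using x by (intro mcount_mono) auto
  finally show ?thesis by simp
qed

lemma finite_support_of_msum_le_1:
  assumes "msum a \<le> 1" "0 < e" "S \<subseteq> {e..1}"
  shows "finite {x \<in> S. a x \<noteq> 0}"
proof -
  have "mcount a S < \<infinity>" using mcount_le_of_msum_le_1[OF assms] by (rule le_less_trans) simp
  then obtain N where N: "mcount a S < of_nat N" using ennreal_Ex_less_of_nat by auto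
  have "card F \<le> N" if F: "F \<subseteq> {x \<in> S. a x \<noteq> 0}" "finite F" for F
  proof -
    have "of_nat (card F) = (\<Sum>x\<in>F. 1::ennreal)" by simp
    also have "\<dots> \<le> (\<Sum>x\<in>F. mcount a {x})" using F by (intro sum_mono mcount_ge_1) (auto simp: mcount_singleton)
    also have "\<dots> = mcount a (\<Union>x\<in>F. {x})" using F by (intro mcount_sum) (auto simp: disjoint_family_on_def)
    also have "\<dots> \<le> mcount a S" using F by (intro mcount_mono) auto
    finally have "of_nat (card F) < (of_nat N :: ennreal)" using N by (rule le_less_trans)
    then show ?thesis by (simp only: of_nat_less_iff less_imp_le)
  qed
  then show ?thesis by (rule finite_if_finite_subsets_card_bdd[THEN conjunct1])
qed

lemma mcount_of_nat:
  assumes "msum m \<le> 1" "0 < e" "S \<subseteq> {e..1}"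
  shows "\<exists>n. mcount m S = of_nat n"
proof -
  have "mcount m S = (\<integral>\<^sup>+x. of_nat (m x) \<partial>count_space {x \<in> S. m x \<noteq> 0})"
    unfolding mcount_def by (rule nn_integral_count_space_eq) auto
  also have "\<dots> = of_nat (\<Sum>x\<in>{x \<in> S. m x \<noteq> 0}. m x)"
    using finite_support_of_msum_le_1[OF assms] by (simp add: nn_integral_count_space_finite)
  finally show ?thesis ..
qed

section \<open>Second moment of the grid sums\<close>

context pd1_multisubset
begin

text \<open>The bound \<open>c < m - 1\<close> keeps the right end of the cell strictly below
  \<open>1\<close>, inside the support of the density.\<close>

lemma expectation_cell_ge:
  assumes "c \<in> {1..<m-1}"
  shows "ennreal (1 / (real c + 1)) \<le> (\<integral>\<^sup>+\<omega>. mcount (A \<omega>) (cell m c) \<partial>M)"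
proof -
  have m: "0 < real m" using assms by auto
  let ?l = "\<lambda>_::nat. real c / real m" and ?r = "\<lambda>_::nat. real (c + 1) / real m"
  have "(\<Prod>i<1. ennreal ((?r i - ?l i) / ?r i)) \<le> pd1_intensity 1 (\<lambda>i. {?l i<..?r i})"
    using assms m by (intro pd1_intensity_Ioc_ge) (auto simp: field_simps)
  also have "\<dots> = (\<integral>\<^sup>+\<omega>. (\<Prod>i<1::nat. mcount (A \<omega>) {?l i<..?r i}) \<partial>M)"
    using assms m by (intro moment_eq_intensity[symmetric, where l="?l" and r="?r"]) (auto simp: field_simps disjoint_family_on_def)
  finally show ?thesis using m by (simp add: cell_def diff_divide_distrib[symmetric] add.commute)
qed

text \<open>The condition \<open>c + d + 2 < m\<close> says that the right ends of the two cells sum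
  to less than \<open>1\<close>.\<close>

lemma expectation_two_cells_ge:
  assumes "1 \<le> c" "1 \<le> d" "c \<noteq> d" "c + d + 2 < m"
  shows "ennreal (1 / ((real c + 1) * (real d + 1))) \<le> (\<integral>\<^sup>+\<omega>. mcount (A \<omega>) (cell m c) * mcount (A \<omega>) (cell m d) \<partial>M)"
proof -
  have m: "0 < m" using assms by auto
  define b where "b i = (if i = 0 then c else d)" for i :: nat
  let ?l = "\<lambda>i. real (b i) / real m" and ?r = "\<lambda>i. real (b i + 1) / real m"
  have "(real c + real d + 2) * real m < real m * real m" using assms m by (intro mult_strict_right_mono) auto
  then have cd: "real c * real m + (real d * real m + real m * 2) < real m * real m" by (simp add: algebra_simps)
  have two: "{..<2} = {0, 1::nat}" by auto
  have "(\<Prod>i<2. ennreal ((?r i - ?l i) / ?r i)) \<le> pd1_intensity 2 (\<lambda>i. {?l i<..?r i})"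
    using assms m by (intro pd1_intensity_Ioc_ge) (use cd in \<open>auto simp: field_simps b_def two\<close>)
  also have "\<dots> = (\<integral>\<^sup>+\<omega>. (\<Prod>i<2. mcount (A \<omega>) {?l i<..?r i}) \<partial>M)"
  proof (intro moment_eq_intensity[symmetric, where l="?l" and r="?r"])
    show "disjoint_family_on (\<lambda>i. {?l i<..?r i}) {..<2}"
      using disjoint_cells[OF m, of UNIV] assms(3) by (auto simp: disjoint_family_on_def two b_def cell_def)
  qed (use assms m in \<open>auto simp: field_simps b_def\<close>)
  finally show ?thesis using m by (simp add: two b_def cell_def diff_divide_distrib[symmetric] ennreal_mult[symmetric] add.commute)
qed

text \<open>Ordered pairs of points in a common cell, weighted by the squared left end. A multiple
  point keeps this away from \<open>0\<close> on all fine grids, while its mean will be shown to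
  vanish in the limit.\<close>

definition excess :: "nat \<Rightarrow> 'a \<Rightarrow> ennreal" where
  "excess m \<omega> = (\<Sum>c\<in>{1..<m}. ennreal ((real c / real m)\<^sup>2) * (mcount (A \<omega>) (cell m c) * (mcount (A \<omega>) (cell m c) - 1)))"

text \<open>Cells with \<open>c \<ge> m\<close> lie outside the unit interval, and cell indices are
  unrestricted here; intersecting with \<open>{0<..1}\<close> loses no points.\<close>

lemma cell_count_measurable [measurable]: "(\<lambda>\<omega>. mcount (A \<omega>) (cell m c)) \<in> borel_measurable M"
proof -
  have "mcount (A \<omega>) (cell m c) = mcount (A \<omega>) (cell m c \<inter> {0<..1})" if "\<omega> \<in> space M" for \<omega>
  proof -
    have "{x. A \<omega> x \<noteq> 0} \<subseteq> {0<..1}" using random that by (simp only: random_multisubset_def multisubset_def)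
    then have "A \<omega> x = 0" if "x \<notin> {0<..1}" for x using that by blast
    then show ?thesis unfolding mcount_def by (intro nn_integral_count_space_eq) auto
  qed
  moreover have "(\<lambda>\<omega>. mcount (A \<omega>) (cell m c \<inter> {0<..1})) \<in> borel_measurable M"
    by (rule mcount_measurable) auto
  ultimately show ?thesis by (simp cong: measurable_cong)
qed

lemma excess_measurable [measurable]: "excess m \<in> borel_measurable M"
  unfolding excess_def[abs_def] by measurable

text \<open>The square of the lower grid sum of \<open>T\<close> is at most \<open>1\<close>; it
  splits into the excess, the diagonal with \<open>N\<close> in place of \<open>N * (N - 1)\<close>,
  and the pairs of distinct cells.\<close>

lemma excess_second_moment:
  assumes m: "0 < m"
  shows "(\<integral>\<^sup>+\<omega>. excess m \<omega> \<partial>M) + ((\<Sum>c\<in>{1..<m}. ennreal ((real c / real m)\<^sup>2) * (\<integral>\<^sup>+\<omega>. mcount (A \<omega>) (cell m c) \<partial>M)) +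
    (\<Sum>c\<in>{1..<m}. \<Sum>d\<in>{1..<m}-{c}. ennreal (real c / real m * (real d / real m)) *
       (\<integral>\<^sup>+\<omega>. mcount (A \<omega>) (cell m c) * mcount (A \<omega>) (cell m d) \<partial>M))) \<le> 1"
    (is "?L \<le> 1")
proof -
  let ?N = "\<lambda>\<omega> c. mcount (A \<omega>) (cell m c)" and ?t = "\<lambda>c. real c / real m"
  let ?C = "{1..<m}"
  have "?L = (\<integral>\<^sup>+\<omega>. excess m \<omega> + ((\<Sum>c\<in>?C. ennreal ((?t c)\<^sup>2) * ?N \<omega> c) +
      (\<Sum>c\<in>?C. \<Sum>d\<in>?C-{c}. ennreal (?t c * ?t d) * (?N \<omega> c * ?N \<omega> d))) \<partial>M)"
    by (simp add: nn_integral_add nn_integral_sum nn_integral_cmult)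
  also have "\<dots> \<le> (\<integral>\<^sup>+\<omega>. 1 \<partial>M)"
  proof (rule nn_integral_mono_AE, use AE_msum_le in eventually_elim)
    fix \<omega> assume le: "msum (A \<omega>) \<le> 1"
    let ?a = "\<lambda>c. ennreal (?t c) * ?N \<omega> c"
    have sq: "?a c * ?a c = ennreal ((?t c)\<^sup>2) * (?N \<omega> c * (?N \<omega> c - 1)) + ennreal ((?t c)\<^sup>2) * ?N \<omega> c" if c: "c \<in> ?C" for c
    proof -
      have "cell m c \<subseteq> {?t c..1}" "0 < ?t c" using cell_subset[OF c] c m by (auto simp: cell_def)
      then obtain n where n: "?N \<omega> c = of_nat n" using mcount_of_nat[OF le] by blast
      \<comment> \<open>For \<open>n = 0\<close> the truncated difference \<open>0 - 1\<close> is
        \<open>0\<close>, and both sides vanish.\<close>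
      have "of_nat n * of_nat n = of_nat n * (of_nat n - 1) + (of_nat n :: ennreal)"
        by (cases n) (auto simp: algebra_simps)
      moreover have "?a c * ?a c = ennreal ((?t c)\<^sup>2) * (of_nat n * of_nat n)"
        unfolding n power2_eq_square by (subst ennreal_mult) (simp_all only: mult_ac of_nat_0_le_iff zero_le_divide_iff simp_thms)
      ultimately show ?thesis unfolding n by (simp only: distrib_left)
    qed
    have "excess m \<omega> + ((\<Sum>c\<in>?C. ennreal ((?t c)\<^sup>2) * ?N \<omega> c) +
        (\<Sum>c\<in>?C. \<Sum>d\<in>?C-{c}. ennreal (?t c * ?t d) * (?N \<omega> c * ?N \<omega> d))) =
        (\<Sum>c\<in>?C. ?a c * ?a c) + (\<Sum>c\<in>?C. \<Sum>d\<in>?C-{c}. ?a c * ?a d)"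
    proof -
      have "(\<Sum>c\<in>?C. ?a c * ?a c) = excess m \<omega> + (\<Sum>c\<in>?C. ennreal ((?t c)\<^sup>2) * ?N \<omega> c)"
        unfolding excess_def sum.distrib[symmetric] by (intro sum.cong refl sq)
      moreover have "?a c * ?a d = ennreal (?t c * ?t d) * (?N \<omega> c * ?N \<omega> d)" for c d
        by (subst ennreal_mult) (simp_all only: mult_ac of_nat_0_le_iff zero_le_divide_iff simp_thms)
      ultimately show ?thesis by (simp only: add.assoc)
    qed
    also have "\<dots> = (\<Sum>c\<in>?C. \<Sum>d\<in>?C. ?a c * ?a d)"
      unfolding sum.distrib[symmetric] by (intro sum.cong refl sum.remove[symmetric]) auto
    also have "\<dots> = (\<Sum>c\<in>?C. ?a c) * (\<Sum>c\<in>?C. ?a c)" by (rule sum_product[symmetric])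
    also have "\<dots> \<le> 1 * 1"
    proof (intro mult_mono)
      have "(\<Sum>c\<in>?C. ?a c) \<le> msum (A \<omega>)"
        using m cell_subset by (intro sum_mcount_le_msum disjoint_cells) (auto simp: cell_def)
      then show "(\<Sum>c\<in>?C. ?a c) \<le> 1" "(\<Sum>c\<in>?C. ?a c) \<le> 1" using le by (auto intro: order_trans)
    qed auto
    finally show "excess m \<omega> + ((\<Sum>c\<in>?C. ennreal ((?t c)\<^sup>2) * ?N \<omega> c) +
        (\<Sum>c\<in>?C. \<Sum>d\<in>?C-{c}. ennreal (?t c * ?t d) * (?N \<omega> c * ?N \<omega> d))) \<le> 1" by simp
  qed
  also have "\<dots> = 1" by (simp add: emeasure_space_1)
  finally show ?thesis .
qed

text \<open>Discarding the cells below \<open>q\<close> makes every ratio \<open>c / (c + 1)\<close>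
  at least \<open>q / (q + 1)\<close>; \<open>p\<close> is the side of the remaining triangle of
  pairs. The summand \<open>2\<close> in \<open>m\<close> accounts for the two cell widths, so that
  all pairs with \<open>c + d < 2 * q + p\<close> satisfy \<open>c + d + 2 < m\<close>.\<close>

lemma expectation_excess_le:
  assumes m: "m = q + q + p + 2" and q: "1 \<le> q"
  shows "(\<integral>\<^sup>+\<omega>. excess m \<omega> \<partial>M) \<le> ennreal (1 - ((real m - 2) * (real m - 3) / 2 +
    (real q / (real q + 1))\<^sup>2 * (real p * (real p - 1) / 2)) / (real m)\<^sup>2)"
proof -
  have m0: "0 < m" using m by simp
  define \<kappa> where "\<kappa> = (real q / (real q + 1))\<^sup>2"
  \<comment> \<open>\<open>a\<close> bounds the diagonal part and \<open>b\<close> the part of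
    distinct cells; each tends to \<open>1/2\<close> for a suitable choice of \<open>q\<close> and
    \<open>p\<close>.\<close>
  define a where "a = (real m - 2) * (real m - 3) / 2 / (real m)\<^sup>2"
  define b where "b = \<kappa> * (real p * (real p - 1) / 2) / (real m)\<^sup>2"
  have a0: "0 \<le> a" unfolding a_def using m q by (intro divide_nonneg_nonneg mult_nonneg_nonneg) auto
  have b0: "0 \<le> b" unfolding b_def \<kappa>_def
    by (cases p) (auto intro!: divide_nonneg_nonneg mult_nonneg_nonneg)
  let ?t = "\<lambda>c. real c / real m"
  let ?E1 = "\<lambda>c. \<integral>\<^sup>+\<omega>. mcount (A \<omega>) (cell m c) \<partial>M"
  let ?E2 = "\<lambda>c d. \<integral>\<^sup>+\<omega>. mcount (A \<omega>) (cell m c) * mcount (A \<omega>) (cell m d) \<partial>M"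
  have "ennreal a \<le> ennreal (\<Sum>c\<in>{1..<m-1}. (?t c)\<^sup>2 * (1 / (real c + 1)))"
  proof (rule ennreal_leI)
    have "a \<le> (\<Sum>c\<in>{1..<m-1}. (real c)\<^sup>2 / (real c + 1)) / (real m)\<^sup>2"
      unfolding a_def using sum_sq_over_Suc_ge[of "m - 1"] m by (intro divide_right_mono) (auto simp: of_nat_diff)
    then show "a \<le> (\<Sum>c\<in>{1..<m-1}. (?t c)\<^sup>2 * (1 / (real c + 1)))"
      by (simp add: sum_divide_distrib power_divide mult.commute)
  qed
  also have "\<dots> = (\<Sum>c\<in>{1..<m-1}. ennreal ((?t c)\<^sup>2) * ennreal (1 / (real c + 1)))"
    by (subst sum_ennreal[symmetric], simp, intro sum.cong refl ennreal_mult) auto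
  also have "\<dots> \<le> (\<Sum>c\<in>{1..<m-1}. ennreal ((?t c)\<^sup>2) * ?E1 c)"
    by (intro sum_mono mult_left_mono expectation_cell_ge) auto
  also have "\<dots> \<le> (\<Sum>c\<in>{1..<m}. ennreal ((?t c)\<^sup>2) * ?E1 c)"
    by (intro sum_mono2) auto
  finally have alpha: "ennreal a \<le> \<dots>" .
  have "ennreal b \<le> ennreal (\<Sum>c\<in>{q..<q+p}. \<Sum>d\<in>{q..<q+p+q-c}-{c}. \<kappa> / (real m)\<^sup>2)"
  proof (rule ennreal_leI)
    have "b = (\<kappa> / (real m)\<^sup>2) * (real p * (real p - 1) / 2)" by (simp add: b_def)
    also have "\<dots> \<le> (\<kappa> / (real m)\<^sup>2) * (\<Sum>c\<in>{q..<q+p}. real (card ({q..<q+p+q-c} - {c})))"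
      by (intro mult_left_mono sum_triangle_ge) (simp add: \<kappa>_def)
    also have "\<dots> = (\<Sum>c\<in>{q..<q+p}. \<Sum>d\<in>{q..<q+p+q-c}-{c}. \<kappa> / (real m)\<^sup>2)"
      by (simp only: sum_constant sum_distrib_left mult.commute)
    finally show "b \<le> (\<Sum>c\<in>{q..<q+p}. \<Sum>d\<in>{q..<q+p+q-c}-{c}. \<kappa> / (real m)\<^sup>2)" .
  qed
  also have "\<dots> = (\<Sum>c\<in>{q..<q+p}. \<Sum>d\<in>{q..<q+p+q-c}-{c}. ennreal (\<kappa> / (real m)\<^sup>2))"
    by (subst sum_ennreal[symmetric], simp add: \<kappa>_def sum_nonneg, intro sum.cong refl sum_ennreal[symmetric]) (simp add: \<kappa>_def)
  also have "\<dots> \<le> (\<Sum>c\<in>{q..<q+p}. \<Sum>d\<in>{q..<q+p+q-c}-{c}. ennreal (?t c * ?t d) * ?E2 c d)"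
  proof (intro sum_mono)
    fix c d assume c: "c \<in> {q..<q+p}" and d: "d \<in> {q..<q+p+q-c}-{c}"
    have frac: "real q / (real q + 1) \<le> real n / (real n + 1)" if "q \<le> n" for n using that by (simp add: field_simps)
    have "\<kappa> \<le> real c / (real c + 1) * (real d / (real d + 1))"
      unfolding \<kappa>_def power2_eq_square using c d by (intro mult_mono frac) auto
    then have "\<kappa> / (real m)\<^sup>2 \<le> real c / (real c + 1) * (real d / (real d + 1)) / (real m)\<^sup>2"
      by (rule divide_right_mono) simp
    also have "\<dots> = ?t c * ?t d * (1 / ((real c + 1) * (real d + 1)))" by (simp add: power2_eq_square)
    finally have "ennreal (\<kappa> / (real m)\<^sup>2) \<le> ennreal (?t c * ?t d * (1 / ((real c + 1) * (real d + 1))))" by (rule ennreal_leI)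
    also have "\<dots> = ennreal (?t c * ?t d) * ennreal (1 / ((real c + 1) * (real d + 1)))" by (rule ennreal_mult) auto
    also have "\<dots> \<le> ennreal (?t c * ?t d) * ?E2 c d"
      using c d q m by (intro mult_left_mono expectation_two_cells_ge) auto
    finally show "ennreal (\<kappa> / (real m)\<^sup>2) \<le> ennreal (?t c * ?t d) * ?E2 c d" .
  qed
  also have "\<dots> \<le> (\<Sum>c\<in>{q..<q+p}. \<Sum>d\<in>{1..<m}-{c}. ennreal (?t c * ?t d) * ?E2 c d)"
    using q m by (intro sum_mono sum_mono2) auto
  also have "\<dots> \<le> (\<Sum>c\<in>{1..<m}. \<Sum>d\<in>{1..<m}-{c}. ennreal (?t c * ?t d) * ?E2 c d)"
    using q m by (intro sum_mono2) auto
  finally have beta: "ennreal b \<le> \<dots>" .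
  let ?X = "\<integral>\<^sup>+\<omega>. excess m \<omega> \<partial>M"
  have "?X + (ennreal a + ennreal b) \<le> 1"
    by (rule order_trans[OF add_left_mono[OF add_mono[OF alpha beta]] excess_second_moment[OF m0]])
  then have "?X + ennreal (a + b) \<le> 1" using a0 b0 by simp
  then have "?X \<le> ennreal (1 - (a + b))"
    using a0 b0 by (cases ?X) (auto simp: ennreal_plus[symmetric] top_unique simp del: ennreal_plus intro!: ennreal_leI)
  also have "a + b = ((real m - 2) * (real m - 3) / 2 + \<kappa> * (real p * (real p - 1) / 2)) / (real m)\<^sup>2"
    unfolding a_def b_def by (simp add: add_divide_distrib)
  finally show ?thesis by (simp add: \<kappa>_def)
qed

lemma AE_multiplicity_le_1: "AE \<omega> in M. \<forall>x. A \<omega> x \<le> 1"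
proof -
  \<comment> \<open>Both \<open>q\<close> and \<open>p\<close> tend to infinity and \<open>q\<close>
    is negligible against \<open>p\<close>, so \<open>q / (q + 1)\<close> and \<open>p / m\<close>
    tend to \<open>1\<close>, and the bound \<open>L\<close> tends to
    \<open>1 - (1/2 + 1/2) = 0\<close>.\<close>
  define q where "q n = n + 1" for n :: nat
  define p where "p n = (n + 1)\<^sup>2" for n :: nat
  define m where "m n = q n + q n + p n + 2" for n
  define L where "L n = 1 - ((real (m n) - 2) * (real (m n) - 3) / 2 +
    (real (q n) / (real (q n) + 1))\<^sup>2 * (real (p n) * (real (p n) - 1) / 2)) / (real (m n))\<^sup>2" for n
  have excess_le: "(\<integral>\<^sup>+\<omega>. excess (m n) \<omega> \<partial>M) \<le> ennreal (L n)" for n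
    unfolding L_def by (rule expectation_excess_le[OF m_def]) (simp add: q_def)
  have "L \<longlonglongrightarrow> 0" unfolding L_def m_def p_def q_def by real_asymp
  \<comment> \<open>Fatou's lemma turns convergence of the means into an almost sure statement about
    the lower limit.\<close>
  have "(\<integral>\<^sup>+\<omega>. liminf (\<lambda>n. excess (m n) \<omega>) \<partial>M) \<le> liminf (\<lambda>n. \<integral>\<^sup>+\<omega>. excess (m n) \<omega> \<partial>M)"
    by (rule nn_integral_liminf) measurable
  also have "\<dots> \<le> liminf (\<lambda>n. ennreal (L n))"
    by (intro Liminf_mono always_eventually allI) (rule excess_le)
  also have "\<dots> = 0"
    using lim_imp_Liminf[OF _ tendsto_ennrealI[OF \<open>L \<longlonglongrightarrow> 0\<close>]] by simp
  finally have "(\<integral>\<^sup>+\<omega>. liminf (\<lambda>n. excess (m n) \<omega>) \<partial>M) = 0" by simp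
  then have "AE \<omega> in M. liminf (\<lambda>n. excess (m n) \<omega>) = 0"
    by (subst (asm) nn_integral_0_iff_AE) auto
  moreover have "AE \<omega> in M. multisubset (A \<omega>)" using random by (auto simp: random_multisubset_def)
  ultimately show ?thesis
  proof eventually_elim
    case (elim \<omega>)
    show ?case
    proof (rule ccontr)
      assume "\<not> (\<forall>x. A \<omega> x \<le> 1)"
      then obtain x where x: "2 \<le> A \<omega> x" by (auto simp: not_le Suc_le_eq numeral_2_eq_2)
      then have x01: "0 < x" "x \<le> 1" using elim(2) by (auto simp: multisubset_def subset_eq)
      have "filterlim (\<lambda>n. real (m n)) at_top sequentially" unfolding m_def p_def q_def by real_asymp
      then have ev: "eventually (\<lambda>n. 2 / x < real (m n)) sequentially"
        by (simp add: filterlim_at_top_dense)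
      \<comment> \<open>Once cells are shorter than \<open>x / 2\<close>, the cell of a double point
        \<open>x\<close> has left end at least \<open>x / 2\<close> and count
        \<open>N \<ge> 2\<close>, so its summand alone is at least \<open>(x / 2)^2\<close>,
        independently of the grid.\<close>
      have "eventually (\<lambda>n. ennreal ((x / 2)\<^sup>2) \<le> excess (m n) \<omega>) sequentially"
        using ev
      proof eventually_elim
        case (elim n)
        have m0: "0 < m n" by (simp add: m_def)
        have mx: "2 / real (m n) < x" using elim x01 m0 by (simp add: field_simps)
        then have "1 / real (m n) < x" using m0 by (simp add: field_simps)
        then obtain c where c: "c \<in> {1..<m n}" "x \<in> cell (m n) c" using ex_cell[OF m0 _ x01(2)] by blast
        have "x \<le> real c / real (m n) + 1 / real (m n)" using c(2) by (simp add: cell_def add_divide_distrib)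
        moreover have "1 / real (m n) < x / 2" using mx m0 by (simp add: field_simps)
        ultimately have "x / 2 \<le> real c / real (m n)" by linarith
        then have sq: "(x / 2)\<^sup>2 \<le> (real c / real (m n))\<^sup>2" using x01 by (intro power_mono) auto
        let ?N = "mcount (A \<omega>) (cell (m n) c)"
        have "of_nat 2 \<le> (of_nat (A \<omega> x) :: ennreal)" using x by (simp only: of_nat_le_iff)
        also have "\<dots> = mcount (A \<omega>) {x}" by (simp add: mcount_singleton)
        also have "\<dots> \<le> ?N" using c by (intro mcount_mono) auto
        finally have N: "2 \<le> ?N" by simp
        have "(1::ennreal) = 2 - 1" by (simp flip: ennreal_numeral ennreal_1 add: ennreal_minus)
        also have "\<dots> \<le> ?N - 1" using N by (intro ennreal_minus_mono) auto
        finally have "1 * 1 \<le> ?N * (?N - 1)" using N by (intro mult_mono) (auto intro: order_trans[rotated])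
        then have "ennreal ((x / 2)\<^sup>2) * 1 \<le> ennreal ((real c / real (m n))\<^sup>2) * (?N * (?N - 1))"
          using sq by (intro mult_mono ennreal_leI) auto
        also have "\<dots> \<le> excess (m n) \<omega>" unfolding excess_def
          using c(1) by (intro member_le_sum[where f="\<lambda>c. ennreal ((real c / real (m n))\<^sup>2) * (mcount (A \<omega>) (cell (m n) c) * (mcount (A \<omega>) (cell (m n) c) - 1))"]) auto
        finally show "ennreal ((x / 2)\<^sup>2) \<le> excess (m n) \<omega>" by simp
      qed
      then have "ennreal ((x / 2)\<^sup>2) \<le> liminf (\<lambda>n. excess (m n) \<omega>)" by (rule Liminf_bounded)
      then show False using elim(1) x01 by (simp add: ennreal_eq_0_iff)
    qed
  qed
qed

end

section \<open>Joint moments of counts\<close>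

text \<open>\<open>j\<close> assigns a cell to each factor. Factors sharing a cell are merged into a
  single count on the intersection of their sets, so every term is a product over distinct cells,
  whose mean is an intensity. The \<open>T i\<close> may overlap or repeat, which covers higher
  powers of one count.\<close>

definition coarse_moment :: "(real \<Rightarrow> nat) \<Rightarrow> 'i set \<Rightarrow> ('i \<Rightarrow> real set) \<Rightarrow> nat \<Rightarrow> ennreal" where
  "coarse_moment a I T n = (\<Sum>j\<in>I \<rightarrow>\<^sub>E {1..<n}. \<Prod>c\<in>j ` I. mcount a {x \<in> cell n c. \<forall>i\<in>I. j i = c \<longrightarrow> x \<in> T i})"

text \<open>A nonzero count is at least \<open>1\<close>, so further factors do not decrease the
  product.\<close>

lemma mcount_Int_le_prod:
  assumes F: "finite F" "F \<noteq> {}" and S: "\<And>i. i \<in> F \<Longrightarrow> S \<subseteq> T i"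
  shows "mcount a S \<le> (\<Prod>i\<in>F. mcount a (T i))"
proof (cases "mcount a S = 0")
  case False
  have ge: "1 \<le> mcount a (T i)" if "i \<in> F" for i
    using mcount_ge_1[OF False] mcount_mono[OF S[OF that]] by (rule order_trans)
  obtain i where i: "i \<in> F" using F by auto
  have "mcount a S * 1 \<le> mcount a (T i) * (\<Prod>j\<in>F-{i}. mcount a (T j))"
    using i ge by (intro mult_mono mcount_mono S prod_ge_1) auto
  then show ?thesis using i F by (simp add: prod.remove)
qed simp

text \<open>With at most one point, and that one simple, all counts are the
  \<open>0\<close>-\<open>1\<close> indicators of this point, and indicators of intersections are
  products.\<close>

lemma mcount_Int_eq_prod:
  assumes F: "finite F" "F \<noteq> {}" and a: "\<And>x. a x \<le> 1"
    and one: "\<And>x y i j. i \<in> F \<Longrightarrow> j \<in> F \<Longrightarrow> x \<in> T i \<Longrightarrow> y \<in> T j \<Longrightarrow> a x \<noteq> 0 \<Longrightarrow> a y \<noteq> 0 \<Longrightarrow> x = y"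
  shows "mcount a (\<Inter>i\<in>F. T i) = (\<Prod>i\<in>F. mcount a (T i))"
proof (cases "\<exists>i\<in>F. \<exists>x\<in>T i. a x \<noteq> 0")
  case True
  then obtain y i where y: "i \<in> F" "y \<in> T i" "a y \<noteq> 0" by auto
  have ay: "a y = 1" using a[of y] y by auto
  have *: "mcount a X = (if y \<in> X then 1 else 0)" if X: "\<And>x. x \<in> X \<Longrightarrow> a x \<noteq> 0 \<Longrightarrow> x = y" for X
  proof -
    have "mcount a X = mcount a (X \<inter> {y})" unfolding mcount_def
      by (rule nn_integral_count_space_eq) (use X in auto)
    also have "\<dots> = (if y \<in> X then 1 else 0)" by (simp add: mcount_singleton ay)
    finally show ?thesis .
  qed
  have T: "mcount a (T j) = (if y \<in> T j then 1 else 0)" if "j \<in> F" for j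
    by (rule *) (use one[OF that y(1)] y in auto)
  have "mcount a (\<Inter>i\<in>F. T i) = (if y \<in> (\<Inter>i\<in>F. T i) then 1 else 0)"
    by (rule *) (use one[OF y(1) y(1)] y in auto)
  also have "\<dots> = (\<Prod>i\<in>F. if y \<in> T i then 1 else 0)"
    using F by (auto simp: prod_zero_iff)
  also have "\<dots> = (\<Prod>i\<in>F. mcount a (T i))" by (intro prod.cong refl) (simp add: T)
  finally show ?thesis .
next
  case False
  have z: "mcount a X = 0" if "i \<in> F" "X \<subseteq> T i" for X i
  proof -
    have "mcount a X = mcount a {}" unfolding mcount_def
      by (rule nn_integral_count_space_eq) (use False that in auto)
    then show ?thesis by simp
  qed
  obtain i where i: "i \<in> F" using F by auto
  have "mcount a (\<Inter>i\<in>F. T i) = 0" using i by (intro z[OF i]) auto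
  moreover have "(\<Prod>i\<in>F. mcount a (T i)) = 0" using F i z[OF i order_refl] by (auto simp: prod_zero_iff)
  ultimately show ?thesis by simp
qed

lemma prod_sum_cells:
  assumes I: "finite I"
  shows "(\<Prod>i\<in>I. \<Sum>c\<in>{1..<n}. mcount a (T i \<inter> cell n c)) =
    (\<Sum>j\<in>I \<rightarrow>\<^sub>E {1..<n}. \<Prod>c\<in>j ` I. \<Prod>i\<in>{i \<in> I. j i = c}. mcount a (T i \<inter> cell n c))"
proof -
  have "(\<Prod>i\<in>I. \<Sum>c\<in>{1..<n}. mcount a (T i \<inter> cell n c)) = (\<Sum>j\<in>I \<rightarrow>\<^sub>E {1..<n}. \<Prod>i\<in>I. mcount a (T i \<inter> cell n (j i)))"
    using I by (intro prod_sum_PiE) auto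
  also have "\<dots> = (\<Sum>j\<in>I \<rightarrow>\<^sub>E {1..<n}. \<Prod>c\<in>j ` I. \<Prod>i\<in>{i \<in> I. j i = c}. mcount a (T i \<inter> cell n (j i)))"
    by (intro sum.cong refl prod.image_gen I)
  also have "\<dots> = (\<Sum>j\<in>I \<rightarrow>\<^sub>E {1..<n}. \<Prod>c\<in>j ` I. \<Prod>i\<in>{i \<in> I. j i = c}. mcount a (T i \<inter> cell n c))"
    by (intro sum.cong refl prod.cong) auto
  finally show ?thesis .
qed

text \<open>Holds for every multiset and every grid, so the full product can serve as majorant for
  dominated convergence.\<close>

lemma coarse_moment_le:
  assumes I: "finite I" and n: "0 < n"
  shows "coarse_moment a I T n \<le> (\<Prod>i\<in>I. mcount a (T i))"
proof -
  have "coarse_moment a I T n \<le> (\<Sum>j\<in>I \<rightarrow>\<^sub>E {1..<n}. \<Prod>c\<in>j ` I. \<Prod>i\<in>{i \<in> I. j i = c}. mcount a (T i \<inter> cell n c))"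
    unfolding coarse_moment_def using I
    by (intro sum_mono prod_mono_ennreal mcount_Int_le_prod) auto
  also have "\<dots> = (\<Prod>i\<in>I. \<Sum>c\<in>{1..<n}. mcount a (T i \<inter> cell n c))"
    by (rule prod_sum_cells[OF I, symmetric])
  also have "\<dots> \<le> (\<Prod>i\<in>I. mcount a (T i))"
  proof (intro prod_mono_ennreal)
    fix i
    have "(\<Sum>c\<in>{1..<n}. mcount a (T i \<inter> cell n c)) = mcount a (\<Union>c\<in>{1..<n}. T i \<inter> cell n c)"
      using disjoint_cells[OF n, of "{1..<n}"] by (intro mcount_sum) (auto simp: disjoint_family_on_def)
    also have "\<dots> \<le> mcount a (T i)" by (intro mcount_mono) auto
    finally show "(\<Sum>c\<in>{1..<n}. mcount a (T i \<inter> cell n c)) \<le> mcount a (T i)" .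
  qed
  finally show ?thesis .
qed

text \<open>Only finitely many points lie in \<open>{e..1}\<close>. On grids finer than their least
  distance each cell contains at most one of them, and merging factors becomes exact.\<close>

lemma coarse_moment_eventually:
  assumes I: "finite I" and e: "0 < e" and T: "\<And>i. i \<in> I \<Longrightarrow> T i \<subseteq> {e..1}"
    and a: "\<And>x. a x \<le> 1" and le: "msum a \<le> 1"
  shows "eventually (\<lambda>n. coarse_moment a I T n = (\<Prod>i\<in>I. mcount a (T i))) sequentially"
proof -
  define P where "P = {x \<in> {e..1}. a x \<noteq> 0}"
  have P: "finite P" unfolding P_def by (rule finite_support_of_msum_le_1[OF le e order_refl])
  \<comment> \<open>Including \<open>e\<close> forces \<open>1 / n < e\<close>, so the cells with
    \<open>c \<ge> 1\<close> cover all \<open>T i\<close>; it also keeps the minimum defined when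
    there are fewer than two points.\<close>
  define \<delta> where "\<delta> = Min (insert e ((\<lambda>(x, y). \<bar>x - y\<bar>) ` {(x, y) \<in> P \<times> P. x \<noteq> y}))"
  have finD: "finite {(x, y) \<in> P \<times> P. x \<noteq> y}" by (rule finite_subset[of _ "P \<times> P"]) (use P in auto)
  have \<delta>: "0 < \<delta>" "\<delta> \<le> e" "\<And>x y. x \<in> P \<Longrightarrow> y \<in> P \<Longrightarrow> x \<noteq> y \<Longrightarrow> \<delta> \<le> \<bar>x - y\<bar>"
    unfolding \<delta>_def using finD e by (auto intro!: Min_le simp: Min_gr_iff)
  have "eventually (\<lambda>n. 1 / \<delta> < real n) sequentially"
    using filterlim_real_sequentially by (simp add: filterlim_at_top_dense)
  then show ?thesis
  proof eventually_elim
    case (elim n)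
    have "0 < 1 / \<delta>" using \<delta> by simp
    then have n: "0 < n" using elim by (metis less_trans of_nat_0_less_iff)
    have n1: "1 / real n < \<delta>" using elim \<delta> n by (simp add: field_simps)
    have same: "x = y" if "x \<in> P" "y \<in> P" "x \<in> cell n c" "y \<in> cell n c" for x y c
    proof (rule ccontr)
      assume "x \<noteq> y"
      then have "\<delta> \<le> \<bar>x - y\<bar>" using \<delta> that by auto
      also have "\<bar>x - y\<bar> < 1 / real n" using that(3,4) by (auto simp: cell_def add_divide_distrib)
      finally show False using n1 by simp
    qed
    have "coarse_moment a I T n = (\<Sum>j\<in>I \<rightarrow>\<^sub>E {1..<n}. \<Prod>c\<in>j ` I. \<Prod>i\<in>{i \<in> I. j i = c}. mcount a (T i \<inter> cell n c))"
      unfolding coarse_moment_def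
    proof (intro sum.cong refl prod.cong)
      fix j c assume j: "j \<in> I \<rightarrow>\<^sub>E {1..<n}" and c: "c \<in> j ` I"
      let ?F = "{i \<in> I. j i = c}"
      have F: "finite ?F" "?F \<noteq> {}" using I c by auto
      have "{x \<in> cell n c. \<forall>i\<in>I. j i = c \<longrightarrow> x \<in> T i} = (\<Inter>i\<in>?F. T i \<inter> cell n c)" using F by auto
      also have "mcount a \<dots> = (\<Prod>i\<in>?F. mcount a (T i \<inter> cell n c))"
      proof (rule mcount_Int_eq_prod[OF F a])
        fix x y i k assume "i \<in> ?F" "k \<in> ?F" "x \<in> T i \<inter> cell n c" "y \<in> T k \<inter> cell n c" "a x \<noteq> 0" "a y \<noteq> 0"
        then show "x = y" using T[of i] T[of k] by (intro same) (auto simp: P_def)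
      qed
      finally show "mcount a {x \<in> cell n c. \<forall>i\<in>I. j i = c \<longrightarrow> x \<in> T i} = (\<Prod>i\<in>?F. mcount a (T i \<inter> cell n c))" .
    qed
    also have "\<dots> = (\<Prod>i\<in>I. \<Sum>c\<in>{1..<n}. mcount a (T i \<inter> cell n c))"
      by (rule prod_sum_cells[OF I, symmetric])
    also have "\<dots> = (\<Prod>i\<in>I. mcount a (T i))"
    proof (intro prod.cong refl)
      fix i assume i: "i \<in> I"
      have "(\<Sum>c\<in>{1..<n}. mcount a (T i \<inter> cell n c)) = mcount a (\<Union>c\<in>{1..<n}. T i \<inter> cell n c)"
        using disjoint_cells[OF n, of "{1..<n}"] by (intro mcount_sum) (auto simp: disjoint_family_on_def)
      also have "(\<Union>c\<in>{1..<n}. T i \<inter> cell n c) = T i"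
      proof (intro set_eqI iffI)
        fix x assume x: "x \<in> T i"
        then have "e \<le> x" "x \<le> 1" using T[OF i] by auto
        then have "1 / real n < x" using n1 \<delta>(2) by simp
        then show "x \<in> (\<Union>c\<in>{1..<n}. T i \<inter> cell n c)" using ex_cell[OF n _ \<open>x \<le> 1\<close>] x by auto
      qed auto
      finally show "(\<Sum>c\<in>{1..<n}. mcount a (T i \<inter> cell n c)) = mcount a (T i)" .
    qed
    finally show ?case .
  qed
qed

section \<open>Moments over distinct cells determine all joint moments\<close>

lemma (in pd1_multisubset) cell_moment:
  assumes C: "finite C" "C \<noteq> {}" "C \<subseteq> {1..<m}" and S: "\<And>c. c \<in> C \<Longrightarrow> S c \<in> sets borel \<and> S c \<subseteq> cell m c"
    and b: "bij_betw b {..<card C} C"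
  shows "(\<integral>\<^sup>+\<omega>. (\<Prod>c\<in>C. mcount (A \<omega>) (S c)) \<partial>M) = pd1_intensity (card C) (\<lambda>i. S (b i))"
proof -
  have m: "0 < m" using C by auto
  have bC: "b i \<in> C" if "i < card C" for i using b that by (auto simp: bij_betw_def)
  have "(\<integral>\<^sup>+\<omega>. (\<Prod>c\<in>C. mcount (A \<omega>) (S c)) \<partial>M) = (\<integral>\<^sup>+\<omega>. (\<Prod>i<card C. mcount (A \<omega>) (S (b i))) \<partial>M)"
    by (intro nn_integral_cong prod.reindex_bij_betw[symmetric] b)
  also have "\<dots> = pd1_intensity (card C) (\<lambda>i. S (b i))"
  proof (rule moment_eq_intensity[where l="\<lambda>i. real (b i) / real m" and r="\<lambda>i. real (b i + 1) / real m"])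
    show "1 \<le> card C" using C by (simp add: Suc_le_eq card_gt_0_iff)
    show "0 < real (b i) / real m \<and> real (b i + 1) / real m \<le> 1" if "i < card C" for i
      using bC[OF that] C(3) m by (auto simp: field_simps)
    show "disjoint_family_on (\<lambda>i. {real (b i) / real m<..real (b i + 1) / real m}) {..<card C}"
      unfolding cell_def[symmetric] disjoint_family_on_def
    proof (intro ballI impI)
      fix i j assume "i \<in> {..<card C}" "j \<in> {..<card C}" "i \<noteq> j"
      then have "b i \<noteq> b j" using b by (auto simp: bij_betw_def inj_on_def)
      then show "cell m (b i) \<inter> cell m (b j) = {}" using disjoint_cells[OF m, of UNIV] by (auto simp: disjoint_family_on_def)
    qed
    show "S (b i) \<in> sets borel \<and> S (b i) \<subseteq> {real (b i) / real m<..real (b i + 1) / real m}" if "i < card C" for i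
      using S[OF bC[OF that]] by (simp add: cell_def)
  qed
  finally show ?thesis .
qed

text \<open>Both sides equal the same intensity, which involves neither \<open>A\<close> nor
  \<open>B\<close>. The empty product is separate, since the intensities start at
  \<open>k = 1\<close>.\<close>

lemma cell_moment_unique:
  assumes "pd1_multisubset M A" "pd1_multisubset N B" and C: "finite C" "C \<subseteq> {1..<m}"
    and S: "\<And>c. c \<in> C \<Longrightarrow> S c \<in> sets borel \<and> S c \<subseteq> cell m c"
  shows "(\<integral>\<^sup>+\<omega>. (\<Prod>c\<in>C. mcount (A \<omega>) (S c)) \<partial>M) = (\<integral>\<^sup>+\<omega>. (\<Prod>c\<in>C. mcount (B \<omega>) (S c)) \<partial>N)"
proof -
  interpret A: pd1_multisubset M A by fact
  interpret B: pd1_multisubset N B by fact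
  show ?thesis
  proof (cases "C = {}")
    case False
    obtain b where b: "bij_betw b {..<card C} C"
      using ex_bij_betw_nat_finite[OF C(1)] by (auto simp: atLeast0LessThan)
    show ?thesis using A.cell_moment[OF C(1) False C(2) S b] B.cell_moment[OF C(1) False C(2) S b] by simp
  qed (simp add: A.emeasure_space_1 B.emeasure_space_1)
qed

lemma (in pd1_multisubset) coarse_moment_measurable [measurable]:
  assumes [measurable]: "\<And>i. i \<in> I \<Longrightarrow> T i \<in> sets borel" and I: "finite I"
  shows "(\<lambda>\<omega>. coarse_moment (A \<omega>) I T n) \<in> borel_measurable M"
  unfolding coarse_moment_def
proof (intro borel_measurable_sum borel_measurable_prod_ennreal mcount_measurable)
  fix j c assume "j \<in> I \<rightarrow>\<^sub>E {1..<n}" "c \<in> j ` I"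
  then have "c \<in> {1..<n}" by (auto simp: PiE_iff)
  from cell_subset[OF this] show "{x \<in> cell n c. \<forall>i\<in>I. j i = c \<longrightarrow> x \<in> T i} \<subseteq> {0<..1}" by auto
  show "{x \<in> cell n c. \<forall>i\<in>I. j i = c \<longrightarrow> x \<in> T i} \<in> sets borel" using I by measurable
qed

text \<open>Dominated convergence with the limit itself as majorant. It is here that the absence of
  multiple points enters the computation of moments.\<close>

lemma (in pd1_multisubset) coarse_moment_tendsto:
  assumes I: "finite I" and e: "0 < e" and T: "\<And>i. i \<in> I \<Longrightarrow> T i \<in> sets borel \<and> T i \<subseteq> {e..1}"
  shows "(\<lambda>n. \<integral>\<^sup>+\<omega>. coarse_moment (A \<omega>) I T (Suc n) \<partial>M) \<longlonglongrightarrow> (\<integral>\<^sup>+\<omega>. (\<Prod>i\<in>I. mcount (A \<omega>) (T i)) \<partial>M)"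
proof (rule nn_integral_dominated_convergence[where w="\<lambda>\<omega>. \<Prod>i\<in>I. mcount (A \<omega>) (T i)"])
  have T01: "T i \<subseteq> {0<..1}" if "i \<in> I" for i using T[OF that] e by force
  show "(\<lambda>\<omega>. \<Prod>i\<in>I. mcount (A \<omega>) (T i)) \<in> borel_measurable M"
    using T T01 by (intro borel_measurable_prod_ennreal mcount_measurable) auto
  then show "(\<lambda>\<omega>. \<Prod>i\<in>I. mcount (A \<omega>) (T i)) \<in> borel_measurable M" .
  show "(\<lambda>\<omega>. coarse_moment (A \<omega>) I T (Suc n)) \<in> borel_measurable M" for n
    using T I by (intro coarse_moment_measurable) auto
  show "AE \<omega> in M. coarse_moment (A \<omega>) I T (Suc n) \<le> (\<Prod>i\<in>I. mcount (A \<omega>) (T i))" for n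
    by (intro AE_I2 coarse_moment_le I) simp
  show "(\<integral>\<^sup>+\<omega>. (\<Prod>i\<in>I. mcount (A \<omega>) (T i)) \<partial>M) < \<infinity>"
    using T by (intro moment_finite[OF I e]) auto
  show "AE \<omega> in M. (\<lambda>n. coarse_moment (A \<omega>) I T (Suc n)) \<longlonglongrightarrow> (\<Prod>i\<in>I. mcount (A \<omega>) (T i))"
    using AE_msum_le AE_multiplicity_le_1
  proof eventually_elim
    case (elim \<omega>)
    have "eventually (\<lambda>n. coarse_moment (A \<omega>) I T n = (\<Prod>i\<in>I. mcount (A \<omega>) (T i))) sequentially"
      using elim T by (intro coarse_moment_eventually[OF I e]) auto
    then have "(\<lambda>n. coarse_moment (A \<omega>) I T n) \<longlonglongrightarrow> (\<Prod>i\<in>I. mcount (A \<omega>) (T i))"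
      by (rule tendsto_eventually)
    then show ?case by (rule LIMSEQ_Suc)
  qed
qed

lemma moment_unique:
  assumes MA: "pd1_multisubset M A" and NB: "pd1_multisubset N B"
    and I: "finite I" and e: "0 < e" and T: "\<And>i. i \<in> I \<Longrightarrow> T i \<in> sets borel \<and> T i \<subseteq> {e..1}"
  shows "(\<integral>\<^sup>+\<omega>. (\<Prod>i\<in>I. mcount (A \<omega>) (T i)) \<partial>M) = (\<integral>\<^sup>+\<omega>. (\<Prod>i\<in>I. mcount (B \<omega>) (T i)) \<partial>N)"
proof -
  interpret A: pd1_multisubset M A by fact
  interpret B: pd1_multisubset N B by fact
  have [measurable]: "\<And>i. i \<in> I \<Longrightarrow> T i \<in> sets borel" using T by blast
  have eq: "(\<integral>\<^sup>+\<omega>. coarse_moment (A \<omega>) I T n \<partial>M) = (\<integral>\<^sup>+\<omega>. coarse_moment (B \<omega>) I T n \<partial>N)" for n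
  proof -
    have S: "{x \<in> cell n c. \<forall>i\<in>I. j i = c \<longrightarrow> x \<in> T i} \<in> sets borel" for c and j :: "_ \<Rightarrow> nat"
      using I by measurable
    have sub: "{x \<in> cell n c. \<forall>i\<in>I. j i = c \<longrightarrow> x \<in> T i} \<subseteq> {0<..1}" if "j \<in> I \<rightarrow>\<^sub>E {1..<n}" "c \<in> j ` I" for c j
    proof -
      have "c \<in> {1..<n}" using that by (auto simp: PiE_iff)
      from cell_subset[OF this] show ?thesis by auto
    qed
    have "(\<integral>\<^sup>+\<omega>. coarse_moment (A \<omega>) I T n \<partial>M) =
      (\<Sum>j\<in>I \<rightarrow>\<^sub>E {1..<n}. \<integral>\<^sup>+\<omega>. (\<Prod>c\<in>j ` I. mcount (A \<omega>) {x \<in> cell n c. \<forall>i\<in>I. j i = c \<longrightarrow> x \<in> T i}) \<partial>M)"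
      unfolding coarse_moment_def using S sub
      by (intro nn_integral_sum borel_measurable_prod_ennreal A.mcount_measurable)
    also have "\<dots> = (\<Sum>j\<in>I \<rightarrow>\<^sub>E {1..<n}. \<integral>\<^sup>+\<omega>. (\<Prod>c\<in>j ` I. mcount (B \<omega>) {x \<in> cell n c. \<forall>i\<in>I. j i = c \<longrightarrow> x \<in> T i}) \<partial>N)"
    proof (intro sum.cong refl cell_moment_unique[OF MA NB, where m=n])
      fix j assume "j \<in> I \<rightarrow>\<^sub>E {1..<n}"
      then show "j ` I \<subseteq> {1..<n}" by auto
    qed (use I S in auto)
    also have "\<dots> = (\<integral>\<^sup>+\<omega>. coarse_moment (B \<omega>) I T n \<partial>N)"
      unfolding coarse_moment_def using S sub
      by (intro nn_integral_sum[symmetric] borel_measurable_prod_ennreal B.mcount_measurable)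
    finally show ?thesis .
  qed
  have "(\<lambda>n. \<integral>\<^sup>+\<omega>. coarse_moment (B \<omega>) I T (Suc n) \<partial>N) \<longlonglongrightarrow> (\<integral>\<^sup>+\<omega>. (\<Prod>i\<in>I. mcount (A \<omega>) (T i)) \<partial>M)"
    unfolding eq[symmetric] by (rule A.coarse_moment_tendsto[OF I e]) (rule T)
  moreover have "(\<lambda>n. \<integral>\<^sup>+\<omega>. coarse_moment (B \<omega>) I T (Suc n) \<partial>N) \<longlonglongrightarrow> (\<integral>\<^sup>+\<omega>. (\<Prod>i\<in>I. mcount (B \<omega>) (T i)) \<partial>N)"
    by (rule B.coarse_moment_tendsto[OF I e]) (rule T)
  ultimately show ?thesis by (rule LIMSEQ_unique)
qed

section \<open>Joint laws of counts\<close>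

lemma sets_Collect_all_less:
  fixes k :: nat
  assumes "\<And>i. i < k \<Longrightarrow> {x \<in> space M. P i x} \<in> sets M"
  shows "{x \<in> space M. \<forall>i<k. P i x} \<in> sets M"
  using sets.sets_Collect_finite_All[of "{..<k}" M P] assms by (simp add: Ball_def)

context pd1_multisubset
begin

text \<open>Expanding the product of linear factors expresses its mean through joint moments. The
  passage to \<open>real\<close> permits negative shifts and loses nothing, as the counts are almost
  surely finite.\<close>

lemma integral_prod_shifted_counts:
  assumes I: "finite I" and e: "0 < e" and T: "\<And>i. i \<in> I \<Longrightarrow> T i \<in> sets borel \<and> T i \<subseteq> {e..1}"
  shows "(\<integral>\<omega>. (\<Prod>i\<in>I. enn2real (mcount (A \<omega>) (T i)) + s i) \<partial>M) =
    (\<Sum>X\<in>Pow I. enn2real (\<integral>\<^sup>+\<omega>. (\<Prod>i\<in>X. mcount (A \<omega>) (T i)) \<partial>M) * (\<Prod>i\<in>I-X. s i))"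
proof -
  have T01: "T i \<subseteq> {0<..1}" if "i \<in> I" for i using T[OF that] e by force
  have meas: "(\<lambda>\<omega>. \<Prod>i\<in>X. enn2real (mcount (A \<omega>) (T i))) \<in> borel_measurable M" if "X \<subseteq> I" for X
    using T T01 that
    by (intro borel_measurable_prod measurable_compose[OF mcount_measurable borel_measurable_enn2real]) auto
  have eq: "AE \<omega> in M. ennreal (\<Prod>i\<in>X. enn2real (mcount (A \<omega>) (T i))) = (\<Prod>i\<in>X. mcount (A \<omega>) (T i))" if X: "X \<subseteq> I" for X
    using AE_mcount_le[OF e]
  proof eventually_elim
    case (elim \<omega>)
    have "ennreal (enn2real (mcount (A \<omega>) (T i))) = mcount (A \<omega>) (T i)" if "i \<in> X" for i
    proof -
      have "mcount (A \<omega>) (T i) \<le> ennreal (1 / e)" using elim T[of i] X that by auto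
      also have "\<dots> < top" by simp
      finally show ?thesis by (rule ennreal_enn2real)
    qed
    then show ?case by (subst prod_ennreal[symmetric]) auto
  qed
  have int: "integrable M (\<lambda>\<omega>. \<Prod>i\<in>X. enn2real (mcount (A \<omega>) (T i)))"
    and val: "(\<integral>\<omega>. (\<Prod>i\<in>X. enn2real (mcount (A \<omega>) (T i))) \<partial>M) = enn2real (\<integral>\<^sup>+\<omega>. (\<Prod>i\<in>X. mcount (A \<omega>) (T i)) \<partial>M)"
    if X: "X \<subseteq> I" for X
  proof -
    have nn: "(\<integral>\<^sup>+\<omega>. ennreal (\<Prod>i\<in>X. enn2real (mcount (A \<omega>) (T i))) \<partial>M) = (\<integral>\<^sup>+\<omega>. (\<Prod>i\<in>X. mcount (A \<omega>) (T i)) \<partial>M)"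
      by (rule nn_integral_cong_AE[OF eq[OF X]])
    have "(\<integral>\<^sup>+\<omega>. (\<Prod>i\<in>X. mcount (A \<omega>) (T i)) \<partial>M) < \<infinity>"
      using T X I e by (intro moment_finite[where e=e]) (auto intro: finite_subset)
    then show "integrable M (\<lambda>\<omega>. \<Prod>i\<in>X. enn2real (mcount (A \<omega>) (T i)))"
      by (intro integrableI_nonneg meas[OF X]) (auto simp: nn intro!: prod_nonneg)
    show "(\<integral>\<omega>. (\<Prod>i\<in>X. enn2real (mcount (A \<omega>) (T i))) \<partial>M) = enn2real (\<integral>\<^sup>+\<omega>. (\<Prod>i\<in>X. mcount (A \<omega>) (T i)) \<partial>M)"
      unfolding nn[symmetric] by (intro integral_eq_nn_integral meas[OF X]) (auto intro!: prod_nonneg)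
  qed
  have "(\<integral>\<omega>. (\<Prod>i\<in>I. enn2real (mcount (A \<omega>) (T i)) + s i) \<partial>M) =
      (\<integral>\<omega>. (\<Sum>X\<in>Pow I. (\<Prod>i\<in>X. enn2real (mcount (A \<omega>) (T i))) * (\<Prod>i\<in>I-X. s i)) \<partial>M)"
    by (simp only: prod_add[OF I])
  also have "\<dots> = (\<Sum>X\<in>Pow I. \<integral>\<omega>. (\<Prod>i\<in>X. enn2real (mcount (A \<omega>) (T i))) * (\<Prod>i\<in>I-X. s i) \<partial>M)"
    using int by (intro Bochner_Integration.integral_sum integrable_mult_left) auto
  also have "\<dots> = (\<Sum>X\<in>Pow I. enn2real (\<integral>\<^sup>+\<omega>. (\<Prod>i\<in>X. mcount (A \<omega>) (T i)) \<partial>M) * (\<Prod>i\<in>I-X. s i))"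
    using val by (intro sum.cong refl) simp
  finally show ?thesis .
qed

text \<open>Lagrange interpolation: the counts on \<open>{e..1}\<close> are integers in \<open>{..K}\<close>.\<close>

lemma prob_counts_eq:
  fixes k :: nat and v :: "nat \<Rightarrow> nat"
  assumes e: "0 < e" and K: "1 / e \<le> real K" and T: "\<And>i. i < k \<Longrightarrow> T i \<in> sets borel \<and> T i \<subseteq> {e..1}"
    and v: "\<And>i. i < k \<Longrightarrow> v i \<le> K"
  shows "prob {\<omega> \<in> space M. \<forall>i<k. mcount (A \<omega>) (T i) = of_nat (v i)} =
    (\<integral>\<omega>. (\<Prod>p\<in>Sigma {..<k} (\<lambda>i. {..K} - {v i}). enn2real (mcount (A \<omega>) (T (fst p))) + (- real (snd p))) \<partial>M) *
    (\<Prod>p\<in>Sigma {..<k} (\<lambda>i. {..K} - {v i}). 1 / (real (v (fst p)) - real (snd p)))"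
    (is "prob ?E = (\<integral>\<omega>. ?P \<omega> \<partial>M) * ?c")
proof -
  \<comment> \<open>Pairs of a coordinate \<open>i\<close> and a value \<open>u\<close> other than
    \<open>v i\<close>. The product of the factors \<open>(N i - u) / (v i - u)\<close> is
    \<open>1\<close> if the counts equal \<open>v\<close> and \<open>0\<close> for any other vector
    with entries in \<open>{..K}\<close>.\<close>
  let ?J = "Sigma {..<k} (\<lambda>i. {..K} - {v i})"
  have T01: "T i \<subseteq> {0<..1}" if "i < k" for i using T[OF that] e by force
  have meas: "(\<lambda>\<omega>. mcount (A \<omega>) (T i)) \<in> borel_measurable M" if "i < k" for i
    using T[OF that] T01[OF that] by (intro mcount_measurable) auto
  have E: "?E \<in> sets M"
    by (rule sets_Collect_all_less, rule borel_measurable_eq, rule meas) auto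
  have "prob ?E = (\<integral>\<omega>. indicator ?E \<omega> \<partial>M)"
    unfolding Bochner_Integration.integral_indicator by (rule arg_cong[where f=prob]) blast
  also have "\<dots> = (\<integral>\<omega>. ?P \<omega> * ?c \<partial>M)"
  proof (rule integral_cong_AE)
    show "AE \<omega> in M. indicator ?E \<omega> = ?P \<omega> * ?c"
      using AE_msum_le AE_space
    proof eventually_elim
      case (elim \<omega>)
      have "\<exists>u. mcount (A \<omega>) (T i) = of_nat u \<and> u \<le> K" if i: "i < k" for i
      proof -
        obtain u where u: "mcount (A \<omega>) (T i) = of_nat u" using mcount_of_nat[OF elim(1) e] T[OF i] by blast
        have "mcount (A \<omega>) (T i) \<le> ennreal (1 / e)" using mcount_le_of_msum_le_1[OF elim(1) e] T[OF i] by blast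
        also have "\<dots> \<le> ennreal (real K)" using K by (rule ennreal_leI)
        finally have "u \<le> K" unfolding u by (simp add: ennreal_of_nat_eq_real_of_nat)
        with u show ?thesis by blast
      qed
      then obtain u where u: "\<And>i. i < k \<Longrightarrow> mcount (A \<omega>) (T i) = of_nat (u i) \<and> u i \<le> K" by metis
      have P: "?P \<omega> = (\<Prod>p\<in>?J. real (u (fst p)) - real (snd p))"
        using u by (intro prod.cong refl) (auto simp: ennreal_of_nat_eq_real_of_nat)
      show "indicator ?E \<omega> = ?P \<omega> * ?c"
      proof (cases "\<forall>i<k. u i = v i")
        case True
        then have "\<omega> \<in> ?E" using u elim(2) by auto
        moreover have "?P \<omega> * ?c = (\<Prod>p\<in>?J. (real (u (fst p)) - real (snd p)) * (1 / (real (v (fst p)) - real (snd p))))"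
          unfolding P prod.distrib ..
        moreover have "\<dots> = 1" using True by (intro prod.neutral) auto
        ultimately show ?thesis by simp
      next
        case False
        then obtain i where i: "i < k" "u i \<noteq> v i" by auto
        then have "mcount (A \<omega>) (T i) \<noteq> of_nat (v i)" using u[OF i(1)] by simp
        then have "\<omega> \<notin> ?E" using i by auto
        moreover have "?P \<omega> = 0" unfolding P using i u[OF i(1)]
          by (intro prod_zero finite_SigmaI bexI[of _ "(i, u i)"]) auto
        ultimately show ?thesis by simp
      qed
    qed
    show "(\<lambda>\<omega>. ?P \<omega> * ?c) \<in> borel_measurable M"
      by (intro borel_measurable_times borel_measurable_prod borel_measurable_add
          measurable_compose[OF meas borel_measurable_enn2real] borel_measurable_const) auto
  qed (rule borel_measurable_indicator[OF E])
  also have "\<dots> = (\<integral>\<omega>. ?P \<omega> \<partial>M) * ?c" by simp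
  finally show ?thesis .
qed

text \<open>Almost surely the event is a disjoint union over the finitely many admissible count
  vectors. These are extensional functions, so that distinct vectors differ at some index below
  \<open>k\<close>.\<close>

lemma prob_counts_le:
  fixes k :: nat and c :: "nat \<Rightarrow> ennreal"
  assumes e: "0 < e" and K: "1 / e \<le> real K" and T: "\<And>i. i < k \<Longrightarrow> T i \<in> sets borel \<and> T i \<subseteq> {e..1}"
  shows "prob {\<omega> \<in> space M. \<forall>i<k. mcount (A \<omega>) (T i) \<le> c i} =
    (\<Sum>v\<in>{v \<in> {..<k} \<rightarrow>\<^sub>E {..K}. \<forall>i<k. of_nat (v i) \<le> c i}. prob {\<omega> \<in> space M. \<forall>i<k. mcount (A \<omega>) (T i) = of_nat (v i)})"
proof -
  let ?V = "{v \<in> {..<k} \<rightarrow>\<^sub>E {..K}. \<forall>i<k. of_nat (v i) \<le> c i}"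
  let ?E = "\<lambda>v. {\<omega> \<in> space M. \<forall>i<k. mcount (A \<omega>) (T i) = of_nat (v i)}"
  have T01: "T i \<subseteq> {0<..1}" if "i < k" for i using T[OF that] e by force
  have meas: "(\<lambda>\<omega>. mcount (A \<omega>) (T i)) \<in> borel_measurable M" if "i < k" for i
    using T[OF that] T01[OF that] by (intro mcount_measurable) auto
  have finV: "finite ?V" by (rule finite_subset[of _ "{..<k} \<rightarrow>\<^sub>E {..K}"]) (auto intro: finite_PiE)
  have E: "?E v \<in> sets M" for v
    by (rule sets_Collect_all_less, rule borel_measurable_eq, rule meas) auto
  have le: "{\<omega> \<in> space M. \<forall>i<k. mcount (A \<omega>) (T i) \<le> c i} \<in> sets M"
    by (rule sets_Collect_all_less, rule borel_measurable_le, rule meas) auto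
  have "prob {\<omega> \<in> space M. \<forall>i<k. mcount (A \<omega>) (T i) \<le> c i} = prob (\<Union>v\<in>?V. ?E v)"
  proof (rule finite_measure_eq_AE)
    show "AE \<omega> in M. \<omega> \<in> {\<omega> \<in> space M. \<forall>i<k. mcount (A \<omega>) (T i) \<le> c i} \<longleftrightarrow> \<omega> \<in> (\<Union>v\<in>?V. ?E v)"
      using AE_msum_le
    proof eventually_elim
      case (elim \<omega>)
      show ?case
      proof
        assume \<omega>: "\<omega> \<in> {\<omega> \<in> space M. \<forall>i<k. mcount (A \<omega>) (T i) \<le> c i}"
        have "\<exists>u. mcount (A \<omega>) (T i) = of_nat u \<and> u \<le> K" if i: "i < k" for i
        proof -
          obtain u where u: "mcount (A \<omega>) (T i) = of_nat u" using mcount_of_nat[OF elim(1) e] T[OF i] by blast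
          have "mcount (A \<omega>) (T i) \<le> ennreal (1 / e)" using mcount_le_of_msum_le_1[OF elim(1) e] T[OF i] by blast
          also have "\<dots> \<le> ennreal (real K)" using K by (rule ennreal_leI)
          finally have "u \<le> K" unfolding u by (simp add: ennreal_of_nat_eq_real_of_nat)
          with u show ?thesis by blast
        qed
        then obtain u where u: "\<And>i. i < k \<Longrightarrow> mcount (A \<omega>) (T i) = of_nat (u i) \<and> u i \<le> K" by metis
        then have "restrict u {..<k} \<in> ?V" "\<omega> \<in> ?E (restrict u {..<k})" using \<omega> by auto
        then show "\<omega> \<in> (\<Union>v\<in>?V. ?E v)" by blast
      qed auto
    qed
  qed (rule le, rule sets.finite_UN[OF finV E])
  also have "\<dots> = (\<Sum>v\<in>?V. prob (?E v))"
  proof (rule finite_measure_finite_Union[OF finV])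
    show "?E ` ?V \<subseteq> sets M" by (intro image_subsetI E)
    show "disjoint_family_on ?E ?V"
      unfolding disjoint_family_on_def
    proof (intro ballI impI equals0I)
      fix u v \<omega> assume uv: "u \<in> ?V" "v \<in> ?V" "u \<noteq> v" and "\<omega> \<in> ?E u \<inter> ?E v"
      then have "\<forall>i<k. mcount (A \<omega>) (T i) = of_nat (u i)" "\<forall>i<k. mcount (A \<omega>) (T i) = of_nat (v i)" by blast+
      then have "(of_nat (u i) :: ennreal) = of_nat (v i)" if "i < k" for i using that by metis
      then have "u i = v i" if "i < k" for i using that by (metis of_nat_eq_iff)
      then have "u = v" using uv by (intro PiE_ext[of u "{..<k}" "\<lambda>_. {..K}"]) auto
      with uv show False by simp
    qed
  qed
  finally show ?thesis .
qed

end

lemma prob_counts_le_unique: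
  fixes k :: nat and c :: "nat \<Rightarrow> ennreal"
  assumes MA: "pd1_multisubset M A" and NB: "pd1_multisubset N B"
    and e: "0 < e" and T: "\<And>i. i < k \<Longrightarrow> T i \<in> sets borel \<and> T i \<subseteq> {e..1}"
  shows "measure M {\<omega> \<in> space M. \<forall>i<k. mcount (A \<omega>) (T i) \<le> c i} = measure N {\<omega> \<in> space N. \<forall>i<k. mcount (B \<omega>) (T i) \<le> c i}"
proof -
  interpret A: pd1_multisubset M A by fact
  interpret B: pd1_multisubset N B by fact
  \<comment> \<open>\<open>K\<close> depends on \<open>e\<close> alone, so the same interpolation
    polynomials serve both multisubsets.\<close>
  obtain K where K: "1 / e \<le> real K" using real_arch_simple by blast
  have shifted: "(\<integral>\<omega>. (\<Prod>p\<in>J. enn2real (mcount (A \<omega>) (T (fst p))) + s p) \<partial>M) =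
    (\<integral>\<omega>. (\<Prod>p\<in>J. enn2real (mcount (B \<omega>) (T (fst p))) + s p) \<partial>N)"
    if J: "finite J" "fst ` J \<subseteq> {..<k}" for J :: "(nat \<times> nat) set" and s
  proof -
    have TJ: "T (fst p) \<in> sets borel \<and> T (fst p) \<subseteq> {e..1}" if "p \<in> J" for p using T[of "fst p"] J that by auto
    have eq: "(\<integral>\<^sup>+\<omega>. (\<Prod>p\<in>X. mcount (A \<omega>) (T (fst p))) \<partial>M) = (\<integral>\<^sup>+\<omega>. (\<Prod>p\<in>X. mcount (B \<omega>) (T (fst p))) \<partial>N)"
      if "X \<in> Pow J" for X
      using that TJ J by (intro moment_unique[OF MA NB _ e]) (auto intro: finite_subset)
    have "(\<integral>\<omega>. (\<Prod>p\<in>J. enn2real (mcount (A \<omega>) (T (fst p))) + s p) \<partial>M) =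
        (\<Sum>X\<in>Pow J. enn2real (\<integral>\<^sup>+\<omega>. (\<Prod>p\<in>X. mcount (A \<omega>) (T (fst p))) \<partial>M) * (\<Prod>p\<in>J-X. s p))"
      by (rule A.integral_prod_shifted_counts[OF J(1) e]) (rule TJ)
    also have "\<dots> = (\<Sum>X\<in>Pow J. enn2real (\<integral>\<^sup>+\<omega>. (\<Prod>p\<in>X. mcount (B \<omega>) (T (fst p))) \<partial>N) * (\<Prod>p\<in>J-X. s p))"
      by (intro sum.cong refl) (simp only: eq)
    also have "\<dots> = (\<integral>\<omega>. (\<Prod>p\<in>J. enn2real (mcount (B \<omega>) (T (fst p))) + s p) \<partial>N)"
      by (rule B.integral_prod_shifted_counts[OF J(1) e, symmetric]) (rule TJ)
    finally show ?thesis .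
  qed
  let ?V = "{v \<in> {..<k} \<rightarrow>\<^sub>E {..K}. \<forall>i<k. of_nat (v i) \<le> c i}"
  have "measure M {\<omega> \<in> space M. \<forall>i<k. mcount (A \<omega>) (T i) \<le> c i} =
      (\<Sum>v\<in>?V. measure M {\<omega> \<in> space M. \<forall>i<k. mcount (A \<omega>) (T i) = of_nat (v i)})"
    by (rule A.prob_counts_le[OF e K]) (rule T)
  also have "\<dots> = (\<Sum>v\<in>?V. measure N {\<omega> \<in> space N. \<forall>i<k. mcount (B \<omega>) (T i) = of_nat (v i)})"
  proof (intro sum.cong refl)
    fix v assume v: "v \<in> ?V"
    then have vK: "v i \<le> K" if "i < k" for i using that by (auto simp: PiE_iff)
    let ?J = "Sigma {..<k} (\<lambda>i. {..K} - {v i})"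
    let ?c = "\<Prod>p\<in>?J. 1 / (real (v (fst p)) - real (snd p))"
    have "measure M {\<omega> \<in> space M. \<forall>i<k. mcount (A \<omega>) (T i) = of_nat (v i)} =
        (\<integral>\<omega>. (\<Prod>p\<in>?J. enn2real (mcount (A \<omega>) (T (fst p))) + (- real (snd p))) \<partial>M) * ?c"
      by (rule A.prob_counts_eq[OF e K]) (use T vK in auto)
    also have "\<dots> = (\<integral>\<omega>. (\<Prod>p\<in>?J. enn2real (mcount (B \<omega>) (T (fst p))) + (- real (snd p))) \<partial>N) * ?c"
      by (subst shifted) auto
    also have "\<dots> = measure N {\<omega> \<in> space N. \<forall>i<k. mcount (B \<omega>) (T i) = of_nat (v i)}"
      by (rule B.prob_counts_eq[OF e K, symmetric]) (use T vK in auto)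
    finally show "measure M {\<omega> \<in> space M. \<forall>i<k. mcount (A \<omega>) (T i) = of_nat (v i)} =
        measure N {\<omega> \<in> space N. \<forall>i<k. mcount (B \<omega>) (T i) = of_nat (v i)}" .
  qed
  also have "\<dots> = measure N {\<omega> \<in> space N. \<forall>i<k. mcount (B \<omega>) (T i) \<le> c i}"
    by (rule B.prob_counts_le[OF e K, symmetric]) (rule T)
  finally show ?thesis .
qed

text \<open>Counts on truncated sets increase to the full count, which may be infinite, so the
  events with upper bounds \<open>c i\<close> decrease. This is why laws are compared through
  \<open>\<le>\<close>, an event that passes to the limit, rather than through exact values.\<close>

lemma (in pd1_multisubset) prob_counts_le_tendsto:
  fixes k :: nat and c :: "nat \<Rightarrow> ennreal"
  assumes S: "\<And>i. i < k \<Longrightarrow> S i \<in> sets borel \<and> S i \<subseteq> {0<..1}"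
  shows "(\<lambda>n. prob {\<omega> \<in> space M. \<forall>i<k. mcount (A \<omega>) (S i \<inter> {inverse (real (Suc n))..1}) \<le> c i})
    \<longlonglongrightarrow> prob {\<omega> \<in> space M. \<forall>i<k. mcount (A \<omega>) (S i) \<le> c i}"
proof -
  let ?T = "\<lambda>n i. S i \<inter> {inverse (real (Suc n))..1}"
  let ?E = "\<lambda>n. {\<omega> \<in> space M. \<forall>i<k. mcount (A \<omega>) (?T n i) \<le> c i}"
  have inc: "?T n i \<subseteq> ?T m i" if "n \<le> m" for n m i
  proof -
    have "inverse (real (Suc m)) \<le> inverse (real (Suc n))" using that by (intro le_imp_inverse_le) auto
    then have "{inverse (real (Suc n))..1} \<subseteq> {inverse (real (Suc m))..1}" by (simp del: of_nat_Suc)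
    then show ?thesis by blast
  qed
  have "?E n \<in> sets M" for n
  proof -
    have "(\<lambda>\<omega>. mcount (A \<omega>) (?T n i)) \<in> borel_measurable M" if "i < k" for i
      using S[OF that] by (intro mcount_measurable) auto
    then show ?thesis by (intro sets_Collect_all_less borel_measurable_le borel_measurable_const)
  qed
  moreover have "decseq ?E"
  proof (unfold decseq_def, intro allI impI subsetI CollectI conjI)
    fix n m \<omega> i assume nm: "n \<le> m" and \<omega>: "\<omega> \<in> ?E m" and i: "i < k"
    have "mcount (A \<omega>) (?T n i) \<le> mcount (A \<omega>) (?T m i)" by (rule mcount_mono[OF inc[OF nm]])
    also have "\<dots> \<le> c i" using \<omega> i by blast
    finally show "mcount (A \<omega>) (?T n i) \<le> c i" .
  qed blast
  ultimately have "(\<lambda>n. prob (?E n)) \<longlonglongrightarrow> prob (\<Inter>n. ?E n)"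
    by (intro finite_Lim_measure_decseq image_subsetI)
  also have "(\<Inter>n. ?E n) = {\<omega> \<in> space M. \<forall>i<k. mcount (A \<omega>) (S i) \<le> c i}"
  proof -
    have "mcount a (S i) \<le> c i \<longleftrightarrow> (\<forall>n. mcount a (?T n i) \<le> c i)" if i: "i < k" for a i
    proof -
      have "(\<Union>n. ?T n i) = S i"
      proof (intro set_eqI iffI)
        fix x assume x: "x \<in> S i"
        then have "0 < x" "x \<le> 1" using S[OF i] by auto
        moreover from this obtain n where "inverse (real (Suc n)) < x" using reals_Archimedean by blast
        ultimately have "x \<in> ?T n i" using x by simp
        then show "x \<in> (\<Union>n. ?T n i)" by blast
      qed auto
      moreover have "(SUP n. mcount a (?T n i)) = mcount a (\<Union>n. ?T n i)"
        unfolding mcount_eq_emeasure using inc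
        by (intro SUP_emeasure_incseq) (auto simp: incseq_def)
      ultimately have "mcount a (S i) = (SUP n. mcount a (?T n i))" by simp
      then show ?thesis by (simp add: SUP_le_iff)
    qed
    then show ?thesis by blast
  qed
  finally show ?thesis .
qed

section \<open>Laws on finite products are determined by lower boxes\<close>

lemma borel_ennreal_eq_sigma_atMost: "borel = sigma UNIV (range (atMost :: ennreal \<Rightarrow> ennreal set))"
proof (rule borel_eq_sigmaI1[OF borel_Ioi])
  fix X :: "ennreal set" assume "X \<in> range greaterThan"
  then obtain c where X: "X = {c<..}" by auto
  have "UNIV - {..c} \<in> sigma_sets UNIV (range atMost)" by (intro sigma_sets.Compl sigma_sets.Basic) simp
  moreover have "UNIV - {..c} = {c<..}" by auto
  ultimately show "X \<in> sets (sigma UNIV (range atMost))" unfolding X by simp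
qed auto

lemma measure_eqI_PiM_ennreal_atMost:
  fixes P Q :: "(nat \<Rightarrow> ennreal) measure"
  assumes P: "prob_space P" "sets P = sets (PiM {..<k} (\<lambda>_. borel))"
    and Q: "prob_space Q" "sets Q = sets (PiM {..<k} (\<lambda>_. borel))"
    and eq: "\<And>c. emeasure P (\<Pi>\<^sub>E i\<in>{..<k}. {..c i}) = emeasure Q (\<Pi>\<^sub>E i\<in>{..<k}. {..c i})"
  shows "P = Q"
proof -
  define E where "E = {{f \<in> {..<k} \<rightarrow>\<^sub>E UNIV. \<forall>i\<in>j. f i \<in> B i} | B j. j \<in> {{..<k}} \<and> B \<in> Pi j (\<lambda>_. range (atMost :: ennreal \<Rightarrow> _))}"
  have PiE: "{f \<in> {..<k} \<rightarrow>\<^sub>E UNIV. \<forall>i\<in>{..<k}. f i \<in> B i} = Pi\<^sub>E {..<k} B" for B :: "nat \<Rightarrow> ennreal set"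
    by (rule set_eqI, unfold mem_Collect_eq PiE_iff) blast
  have E: "X \<in> E \<longleftrightarrow> (\<exists>c. X = (\<Pi>\<^sub>E i\<in>{..<k}. {..c i}))" for X
  proof
    assume "X \<in> E"
    then obtain B where B: "B \<in> {..<k} \<rightarrow> range atMost" "X = {f \<in> {..<k} \<rightarrow>\<^sub>E UNIV. \<forall>i\<in>{..<k}. f i \<in> B i}"
      by (auto simp: E_def)
    have "\<forall>i\<in>{..<k}. \<exists>c. B i = {..c}" using B by auto
    then obtain c where "\<forall>i\<in>{..<k}. B i = {..c i}" by metis
    then have "X = (\<Pi>\<^sub>E i\<in>{..<k}. {..c i})" unfolding B PiE by (intro PiE_cong) blast
    then show "\<exists>c. X = (\<Pi>\<^sub>E i\<in>{..<k}. {..c i})" by (intro exI[of _ c])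
  next
    assume "\<exists>c. X = (\<Pi>\<^sub>E i\<in>{..<k}. {..c i})"
    then obtain c where "X = (\<Pi>\<^sub>E i\<in>{..<k}. {..c i})" by (rule exE)
    then have "X = {f \<in> {..<k} \<rightarrow>\<^sub>E UNIV. \<forall>i\<in>{..<k}. f i \<in> {..c i}}" by (simp only: PiE)
    then show "X \<in> E" unfolding E_def
      by (intro CollectI exI[of _ "\<lambda>i. {..c i}"] exI[of _ "{..<k}"] conjI) simp_all
  qed
  have E_Pow: "E \<subseteq> Pow ({..<k} \<rightarrow>\<^sub>E UNIV)" unfolding E_def by blast
  have "sets (PiM {..<k} (\<lambda>_. sigma UNIV (range (atMost :: ennreal \<Rightarrow> _)))) = sets (sigma ({..<k} \<rightarrow>\<^sub>E UNIV) E)"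
    unfolding E_def
  proof (rule sets_PiM_sigma)
    show "\<exists>S\<subseteq>range (atMost :: ennreal \<Rightarrow> _). countable S \<and> UNIV = \<Union>S"
      by (intro exI[of _ "{{..top}}"]) auto
  qed auto
  also have "\<dots> = sigma_sets ({..<k} \<rightarrow>\<^sub>E UNIV) E" by (rule sets_measure_of[OF E_Pow])
  finally have sigma: "sets (PiM {..<k} (\<lambda>_. borel :: ennreal measure)) = sigma_sets ({..<k} \<rightarrow>\<^sub>E UNIV) E"
    unfolding borel_ennreal_eq_sigma_atMost .
  show ?thesis
  proof (rule measure_eqI_generator_eq)
    show "Int_stable E"
    proof (rule Int_stableI)
      fix X Y assume "X \<in> E" "Y \<in> E"
      then obtain c d where "X = (\<Pi>\<^sub>E i\<in>{..<k}. {..c i})" "Y = (\<Pi>\<^sub>E i\<in>{..<k}. {..d i})" unfolding E by blast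
      then have "X \<inter> Y = (\<Pi>\<^sub>E i\<in>{..<k}. {..min (c i) (d i)})" by (simp only: PiE_Int Int_atMost)
      then show "X \<inter> Y \<in> E" by (intro E[THEN iffD2] exI[of _ "\<lambda>i. min (c i) (d i)"])
    qed
    show "E \<subseteq> Pow ({..<k} \<rightarrow>\<^sub>E UNIV)" by (rule E_Pow)
    show "emeasure P X = emeasure Q X" if X: "X \<in> E" for X
    proof -
      obtain c where "X = (\<Pi>\<^sub>E i\<in>{..<k}. {..c i})" using E[THEN iffD1, OF X] by (rule exE)
      then show ?thesis using eq[of c] by simp
    qed
    show "sets P = sigma_sets ({..<k} \<rightarrow>\<^sub>E UNIV) E" "sets Q = sigma_sets ({..<k} \<rightarrow>\<^sub>E UNIV) E"
      using P(2) Q(2) sigma by simp_all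
    \<comment> \<open>Since \<open>top\<close> is a value of \<open>ennreal\<close>, the whole space
      is itself a lower box and needs no exhaustion.\<close>
    have top: "({..<k} \<rightarrow>\<^sub>E UNIV) = (\<Pi>\<^sub>E i\<in>{..<k}. {..top :: ennreal})"
      by (rule PiE_cong) (auto simp: atMost_def)
    show "range (\<lambda>_::nat. {..<k} \<rightarrow>\<^sub>E UNIV) \<subseteq> E" 
      using E[THEN iffD2, OF exI[of _ "\<lambda>_. top"], OF top] by (intro image_subsetI)
    show "(\<Union>_::nat. {..<k} \<rightarrow>\<^sub>E UNIV) = {..<k} \<rightarrow>\<^sub>E UNIV" by simp
    interpret prob_space P by fact
    show "emeasure P ({..<k} \<rightarrow>\<^sub>E UNIV) \<noteq> \<infinity>" by simp
  qed
qed

lemma vimage_restrict_PiE_atMost: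
  fixes k :: nat
  shows "(\<lambda>\<omega>. \<lambda>i\<in>{..<k}. g \<omega> i) -` (\<Pi>\<^sub>E i\<in>{..<k}. {..c i}) \<inter> X = {\<omega> \<in> X. \<forall>i<k. g \<omega> i \<le> c i}"
proof (intro set_eqI iffI)
  fix \<omega> assume "\<omega> \<in> (\<lambda>\<omega>. \<lambda>i\<in>{..<k}. g \<omega> i) -` (\<Pi>\<^sub>E i\<in>{..<k}. {..c i}) \<inter> X"
  then have \<omega>: "(\<lambda>i\<in>{..<k}. g \<omega> i) \<in> (\<Pi>\<^sub>E i\<in>{..<k}. {..c i})" "\<omega> \<in> X" by blast+
  have "g \<omega> i \<le> c i" if "i < k" for i using PiE_mem[OF \<omega>(1), of i] that by simp
  with \<omega> show "\<omega> \<in> {\<omega> \<in> X. \<forall>i<k. g \<omega> i \<le> c i}" by blast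
next
  fix \<omega> assume \<omega>: "\<omega> \<in> {\<omega> \<in> X. \<forall>i<k. g \<omega> i \<le> c i}"
  have "(\<lambda>i\<in>{..<k}. g \<omega> i) \<in> (\<Pi>\<^sub>E i\<in>{..<k}. {..c i})"
  proof (rule restrict_PiE_iff[THEN iffD2], rule ballI)
    fix i assume "i \<in> {..<k}"
    then have "i < k" by simp
    then have "g \<omega> i \<le> c i" using \<omega> by blast
    then show "g \<omega> i \<in> {..c i}" by simp
  qed
  with \<omega> show "\<omega> \<in> (\<lambda>\<omega>. \<lambda>i\<in>{..<k}. g \<omega> i) -` (\<Pi>\<^sub>E i\<in>{..<k}. {..c i}) \<inter> X" by blast
qed

lemma same_distribution_of_pd1:
  assumes MA: "pd1_multisubset M A" and NB: "pd1_multisubset N B"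
  shows "same_distribution M A N B"
  unfolding same_distribution_def
proof (intro allI impI)
  fix k :: nat and S :: "nat \<Rightarrow> real set"
  assume S: "\<forall>i<k. S i \<in> sets borel \<and> S i \<subseteq> {0<..1}"
  interpret A: pd1_multisubset M A by fact
  interpret B: pd1_multisubset N B by fact
  have mA: "(\<lambda>\<omega>. \<lambda>i\<in>{..<k}. mcount (A \<omega>) (S i)) \<in> measurable M (PiM {..<k} (\<lambda>_. borel))"
    using S by (intro measurable_restrict A.mcount_measurable) auto
  have mB: "(\<lambda>\<omega>. \<lambda>i\<in>{..<k}. mcount (B \<omega>) (S i)) \<in> measurable N (PiM {..<k} (\<lambda>_. borel))"
    using S by (intro measurable_restrict B.mcount_measurable) auto
  show "distr M (PiM {..<k} (\<lambda>_. borel)) (\<lambda>\<omega>. \<lambda>i\<in>{..<k}. mcount (A \<omega>) (S i)) =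
        distr N (PiM {..<k} (\<lambda>_. borel)) (\<lambda>\<omega>. \<lambda>i\<in>{..<k}. mcount (B \<omega>) (S i))"
  proof (rule measure_eqI_PiM_ennreal_atMost)
    fix c :: "nat \<Rightarrow> ennreal"
    have X: "(\<Pi>\<^sub>E i\<in>{..<k}. {..c i}) \<in> sets (PiM {..<k} (\<lambda>_. borel))" by (rule sets_PiM_I_finite) auto
    have "emeasure (distr M (PiM {..<k} (\<lambda>_. borel)) (\<lambda>\<omega>. \<lambda>i\<in>{..<k}. mcount (A \<omega>) (S i))) (\<Pi>\<^sub>E i\<in>{..<k}. {..c i})
        = emeasure M {\<omega> \<in> space M. \<forall>i<k. mcount (A \<omega>) (S i) \<le> c i}"
      unfolding emeasure_distr[OF mA X] vimage_restrict_PiE_atMost ..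
    also have "\<dots> = emeasure N {\<omega> \<in> space N. \<forall>i<k. mcount (B \<omega>) (S i) \<le> c i}"
      unfolding A.emeasure_eq_measure B.emeasure_eq_measure
    proof (rule arg_cong[where f=ennreal])
      have eq: "measure M {\<omega> \<in> space M. \<forall>i<k. mcount (A \<omega>) (S i \<inter> {inverse (real (Suc n))..1}) \<le> c i} =
          measure N {\<omega> \<in> space N. \<forall>i<k. mcount (B \<omega>) (S i \<inter> {inverse (real (Suc n))..1}) \<le> c i}" for n
        using S by (intro prob_counts_le_unique[OF MA NB, of "inverse (real (Suc n))"]) auto
      have "(\<lambda>n. measure N {\<omega> \<in> space N. \<forall>i<k. mcount (B \<omega>) (S i \<inter> {inverse (real (Suc n))..1}) \<le> c i})
          \<longlonglongrightarrow> measure M {\<omega> \<in> space M. \<forall>i<k. mcount (A \<omega>) (S i) \<le> c i}"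
        unfolding eq[symmetric] using S by (intro A.prob_counts_le_tendsto) auto
      moreover have "(\<lambda>n. measure N {\<omega> \<in> space N. \<forall>i<k. mcount (B \<omega>) (S i \<inter> {inverse (real (Suc n))..1}) \<le> c i})
          \<longlonglongrightarrow> measure N {\<omega> \<in> space N. \<forall>i<k. mcount (B \<omega>) (S i) \<le> c i}"
        using S by (intro B.prob_counts_le_tendsto) auto
      ultimately show "measure M {\<omega> \<in> space M. \<forall>i<k. mcount (A \<omega>) (S i) \<le> c i} =
          measure N {\<omega> \<in> space N. \<forall>i<k. mcount (B \<omega>) (S i) \<le> c i}"
        by (rule LIMSEQ_unique)
    qed
    also have "\<dots> = emeasure (distr N (PiM {..<k} (\<lambda>_. borel)) (\<lambda>\<omega>. \<lambda>i\<in>{..<k}. mcount (B \<omega>) (S i))) (\<Pi>\<^sub>E i\<in>{..<k}. {..c i})"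
      unfolding emeasure_distr[OF mB X] vimage_restrict_PiE_atMost ..
    finally show "emeasure (distr M (PiM {..<k} (\<lambda>_. borel)) (\<lambda>\<omega>. \<lambda>i\<in>{..<k}. mcount (A \<omega>) (S i))) (\<Pi>\<^sub>E i\<in>{..<k}. {..c i}) =
        emeasure (distr N (PiM {..<k} (\<lambda>_. borel)) (\<lambda>\<omega>. \<lambda>i\<in>{..<k}. mcount (B \<omega>) (S i))) (\<Pi>\<^sub>E i\<in>{..<k}. {..c i})" .
  qed (use A.prob_space_distr[OF mA] B.prob_space_distr[OF mB] in simp_all)
qed

theorem corollary1:
  shows "(random_multisubset (poisson_dirichlet 1) multisubset_of_seq \<and>
          \<P>(X in poisson_dirichlet 1. msum (multisubset_of_seq X) \<le> 1) = 1 \<and>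
          (\<forall>k\<ge>1. has_multi_intensity_density (poisson_dirichlet 1) multisubset_of_seq k (pd1_density k))) \<and>
         (\<forall>(M :: 'a measure) A.
            random_multisubset M A \<longrightarrow>
            \<P>(\<omega> in M. msum (A \<omega>) \<le> 1) = 1 \<longrightarrow>
            (\<forall>k\<ge>1. has_multi_intensity_density M A k (pd1_density k)) \<longrightarrow>
            same_distribution M A (poisson_dirichlet 1) multisubset_of_seq)"
proof -
  interpret pd: prob_space "poisson_dirichlet 1" by (rule prob_space_poisson_dirichlet)
  have msum: "\<P>(X in poisson_dirichlet 1. msum (multisubset_of_seq X) \<le> 1) = 1"
    using AE_msum_poisson_dirichlet by (subst pd.prob_Collect_eq_1) measurable
  have pd: "pd1_multisubset (poisson_dirichlet 1) multisubset_of_seq"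
    by (intro pd1_multisubset.intro pd1_multisubset_axioms.intro pd.prob_space_axioms
        random_multisubset_poisson_dirichlet AE_msum_poisson_dirichlet poisson_dirichlet_multi_intensity)
  have "same_distribution M A (poisson_dirichlet 1) multisubset_of_seq"
    if "random_multisubset M A" "\<P>(\<omega> in M. msum (A \<omega>) \<le> 1) = 1"
      "\<forall>k\<ge>1. has_multi_intensity_density M A k (pd1_density k)" for M :: "'a measure" and A
  proof -
    interpret prob_space M using that(1) by (simp add: random_multisubset_def)
    have "AE \<omega> in M. msum (A \<omega>) \<le> 1" using AE_prob_1[OF that(2)] by eventually_elim simp
    then have "pd1_multisubset M A"
      using that by (intro pd1_multisubset.intro pd1_multisubset_axioms.intro prob_space_axioms) auto
    then show ?thesis using pd by (rule same_distribution_of_pd1)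
  qed
  with msum show ?thesis
    by (simp add: random_multisubset_poisson_dirichlet poisson_dirichlet_multi_intensity)
qed

end
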